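(* Let $\mathfrak g$ be a simple Lie algebra of lacing number $r\in\{2,3\}$. For every dominant monomial $m\in\widetilde{\mathcal Y}_{t,q}^L$ there is a unique $F(m)\in\mathfrak K^L$ such that $m$ is the unique dominant monomial of $F(m)$.
   Context: Parameters: $q,t\in\mathbb C^\times$ are not roots of unity, $q^{\mathbb Z}\cap t^{\mathbb Z}=\{1\}$, $\epsilon=e^{i\pi/r}$, and $\mathcal C=q^{\mathbb Z}t^{\mathbb Z}$ (free abelian on $q,t$). For $a=q^lt^m\in\mathcal C$ put $\Pi_q(a)=q^l$, $\Pi_t(a)=\epsilon^lt^m$. $C=(C_{i,j})_{i,j\in I}$ is the Cartan matrix of $\mathfrak g$; $r_iC_{i,j}=r_jC_{j,i}$ with $\min r_i=1$, $\max r_i=r$; $q_i=q^{r_i}$; $r_i^\vee=1+r-r_i$; $\mathcal Y_q=\mathbb Z[Y_{i,a}^{\pm1}]_{i\in I,a\in q^{\mathbb Z}}$; $\mathcal Y_t^L=\mathbb Z[Z_{i,a^{r_i^\vee}}^{\pm1}]_{i\in I,a\in\epsilon^{\mathbb Z}t^{\mathbb Z}}$. Let $\gamma$ be an indeterminate (written $\alpha^L$ in the paper if $r=2$, $\beta^L$ if $r=3$; it specializes to $1$ at $q=\epsilon$ and to $0$ at $t=1$). Case $r=2$. $I_k=\{i:r_i=k\}$, $I_1^\vee=I_2$, $I_2^\vee=I_1$. Fix $\phi:I\to\{0,1\}$ with $\phi(i)+\phi(j)=1$ if $C_{i,j}<0$, and $\phi(i)=1$ if $C_{i,j}=-2$ for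 some $j$. Put $X_{i,a}=z_{i,a}$ for $i\in I_2^\vee$, $X_{i,a}=z_{i,aq^{-1}}z_{i,aq}$ for $i\in I_1^\vee$, and $\widetilde B_{i,a}=z_{i,a(q_it)^{-1}}z_{i,aq_it}\prod_{j:C_{i,j}=-1}z_{j,a}^{-1}\prod_{j:C_{i,j}=-2}z_{j,aq^{-1}}^{-1}z_{j,aq}^{-1}$. For $i\in I_1^\vee$, $\mathfrak K_{i,t,q}^L=\mathbb Z[X_{i,a}(1+\gamma\widetilde B_{i,aq^3t}^{-1}+\gamma\widetilde B_{i,aqt}^{-1}+\widetilde B_{i,aq^3t}^{-1}\widetilde B_{i,aqt}^{-1}),\ \gamma z_{i,a}(1+\widetilde B_{i,aq^2t}^{-1}),\ X_{j,a}^{\pm1},\ \gamma z_{j,a}^{\pm1},\ \gamma]_{a\in\mathcal C,j\ne i}$. For $i\in I_2^\vee$, $\mathfrak K_{i,t,q}^L=\mathbb Z[z_{i,a}(1+\widetilde B_{i,aqt}^{-1}),\ X_{j,a}^{\pm1},\ \gamma z_{j,a}^{\pm1},\ \gamma]_{a\in\mathcal C,j\ne i}$. The map $\Pi_t^L$ below uses $z_{i,a}\mapsto Z_{i,(-1)^{1+\phi(i)}\Pi_t(a)^{r_i^\vee}}$. Case $r=3$ ($\mathfrak g=G_2$, $I=\{1,2\}$, $r_1=3$, $r_2=1$). Put $X_{2,a}=z_{2,a}$, $X_{1,a}=z_{1,aq^{-2}}z_{1,a}z_{1,aq^2}$, $\widetilde B_{1,a}=z_{1,a(tq^3)^{-1}}z_{1,atq^3}z_{2,a}^{-1}$,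 $\widetilde B_{2,a}=z_{2,a(qt)^{-1}}z_{2,aqt}z_{1,aq^{-2}}^{-1}z_{1,a}^{-1}z_{1,aq^2}^{-1}$. $\mathfrak K_{1,t,q}^L$ is generated by the elements $X_{1,a}(1+\gamma\widetilde B_{1,aq^5t}^{-1})(1+\gamma\widetilde B_{1,aq^3t}^{-1})(1+\gamma\widetilde B_{1,aqt}^{-1})+(1-\gamma)X_{1,a}\widetilde B_{1,aq^5t}^{-1}\widetilde B_{1,aq^3t}^{-1}\widetilde B_{1,aqt}^{-1}$, $\gamma z_{1,a}(1+\widetilde B_{1,aq^3t}^{-1})$, $z_{2,a}^{\pm1}$, $\gamma$ ($a\in\mathcal C$), and $\mathfrak K_{2,t,q}^L=\mathbb Z[z_{2,a}(1+\widetilde B_{2,aqt}^{-1}),X_{1,a}^{\pm1},\gamma z_{1,a}^{\pm1},\gamma]_{a\in\mathcal C}$. The map $\Pi_t^L$ below uses $z_{1,a}\mapsto Z_{1,-\Pi_t(a)}$, $z_{2,a}\mapsto Z_{2,\Pi_t(a)^3}$. In both cases: $\mathcal Y_{t,q}^L=\mathbb Z[X_{i,a}^{\pm1},\gamma z_{i,a}^{\pm1},\gamma]_{i\in I,a\in\mathcal C}\subset\mathbb Z[z_{i,a}^{\pm1},\gamma]_{i\in I,a\in\mathcal C}$. There are surjective ring homomorphisms $\Pi_t^L:\mathcal Y_{t,q}^L\to\mathcal Y_t^L$, induced by $\gamma\mapsto1$ and the rule for $z_{i,a}$ above, and $\Pi_q^L:\mathcal Y_{t,q}^L\to\mathcal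 Y_q$, given by $\gamma\mapsto0$, $\gamma z_{i,a}^{\pm1}\mapsto0$, $X_{i,a}\mapsto Y_{i,\Pi_q(a)}$. Put $\widetilde{\mathcal Y}_{t,q}^L=\mathcal Y_{t,q}^L/(\ker\Pi_t^L\cap\ker\Pi_q^L)$ (the maps $\Pi_t^L,\Pi_q^L$ descend to it), and let $\mathfrak K^L\subset\widetilde{\mathcal Y}_{t,q}^L$ be the intersection over $i\in I$ of the images of the $\mathfrak K_{i,t,q}^L$. Monomials: a monomial of $\widetilde{\mathcal Y}_{t,q}^L$ is an element of the form $(\lambda+\mu\gamma)M$ with $\lambda,\mu\in\mathbb Z$ and $M$ a monomial in the $z_{i,a}^{\pm1}$. It is dominant if it can be written using only $\gamma$ and nonnegative powers of the $z_{i,a}$. A monomial of $\mathcal Y_q$ or $\mathcal Y_t^L$ is dominant if it involves only nonnegative powers of the variables. Since an element of $\widetilde{\mathcal Y}_{t,q}^L$ is determined by its images under $\Pi_t^L$ and $\Pi_q^L$, "$m$ is the unique dominant monomial of $\chi$" means that no dominant monomial occurs in $\Pi_t^L(\chi)-\Pi_t^L(m)$ nor in $\Pi_q^L(\chi)-\Pi_q^L(m)$. *)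

theory Defs
  imports
    Complex_Main
    "HOL-Library.Poly_Mapping"
    "HOL-Computational_Algebra.Polynomial"
    "HOL-Algebra.QuotRing"
    "HOL-Algebra.Generated_Rings"
    "HOL-Decision_Procs.Algebra_Aux"
begin

text \<open>
  The simple Lie algebra enters only through its Cartan matrix, i.e. an indecomposable
  Cartan matrix of finite type, indexed by a finite type.
\<close>

definition indecomposable_matrix :: "('i::finite \<Rightarrow> 'i \<Rightarrow> int) \<Rightarrow> bool" where
  "indecomposable_matrix C \<longleftrightarrow>
     (\<forall>J. J \<noteq> {} \<and> J \<noteq> UNIV \<longrightarrow> (\<exists>i\<in>J. \<exists>j\<in>-J. C i j \<noteq> 0))"

definition finite_type_cartan_matrix :: "('i::finite \<Rightarrow> 'i \<Rightarrow> int) \<Rightarrow> bool" where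
  "finite_type_cartan_matrix C \<longleftrightarrow>
     (\<forall>i. C i i = 2) \<and>
     (\<forall>i j. i \<noteq> j \<longrightarrow> C i j \<le> 0) \<and>
     (\<forall>i j. C i j = 0 \<longleftrightarrow> C j i = 0) \<and>
     (\<exists>D :: 'i \<Rightarrow> real. (\<forall>i. D i > 0) \<and>
        (\<forall>i j. D i * of_int (C i j) = D j * of_int (C j i)) \<and>
        (\<forall>x :: 'i \<Rightarrow> real. x \<noteq> (\<lambda>_. 0) \<longrightarrow>
           (\<Sum>i\<in>UNIV. \<Sum>j\<in>UNIV. D i * of_int (C i j) * x i * x j) > 0))"

text \<open>
  A Laurent monomial in variables indexed by pairs of a node and a complex number is given by
  its finitely supported exponent vector (written additively), and a Laurent polynomial over
  the integers is a finitely supported function on exponent vectors. The ring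
  \<open>\<int>[z\<^bsub>i,a\<^esub>\<^sup>\<plusminus>\<^sup>1, \<gamma>]\<close> is the ring of polynomials in \<open>\<gamma>\<close> over it. The spectral parameter is not
  restricted by the types; all the rings below are generated by variables with admissible ones.
\<close>

type_synonym 'i expo = "('i \<times> complex) \<Rightarrow>\<^sub>0 int"
type_synonym 'i laurent = "'i expo \<Rightarrow>\<^sub>0 int"

definition nonneg_expo :: "'i expo \<Rightarrow> bool" where
  "nonneg_expo u \<longleftrightarrow> (\<forall>x. 0 \<le> Poly_Mapping.lookup u x)"

definition gam :: "'i laurent poly" where
  "gam = [:0, 1:]"

definition mono :: "'i expo \<Rightarrow> 'i laurent poly" where
  "mono u = [:frag_of u:]"

definition subring_gen :: "'a::comm_ring_1 set \<Rightarrow> 'a ring" where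
  "subring_gen H = cring_class_ops\<lparr>carrier := generate_ring cring_class_ops H\<rparr>"

text \<open>
  The standing assumptions: \<open>C\<close> is the Cartan matrix, \<open>d i\<close> is the integer \<open>r\<^sub>i\<close>, \<open>r\<close> the lacing
  number and \<open>phi\<close> the auxiliary function \<open>I \<rightarrow> {0, 1}\<close>, which is used only for \<open>r = 2\<close>. For
  \<open>r \<in> {2, 3}\<close> the values of \<open>d\<close> are 1 and \<open>r\<close>, and \<open>r - k + 1\<close> is the value dual to \<open>k\<close>, so
  that \<open>I\<^sub>1\<^sup>\<or>\<close> is the set of nodes with \<open>d i = r\<close> and, for \<open>r = 2\<close>, \<open>I\<^sub>2\<^sup>\<or>\<close> the set of
  those with \<open>d i = 1\<close>. For \<open>r = 3\<close> the matrix is of type \<open>G\<^sub>2\<close>, and the nodes called 1 and 2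
  in the literature are those with \<open>d i = 3\<close> and \<open>d i = 1\<close>.
\<close>

locale langlands_setting =
  fixes C :: "'i::finite \<Rightarrow> 'i \<Rightarrow> int"
    and d :: "'i \<Rightarrow> nat"
    and r :: nat
    and q t :: complex
    and phi :: "'i \<Rightarrow> nat"
  assumes cartan: "finite_type_cartan_matrix C" "indecomposable_matrix C"
    and symm: "\<And>i j. int (d i) * C i j = int (d j) * C j i"
    and min_d: "Min (range d) = 1"
    and max_d: "Max (range d) = r"
    and q_nz: "q \<noteq> 0" and t_nz: "t \<noteq> 0"
    and q_generic: "\<And>n. n > 0 \<Longrightarrow> q ^ n \<noteq> 1"
    and t_generic: "\<And>n. n > 0 \<Longrightarrow> t ^ n \<noteq> 1"
    and qt_generic: "(range (\<lambda>l::int. q powi l)) \<inter> (range (\<lambda>m::int. t powi m)) = {1}"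
    and phi_range: "r = 2 \<Longrightarrow> phi i \<in> {0, 1}"
    and phi_adj: "r = 2 \<Longrightarrow> C i j < 0 \<Longrightarrow> phi i + phi j = 1"
    and phi_double: "r = 2 \<Longrightarrow> C i j = -2 \<Longrightarrow> phi i = 1"
begin

definition eps :: complex where
  "eps = cis (pi / real r)"

definition dual_d :: "'i \<Rightarrow> nat" where
  "dual_d i = 1 + r - d i"

definition CC :: "complex set" where
  "CC = {q powi l * t powi m | l m. True}"

definition qt_exponents :: "complex \<Rightarrow> int \<times> int" where
  "qt_exponents a = (THE lm. a = q powi fst lm * t powi snd lm)"

definition spec_q :: "complex \<Rightarrow> complex" where
  "spec_q a = q powi fst (qt_exponents a)"

definition spec_t :: "complex \<Rightarrow> complex" where
  "spec_t a = eps powi fst (qt_exponents a) * t powi snd (qt_exponents a)"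

text \<open>Exponent vectors of \<open>z\<^bsub>i,a\<^esub>\<close>, \<open>X\<^bsub>i,a\<^esub>\<close> and \<open>B\<^bsub>i,a\<^esub>\<close> (with tilde).\<close>

definition z_ex :: "'i \<Rightarrow> complex \<Rightarrow> 'i expo" where
  "z_ex i a = frag_of (i, a)"

definition X_ex :: "'i \<Rightarrow> complex \<Rightarrow> 'i expo" where
  "X_ex i a =
     (if d i = 1 then z_ex i a
      else if d i = 2 then z_ex i (a / q) + z_ex i (a * q)
      else z_ex i (a / q^2) + z_ex i a + z_ex i (a * q^2))"

definition B_ex :: "'i \<Rightarrow> complex \<Rightarrow> 'i expo" where
  "B_ex i a = z_ex i (a / (q ^ d i * t)) + z_ex i (a * q ^ d i * t)
     - (\<Sum>j | C i j = -1. z_ex j a)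
     - (\<Sum>j | C i j = -2. z_ex j (a / q) + z_ex j (a * q))
     - (\<Sum>j | C i j = -3. z_ex j (a / q^2) + z_ex j a + z_ex j (a * q^2))"

abbreviation z :: "'i \<Rightarrow> complex \<Rightarrow> 'i laurent poly" where
  "z i a \<equiv> mono (z_ex i a)"

abbreviation z_inv :: "'i \<Rightarrow> complex \<Rightarrow> 'i laurent poly" where
  "z_inv i a \<equiv> mono (- z_ex i a)"

abbreviation X :: "'i \<Rightarrow> complex \<Rightarrow> 'i laurent poly" where
  "X i a \<equiv> mono (X_ex i a)"

abbreviation X_inv :: "'i \<Rightarrow> complex \<Rightarrow> 'i laurent poly" where
  "X_inv i a \<equiv> mono (- X_ex i a)"

abbreviation B_inv :: "'i \<Rightarrow> complex \<Rightarrow> 'i laurent poly" where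
  "B_inv i a \<equiv> mono (- B_ex i a)"

definition Y_tq :: "'i laurent poly ring" where
  "Y_tq = subring_gen
     (\<Union>i. \<Union>a\<in>CC. {X i a, X_inv i a, gam * z i a, gam * z_inv i a, gam})"

definition Y_q :: "'i laurent ring" where
  "Y_q = subring_gen
     (\<Union>i. \<Union>l::int. {frag_of (z_ex i (q powi l)), frag_of (- z_ex i (q powi l))})"

definition Y_t :: "'i laurent ring" where
  "Y_t = subring_gen
     (\<Union>i. \<Union>l::int. \<Union>m::int. let b = (eps powi l * t powi m) ^ dual_d i in
        {frag_of (z_ex i b), frag_of (- z_ex i b)})"

text \<open>The map \<open>Pi_t\<close> sends \<open>z\<^bsub>i,a\<^esub>\<close> to \<open>Z\<^bsub>i,b\<^esub>\<close> with \<open>b = Z_param i a\<close>.\<close>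

definition Z_param :: "'i \<Rightarrow> complex \<Rightarrow> complex" where
  "Z_param i a =
     (if r = 2 then (-1) ^ (1 + phi i) * spec_t a ^ dual_d i
      else if d i = 3 then - spec_t a
      else spec_t a ^ 3)"

text \<open>
  Both maps are defined as substitutions on the ambient ring; \<^const>\<open>frag_extend\<close>
  is linear extension over the integers. For \<open>Pi_q\<close> one sets \<open>\<gamma> = 0\<close>; on
  the subring \<open>Y_tq\<close> the result is a polynomial in the algebraically independent \<open>X\<^bsub>i,a\<^esub>\<^sup>\<plusminus>\<^sup>1\<close>, so that
  the exponents with respect to the \<open>X\<^bsub>i,a\<^esub>\<close> can be recovered from those with respect to
  the \<open>z\<^bsub>i,a\<^esub>\<close>.
\<close>

definition Pi_t :: "'i laurent poly \<Rightarrow> 'i laurent" where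
  "Pi_t p = frag_extend (\<lambda>u. frag_of (frag_extend (\<lambda>(i, a). z_ex i (Z_param i a)) u)) (poly p 1)"

definition X_to_z :: "'i expo \<Rightarrow> 'i expo" where
  "X_to_z e = frag_extend (\<lambda>(i, a). X_ex i a) e"

definition z_to_X :: "'i expo \<Rightarrow> 'i expo" where
  "z_to_X = inv_into {e. Poly_Mapping.keys e \<subseteq> UNIV \<times> CC} X_to_z"

definition Pi_q :: "'i laurent poly \<Rightarrow> 'i laurent" where
  "Pi_q p = frag_extend
     (\<lambda>u. frag_of (frag_extend (\<lambda>(i, a). z_ex i (spec_q a)) (z_to_X u))) (poly p 0)"

definition Ker_tq :: "'i laurent poly set" where
  "Ker_tq = a_kernel Y_tq Y_t Pi_t \<inter> a_kernel Y_tq Y_q Pi_q"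

definition Y_tilde :: "'i laurent poly set ring" where
  "Y_tilde = Y_tq Quot Ker_tq"

definition Pi_t_tilde :: "'i laurent poly set \<Rightarrow> 'i laurent" where
  "Pi_t_tilde x = the_elem (Pi_t ` x)"

definition Pi_q_tilde :: "'i laurent poly set \<Rightarrow> 'i laurent" where
  "Pi_q_tilde x = the_elem (Pi_q ` x)"

text \<open>
  The element \<open>\<gamma>\<^sup>2 - \<gamma>\<close> is in the kernel, so \<open>\<gamma>\<close> is idempotent in the quotient, and
  expressions in \<open>\<gamma>\<close> and the \<open>z\<^bsub>i,a\<^esub>\<^sup>\<plusminus>\<^sup>1\<close> denote elements of the quotient modulo this
  relation. This matters because such an expression need not be literally in \<open>Y_tq\<close>: for
  generic \<open>a, b\<close> the product of \<open>\<gamma> z\<^bsub>i,a\<^esub>\<close> and \<open>\<gamma> z\<^bsub>i,b\<^esub>\<close> is in \<open>Y_tq\<close>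
  but \<open>\<gamma> z\<^bsub>i,a\<^esub> z\<^bsub>i,b\<^esub>\<close> is not, and the terms \<open>\<gamma> X\<^bsub>i,a\<^esub> B\<^bsub>i,aqt\<^esub>\<^sup>-\<^sup>1\<close>
  in the generators of \<open>K_i\<close> are of the latter kind. An expression \<open>p\<close> has at most one value.
\<close>

definition denotes :: "'i laurent poly \<Rightarrow> 'i laurent poly set \<Rightarrow> bool" where
  "denotes p x \<longleftrightarrow> x \<in> carrier Y_tilde \<and> (\<exists>y\<in>x. (gam^2 - gam) dvd (p - y))"

text \<open>
  The three cases are \<open>r\<close> arbitrary, \<open>r = 2\<close> and \<open>r = 3\<close>. For \<open>r = 3\<close> and \<open>d i = 3\<close> the generators
  \<open>\<gamma> z\<^bsub>j,a\<^esub>\<^sup>\<plusminus>\<^sup>1\<close> are redundant, because \<open>X\<^bsub>j,a\<^esub> = z\<^bsub>j,a\<^esub>\<close>.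
\<close>

definition K_i :: "'i \<Rightarrow> 'i laurent poly set" where
  "K_i i = generate_ring cring_class_ops (
     (if d i = 1 then
        (\<Union>a\<in>CC. {z i a * (1 + B_inv i (a * q * t))})
      else if d i = 2 then
        (\<Union>a\<in>CC.
          {X i a * (1 + gam * B_inv i (a * q^3 * t) + gam * B_inv i (a * q * t)
                      + B_inv i (a * q^3 * t) * B_inv i (a * q * t)),
           gam * z i a * (1 + B_inv i (a * q^2 * t))})
      else
        (\<Union>a\<in>CC.
          {X i a * (1 + gam * B_inv i (a * q^5 * t)) * (1 + gam * B_inv i (a * q^3 * t))
                 * (1 + gam * B_inv i (a * q * t))
             + (1 - gam) * X i a * B_inv i (a * q^5 * t) * B_inv i (a * q^3 * t)
                 * B_inv i (a * q * t),
           gam * z i a * (1 + B_inv i (a * q^3 * t))}))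
     \<union> (\<Union>j\<in>-{i}. \<Union>a\<in>CC. {X j a, X_inv j a, gam * z j a, gam * z_inv j a})
     \<union> {gam})"

definition K_L :: "'i laurent poly set set" where
  "K_L = (\<Inter>i. {x. \<exists>p\<in>K_i i. denotes p x})"

definition is_monomial :: "'i laurent poly set \<Rightarrow> bool" where
  "is_monomial m \<longleftrightarrow> (\<exists>(lam::int) (mu::int) u. denotes ((of_int lam + of_int mu * gam) * mono u) m)"

definition is_dominant_monomial :: "'i laurent poly set \<Rightarrow> bool" where
  "is_dominant_monomial m \<longleftrightarrow> is_monomial m \<and>
     (\<exists>p\<in>generate_ring cring_class_ops (insert gam (\<Union>i. \<Union>a\<in>CC. {z i a})). denotes p m)"

text \<open>
  The images of a dominant monomial need not be dominant: for \<open>d i = 2\<close> the monomial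
  \<open>z\<^bsub>i,aq\<^sup>-\<^sup>1\<^esub> z\<^bsub>i,aq\<^sup>5\<^esub> = X\<^bsub>i,a\<^esub> X\<^bsub>i,aq\<^sup>2\<^esub>\<^sup>-\<^sup>1 X\<^bsub>i,aq\<^sup>4\<^esub>\<close> is dominant, its image under
  \<open>Pi_q\<close> is not. Only the differences are constrained.
\<close>

definition is_unique_dominant_monomial_of ::
  "'i laurent poly set \<Rightarrow> 'i laurent poly set \<Rightarrow> bool" where
  "is_unique_dominant_monomial_of m x \<longleftrightarrow>
     (\<forall>u. nonneg_expo u \<longrightarrow>
        u \<notin> Poly_Mapping.keys (Pi_t_tilde x - Pi_t_tilde m) \<and>
        u \<notin> Poly_Mapping.keys (Pi_q_tilde x - Pi_q_tilde m))"

end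

end

theory Submission
  imports Defs "HOL-Analysis.Analysis"
begin

text \<open>
  An element of the quotient ring is the same thing as the pair of its images under \<open>Pi_t\<close> and
  \<open>Pi_q\<close>, and since \<open>\<gamma>\<close> is an idempotent contained in every \<open>K_i\<close>, the statement splits
  into two independent ones. Each of them concerns a Laurent polynomial ring in which \<open>K_i\<close> is
  generated by the \<open>Y\<^sub>x (1 + A\<^sub>x\<^sup>-\<^sup>1)\<close> for the variables \<open>x\<close> of node \<open>i\<close> and by the other
  variables and their inverses; on the \<open>q\<close>-side these are the \<open>q\<close>-characters of an untwisted and
  on the \<open>t\<close>-side those of the dual twisted quantum affine algebra.

  Uniqueness holds because the highest monomials of an element of \<open>K_i\<close> are \<open>i\<close>-dominant.
  For existence one computes the coefficients of \<open>F m\<close> layer by layer below \<open>m\<close>: a coefficient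
  at a non-dominant monomial is forced by any \<open>i\<close> for which the monomial is not \<open>i\<close>-dominant.
  That different \<open>i\<close> give the same value is a question in rank two. There the nodes are
  first split into orbits of the shift of the spectral parameter, which leaves only
  one type of interaction, for which the fundamental elements can be written down uniformly.
  The algorithm stops because the norm of the weights does not increase below \<open>m\<close>.
\<close>

section \<open>Group rings of free abelian groups\<close>

text \<open>Why orbits: a variable may have \<open>r\<close> neighbours at another node, and the two
  sides differ in the direction in which this happens. On the \<open>q\<close>-side the
  \<open>d i div d j\<close> short neighbours of a long variable form one string inside a single
  orbit. On the \<open>t\<close>-side the \<open>r\<close> long neighbours of a short variable
  differ by \<open>r\<close>-th roots of unity and lie in \<open>r\<close> different orbits, so that
  two interacting orbits always look like type A2. Both are instances of \<open>pattern\<close>,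
  where \<open>s + 1\<close> is the length of the string.

  Why the process ends: there are infinitely many variables, so only weights can give a bound. The
  norm does not increase because a step from an \<open>i\<close>-dominant monomial goes down its
  root string no further than the reflected weight. A ball of weights bounds the depth (by
  \<open>B\<close>) as well as the length of a root string (by \<open>B'\<close>). The computed
  coefficients therefore vanish between the depths \<open>B\<close> and \<open>B + B'\<close>, and
  cutting there leaves an error that would have to jump over a gap longer than any string.\<close>

abbreviation lookup where "lookup \<equiv> Poly_Mapping.lookup"
abbreviation keys where "keys \<equiv> Poly_Mapping.keys"

lemma frag_of_add: "frag_of (u + v :: 'a::monoid_add) = frag_of u * frag_of v"
  by (simp add: mult_single)

text \<open>Multiplicativity of \<open>E\<close> is demanded on the supports only: the standard
  monomials are multiplicative for dominant exponents, and the specialization at \<open>q\<close>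
  for exponents that are monomials in the \<open>X_ex i a\<close>.\<close>

lemma frag_extend_mult:
  fixes f g :: "'a::monoid_add \<Rightarrow>\<^sub>0 int" and E :: "'a \<Rightarrow> ('b::comm_monoid_add \<Rightarrow>\<^sub>0 int)"
  assumes "\<And>a b. a \<in> keys f \<Longrightarrow> b \<in> keys g \<Longrightarrow> E (a + b) = E a * E b"
  shows "frag_extend E (f * g) = frag_extend E f * frag_extend E g"
proof -
  have "frag_extend E (x * g) = frag_extend E x * frag_extend E g" if "keys x \<subseteq> keys f" for x
    using that
  proof (induction x rule: frag_induction)
    case (one a)
    have "frag_extend E (frag_of a * y) = E a * frag_extend E y" if "keys y \<subseteq> keys g" for y
      using that
    proof (induction y rule: frag_induction)
      case (one b)
      then show ?case using assms[OF \<open>a \<in> keys f\<close>, of b] by (simp flip: frag_of_add)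
    qed (simp_all add: right_diff_distrib frag_extend_diff)
    then show ?case by simp
  qed (simp_all add: left_diff_distrib frag_extend_diff)
  then show ?thesis by simp
qed

lemma lookup_frag_extend:
  "lookup (frag_extend E f) u = (\<Sum>m\<in>keys f. lookup f m * lookup (E m) u)"
  by (simp add: frag_extend_def lookup_sum)

lemma keys_frag_extendD:
  assumes "u \<in> keys (frag_extend E f)"
  obtains m where "m \<in> keys f" "u \<in> keys (E m)"
  using keys_frag_extend assms by fast

lemma keys_multD:
  fixes f g :: "'a::monoid_add \<Rightarrow>\<^sub>0 int"
  assumes "u \<in> keys (f * g)"
  obtains a b where "a \<in> keys f" "b \<in> keys g" "u = a + b"
  using keys_mult assms by fast

lemma keys_addD: "u \<in> keys (f + g) \<Longrightarrow> u \<in> keys f \<or> u \<in> keys g"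
  using keys_add by fast

lemma keys_diffD: "u \<in> keys (f - g) \<Longrightarrow> u \<in> keys f \<or> u \<in> keys g"
  using keys_diff by fast

text \<open>The common step of the triangular eliminations below. \<open>T v\<close> is meant to
  have leading monomial \<open>v\<close>: the leading parts remove from \<open>f\<close> everything
  on \<open>D\<close>, and only the lower terms of the \<open>T v\<close> are added.\<close>

lemma keys_subtract_leading:
  assumes D: "finite D" and u: "u \<in> keys (f - (\<Sum>v\<in>D. frag_cmul (lookup f v) (T v)))"
  shows "u \<in> keys f \<and> u \<notin> D \<or> (\<exists>v\<in>D. v \<in> keys f \<and> u \<in> keys (T v - frag_of v))"
proof -
  let ?g = "\<Sum>v\<in>D. frag_cmul (lookup f v) (frag_of v)"
  let ?h = "\<Sum>v\<in>D. frag_cmul (lookup f v) (T v - frag_of v)"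
  have "(\<Sum>v\<in>D. frag_cmul (lookup f v) (T v)) = ?g + ?h"
    unfolding sum.distrib[symmetric] frag_cmul_distrib2[symmetric] by simp
  then have "u \<in> keys ((f - ?g) - ?h)"
    using u by (simp add: diff_diff_eq)
  from keys_diffD[OF this] show ?thesis
  proof
    assume *: "u \<in> keys (f - ?g)"
    have "lookup ?g u = (\<Sum>v\<in>D. if u = v then lookup f v else 0)"
      unfolding lookup_sum by (rule sum.cong) auto
    also have "\<dots> = (if u \<in> D then lookup f u else 0)" using D by simp
    finally show ?thesis using * by (auto simp: in_keys_iff lookup_minus split: if_splits)
  next
    assume "u \<in> keys ?h"
    then obtain v where "v \<in> D" "u \<in> keys (frag_cmul (lookup f v) (T v - frag_of v))"
      using keys_sum[of "\<lambda>v. frag_cmul (lookup f v) (T v - frag_of v)" D] by blast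
    then show ?thesis by (auto simp: in_keys_iff)
  qed
qed

section \<open>Linear functionals on exponent vectors and restriction to a set of variables\<close>

definition vlin :: "('v \<Rightarrow> 'a::comm_ring_1) \<Rightarrow> ('v \<Rightarrow>\<^sub>0 int) \<Rightarrow> 'a" where
  "vlin \<phi> u = (\<Sum>x\<in>keys u. of_int (lookup u x) * \<phi> x)"

lemma vlin_superset:
  "finite W \<Longrightarrow> keys u \<subseteq> W \<Longrightarrow> vlin \<phi> u = (\<Sum>x\<in>W. of_int (lookup u x) * \<phi> x)"
  unfolding vlin_def by (rule sum.mono_neutral_left) (auto simp: in_keys_iff)

lemma vlin_add [simp]: "vlin \<phi> (u + v) = vlin \<phi> u + vlin \<phi> v"
proof -
  let ?W = "keys u \<union> keys v"
  have "vlin \<phi> (u + v) = (\<Sum>x\<in>?W. of_int (lookup (u + v) x) * \<phi> x)"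
    by (rule vlin_superset) (use keys_add[of u v] in auto)
  also have "\<dots> = (\<Sum>x\<in>?W. of_int (lookup u x) * \<phi> x) + (\<Sum>x\<in>?W. of_int (lookup v x) * \<phi> x)"
    by (simp add: lookup_add distrib_right sum.distrib)
  also have "\<dots> = vlin \<phi> u + vlin \<phi> v"
    by (subst (1 2) vlin_superset[of ?W]) auto
  finally show ?thesis .
qed

lemma vlin_zero [simp]: "vlin \<phi> 0 = 0"
  by (simp add: vlin_def)

lemma vlin_minus [simp]: "vlin \<phi> (- u) = - vlin \<phi> u"
  by (simp add: vlin_def sum_negf)

lemma vlin_diff [simp]: "vlin \<phi> (u - v) = vlin \<phi> u - vlin \<phi> v"
  using vlin_add[of \<phi> u "- v"] by simp

lemma vlin_frag_of [simp]: "vlin \<phi> (frag_of x) = \<phi> x"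
  by (simp add: vlin_def)

lemma vlin_sum [simp]: "vlin \<phi> (\<Sum>k\<in>I. g k) = (\<Sum>k\<in>I. vlin \<phi> (g k))"
  by (induction I rule: infinite_finite_induct) simp_all

definition vpart :: "'v set \<Rightarrow> ('v \<Rightarrow>\<^sub>0 int) \<Rightarrow> ('v \<Rightarrow>\<^sub>0 int)" where
  "vpart S = frag_extend (\<lambda>x. if x \<in> S then frag_of x else 0)"

lemma lookup_vpart: "lookup (vpart S u) x = (if x \<in> S then lookup u x else 0)"
proof -
  have "lookup (vpart S u) x = (\<Sum>y\<in>keys u. if y = x then (if x \<in> S then lookup u x else 0) else 0)"
    unfolding vpart_def lookup_frag_extend by (rule sum.cong) auto
  also have "\<dots> = (if x \<in> S then lookup u x else 0)"
    by (auto simp: in_keys_iff)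
  finally show ?thesis .
qed

lemma vpart_zero [simp]: "vpart S 0 = 0"
  and vpart_add [simp]: "vpart S (u + v) = vpart S u + vpart S v"
  and vpart_diff [simp]: "vpart S (u - v) = vpart S u - vpart S v"
  and vpart_minus [simp]: "vpart S (- u) = - vpart S u"
  by (simp_all add: vpart_def frag_extend_add frag_extend_diff frag_extend_minus)

lemma vpart_sum [simp]: "vpart S (\<Sum>k\<in>I. g k) = (\<Sum>k\<in>I. vpart S (g k))"
  by (induction I rule: infinite_finite_induct) simp_all

lemma vpart_frag_of [simp]: "vpart S (frag_of x) = (if x \<in> S then frag_of x else 0)"
  by (simp add: vpart_def)

lemma vpart_eq_0_iff: "vpart S u = 0 \<longleftrightarrow> keys u \<inter> S = {}"
  by (auto simp: poly_mapping_eq_iff fun_eq_iff lookup_vpart in_keys_iff)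

lemma vpart_Compl: "vpart (- S) u + vpart S u = u"
  by (rule poly_mapping_eqI) (simp add: lookup_add lookup_vpart)

subsection \<open>Generated subrings\<close>

abbreviation gring :: "'a::comm_ring_1 set \<Rightarrow> 'a set" where
  "gring \<equiv> generate_ring cring_class_ops"

lemma gring_1 [simp, intro]: "1 \<in> gring H"
  using generate_ring.one[of cring_class_ops H] by (simp add: one_class)

lemma gring_incl: "h \<in> H \<Longrightarrow> h \<in> gring H"
  by (rule generate_ring.incl)

lemma gring_uminus: "h \<in> gring H \<Longrightarrow> - h \<in> gring H"
  using generate_ring.a_inv[of h cring_class_ops H] by (simp add: uminus_class)

lemma gring_add: "h \<in> gring H \<Longrightarrow> h' \<in> gring H \<Longrightarrow> h + h' \<in> gring H"
  using generate_ring.eng_add[of h cring_class_ops H h'] by (simp add: plus_class)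

lemma gring_mult: "h \<in> gring H \<Longrightarrow> h' \<in> gring H \<Longrightarrow> h * h' \<in> gring H"
  using generate_ring.eng_mult[of h cring_class_ops H h'] by (simp add: times_class)

lemma gring_diff: "h \<in> gring H \<Longrightarrow> h' \<in> gring H \<Longrightarrow> h - h' \<in> gring H"
  using gring_add[of h H "- h'"] gring_uminus[of h' H] by simp

lemma gring_0 [simp, intro]: "0 \<in> gring H"
  using gring_diff[of 1 H 1] by simp

lemma gring_power: "h \<in> gring H \<Longrightarrow> h ^ n \<in> gring H"
  by (induction n) (auto intro: gring_mult)

lemma gring_prod: "(\<And>x. x \<in> I \<Longrightarrow> g x \<in> gring H) \<Longrightarrow> prod g I \<in> gring H"
  by (induction I rule: infinite_finite_induct) (auto intro: gring_mult)

lemma gring_sum: "(\<And>x. x \<in> I \<Longrightarrow> g x \<in> gring H) \<Longrightarrow> sum g I \<in> gring H"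
  by (induction I rule: infinite_finite_induct) (auto intro: gring_add)

lemma gring_induct [consumes 1, case_names one incl uminus add mult]:
  assumes "h \<in> gring H"
    and "P 1"
    and "\<And>h. h \<in> H \<Longrightarrow> P h"
    and "\<And>h. h \<in> gring H \<Longrightarrow> P h \<Longrightarrow> P (- h)"
    and "\<And>h h'. h \<in> gring H \<Longrightarrow> P h \<Longrightarrow> h' \<in> gring H \<Longrightarrow> P h' \<Longrightarrow> P (h + h')"
    and "\<And>h h'. h \<in> gring H \<Longrightarrow> P h \<Longrightarrow> h' \<in> gring H \<Longrightarrow> P h' \<Longrightarrow> P (h * h')"
  shows "P h"
  using assms(1)
proof (induction rule: generate_ring.induct)
  case one
  then show ?case using assms(2) by (simp add: one_class)
qed (use assms(3-) in \<open>auto simp: uminus_class plus_class times_class\<close>)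

lemma gring_subset:
  assumes "H \<subseteq> gring H'"
  shows "gring H \<subseteq> gring H'"
proof
  fix h assume "h \<in> gring H"
  then show "h \<in> gring H'"
    by (induction rule: gring_induct) (use assms in \<open>auto intro: gring_uminus gring_add gring_mult\<close>)
qed

lemma gring_frag_cmul: "h \<in> gring H \<Longrightarrow> frag_cmul k h \<in> gring H"
  by (rule frag_closure_minus_cmul) (auto intro: gring_diff)

lemma gring_frag_extend: "(\<And>m. m \<in> keys g \<Longrightarrow> E m \<in> gring H) \<Longrightarrow> frag_extend E g \<in> gring H"
  unfolding frag_extend_def by (auto intro!: gring_sum gring_frag_cmul)

lemma gring_frag_of:
  fixes \<psi> :: "('b \<Rightarrow>\<^sub>0 int) \<Rightarrow> 'a::ab_group_add"
  assumes "keys u \<subseteq> B" "\<And>u v. \<psi> (u - v) = \<psi> u - \<psi> v"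
    and "\<And>x. x \<in> B \<Longrightarrow> frag_of (\<psi> (frag_of x)) \<in> gring H \<and> frag_of (- \<psi> (frag_of x)) \<in> gring H"
  shows "frag_of (\<psi> u) \<in> gring H"
proof -
  \<comment> \<open>The inverse is carried along because \<open>frag_induction\<close> builds
    exponent vectors by differences.\<close>
  have "frag_of (\<psi> u) \<in> gring H \<and> frag_of (- \<psi> u) \<in> gring H"
    using assms(1)
  proof (induction u rule: frag_induction)
    case zero
    have "\<psi> 0 = 0" using assms(2)[of 0 0] by simp
    then show ?case by simp
  next
    case (diff u v)
    have "frag_of (\<psi> (u - v)) = frag_of (\<psi> u) * frag_of (- \<psi> v)"
      "frag_of (- \<psi> (u - v)) = frag_of (\<psi> v) * frag_of (- \<psi> u)"
      by (simp_all add: assms(2) flip: frag_of_add)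
    then show ?case using diff by (auto intro: gring_mult)
  qed (rule assms(3))
  then show ?thesis ..
qed

lemma gring_keys:
  fixes H :: "('a::ab_group_add \<Rightarrow>\<^sub>0 int) set"
  assumes "f \<in> gring H" "0 \<in> D" "\<And>u v. u \<in> D \<Longrightarrow> v \<in> D \<Longrightarrow> u + v \<in> D"
    and "\<And>h. h \<in> H \<Longrightarrow> keys h \<subseteq> D"
  shows "keys f \<subseteq> D"
  using assms(1)
proof (induction rule: gring_induct)
  case (mult f g)
  show ?case
  proof
    fix u assume "u \<in> keys (f * g)"
    then obtain a b where "a \<in> keys f" "b \<in> keys g" "u = a + b" by (rule keys_multD)
    then show "u \<in> D" using mult.IH assms(3) by auto
  qed
next
  case (add f g)
  then show ?case using keys_add[of f g] by blast
qed (use assms in auto)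

section \<open>The kernels of the screening operators\<close>

definition dominant :: "'v set \<Rightarrow> ('v \<Rightarrow>\<^sub>0 int) \<Rightarrow> bool" where
  "dominant S m \<longleftrightarrow> (\<forall>x\<in>S. 0 \<le> lookup m x)"

definition vdeg :: "'v set \<Rightarrow> ('v \<Rightarrow>\<^sub>0 int) \<Rightarrow> int" where
  "vdeg S = vlin (\<lambda>x. if x \<in> S then 1 else 0)"

lemma vdeg_add [simp]: "vdeg S (u + v) = vdeg S u + vdeg S v"
  and vdeg_diff [simp]: "vdeg S (u - v) = vdeg S u - vdeg S v"
  and vdeg_minus [simp]: "vdeg S (- u) = - vdeg S u"
  and vdeg_zero [simp]: "vdeg S 0 = 0"
  and vdeg_frag_of [simp]: "vdeg S (frag_of x) = (if x \<in> S then 1 else 0)"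
  and vdeg_sum [simp]: "vdeg S (\<Sum>k\<in>I. g k) = (\<Sum>k\<in>I. vdeg S (g k))"
  by (simp_all add: vdeg_def)

lemma vdeg_alt: "vdeg S u = (\<Sum>x\<in>keys u \<inter> S. lookup u x)"
  unfolding vdeg_def vlin_def by (rule sum.mono_neutral_cong_right) auto

lemma vdeg_nonneg: "dominant S m \<Longrightarrow> 0 \<le> vdeg S m"
  unfolding vdeg_alt dominant_def by (rule sum_nonneg) auto

locale screening =
  fixes V :: "'v set" and A :: "'v \<Rightarrow> ('v \<Rightarrow>\<^sub>0 int)"
  assumes keys_A: "x \<in> V \<Longrightarrow> keys (A x) \<subseteq> V"
begin

definition gen :: "'v \<Rightarrow> ('v \<Rightarrow>\<^sub>0 int) \<Rightarrow>\<^sub>0 int" where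
  "gen x = frag_of (frag_of x) + frag_of (frag_of x - A x)"

definition K :: "'v set \<Rightarrow> (('v \<Rightarrow>\<^sub>0 int) \<Rightarrow>\<^sub>0 int) set" where
  "K S = gring (gen ` S \<union> (\<lambda>y. frag_of (frag_of y)) ` (V - S) \<union> (\<lambda>y. frag_of (- frag_of y)) ` (V - S))"

text \<open>In \<open>S\<close>-degree every \<open>A x\<close> behaves like a simple root paired
  with its own coroot. Each factor \<open>A x\<close> that is divided out lowers the
  \<open>S\<close>-degree by exactly 2, so this degree orders the monomials of
  \<open>K S\<close>.\<close>

definition adm :: "'v set \<Rightarrow> bool" where
  "adm S \<longleftrightarrow> S \<subseteq> V \<and> (\<forall>x\<in>S. vdeg S (A x) = 2)"

lemma gen_in_K: "x \<in> S \<Longrightarrow> gen x \<in> K S"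
  unfolding K_def by (rule gring_incl) auto

lemma unit_in_K:
  assumes "keys u \<subseteq> V" "vpart S u = 0"
  shows "frag_of u \<in> K S"
proof -
  have "keys u \<subseteq> V - S"
    using assms vpart_eq_0_iff[of S u] by auto
  then show ?thesis
    unfolding K_def by (rule gring_frag_of[of _ _ "\<lambda>u. u"]) (auto intro: gring_incl)
qed

lemma K_subset:
  assumes "\<And>x. x \<in> S \<Longrightarrow> gen x \<in> K S'" "\<And>y. y \<in> V - S \<Longrightarrow> frag_of (frag_of y) \<in> K S'"
    and "\<And>y. y \<in> V - S \<Longrightarrow> frag_of (- frag_of y) \<in> K S'"
  shows "K S \<subseteq> K S'"
  using assms unfolding K_def by (intro gring_subset) auto

lemma K_add: "f \<in> K S \<Longrightarrow> g \<in> K S \<Longrightarrow> f + g \<in> K S"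
  and K_diff: "f \<in> K S \<Longrightarrow> g \<in> K S \<Longrightarrow> f - g \<in> K S"
  and K_mult: "f \<in> K S \<Longrightarrow> g \<in> K S \<Longrightarrow> f * g \<in> K S"
  and K_0: "0 \<in> K S" and K_1: "1 \<in> K S"
  unfolding K_def by (auto intro: gring_add gring_diff gring_mult)

lemma K_cmul: "f \<in> K S \<Longrightarrow> frag_cmul k f \<in> K S"
  unfolding K_def by (rule gring_frag_cmul)

lemma K_sum: "(\<And>x. x \<in> I \<Longrightarrow> g x \<in> K S) \<Longrightarrow> sum g I \<in> K S"
  unfolding K_def by (rule gring_sum)

lemma K_frag_extend: "(\<And>m. m \<in> keys g \<Longrightarrow> E m \<in> K S) \<Longrightarrow> frag_extend E g \<in> K S"
  unfolding K_def by (rule gring_frag_extend)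

lemma K_keys:
  assumes "f \<in> K S" "S \<subseteq> V" "m \<in> keys f"
  shows "keys m \<subseteq> V"
proof -
  have "keys f \<subseteq> {m. keys m \<subseteq> V}"
  proof (rule gring_keys[OF assms(1)[unfolded K_def]])
    show "u + v \<in> {m. keys m \<subseteq> V}" if "u \<in> {m. keys m \<subseteq> V}" "v \<in> {m. keys m \<subseteq> V}" for u v
      using that keys_add[of u v] by auto
  next
    fix h assume "h \<in> gen ` S \<union> (\<lambda>y. frag_of (frag_of y)) ` (V - S) \<union> (\<lambda>y. frag_of (- frag_of y)) ` (V - S)"
    then show "keys h \<subseteq> {m. keys m \<subseteq> V}"
      using keys_A assms(2) by (fastforce simp: gen_def dest!: keys_addD keys_diffD)
  qed simp
  then show ?thesis using assms(3) by blast
qed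

subsection \<open>Leading monomials\<close>

text \<open>The number of summands is recorded separately, since in this locale it need not be a
  function of the sum. It becomes one through \<open>vdeg\<close> for admissible sets and later
  through \<open>ht\<close>.\<close>

inductive cone :: "'v set \<Rightarrow> nat \<Rightarrow> ('v \<Rightarrow>\<^sub>0 int) \<Rightarrow> bool" for B where
  cone_0: "cone B 0 0"
| cone_Suc: "cone B n a \<Longrightarrow> x \<in> B \<Longrightarrow> cone B (Suc n) (a + A x)"

lemma cone_add: "cone B k b \<Longrightarrow> cone B n a \<Longrightarrow> cone B (n + k) (a + b)"
proof (induction rule: cone.induct)
  case (cone_Suc k b x)
  then show ?case using cone.cone_Suc[of B "n + k" "a + b" x] by (simp add: add.assoc)
qed simp

lemma cone_mono: "cone B n a \<Longrightarrow> B \<subseteq> B' \<Longrightarrow> cone B' n a"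
  by (induction rule: cone.induct) (auto intro: cone.intros)

lemma cone_1: "x \<in> B \<Longrightarrow> cone B 1 (A x)"
  using cone_Suc[OF cone_0, of x B] by simp

lemma cone_0_iff: "cone B 0 a \<longleftrightarrow> a = 0"
  by (auto elim: cone.cases intro: cone_0)

lemma cone_keys: "cone B n a \<Longrightarrow> B \<subseteq> V \<Longrightarrow> keys a \<subseteq> V"
proof (induction rule: cone.induct)
  case (cone_Suc n a x)
  then show ?case using keys_A[of x] keys_add[of a "A x"] by blast
qed simp

lemma cone_vdeg: "cone S n a \<Longrightarrow> adm S \<Longrightarrow> vdeg S a = 2 * int n"
  by (induction rule: cone.induct) (auto simp: adm_def)

text \<open>Monic with leading monomial \<open>m\<close>. The bound \<open>N\<close> on the number
  of steps matters: for \<open>N = nat (vdeg S m)\<close> it says that one goes down a root string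
  at most as far as the reflected weight.\<close>

definition led :: "'v set \<Rightarrow> nat \<Rightarrow> ('v \<Rightarrow>\<^sub>0 int) \<Rightarrow> (('v \<Rightarrow>\<^sub>0 int) \<Rightarrow>\<^sub>0 int) \<Rightarrow> bool" where
  "led B N m f \<longleftrightarrow> (\<forall>m'\<in>keys (f - frag_of m). \<exists>a n. m' = m - a \<and> cone B n a \<and> 1 \<le> n \<and> n \<le> N)"

lemma ledE:
  assumes "led B N m f" "m' \<in> keys (f - frag_of m)"
  obtains a n where "m' = m - a" "cone B n a" "1 \<le> n" "n \<le> N"
  using assms unfolding led_def by blast

lemma led_frag_of: "led B 0 m (frag_of m)"
  by (simp add: led_def)

lemma led_1: "led B 0 0 1"
  using led_frag_of[of B 0] by simp

lemma led_mono: "led B N m f \<Longrightarrow> B \<subseteq> B' \<Longrightarrow> N \<le> N' \<Longrightarrow> led B' N' m f"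
  unfolding led_def by (meson cone_mono le_trans)

lemma led_gen: "x \<in> B \<Longrightarrow> led B 1 (frag_of x) (gen x)"
  unfolding led_def gen_def using cone_1[of x B] by (auto intro!: exI[of _ "A x"] exI[of _ "1::nat"])

lemma led_mult:
  assumes "led B N m f" "led B N' m' f'"
  shows "led B (N + N') (m + m') (f * f')"
  unfolding led_def
proof
  fix u assume "u \<in> keys (f * f' - frag_of (m + m'))"
  moreover have "f * f' - frag_of (m + m') = frag_of m * (f' - frag_of m')
      + (f - frag_of m) * frag_of m' + (f - frag_of m) * (f' - frag_of m')"
    by (simp add: frag_of_add algebra_simps)
  ultimately consider "u \<in> keys (frag_of m * (f' - frag_of m'))"
    | "u \<in> keys ((f - frag_of m) * frag_of m')" | "u \<in> keys ((f - frag_of m) * (f' - frag_of m'))"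
    by (metis keys_addD)
  then show "\<exists>a n. u = m + m' - a \<and> cone B n a \<and> 1 \<le> n \<and> n \<le> N + N'"
  proof cases
    case 1
    then obtain v where "v \<in> keys (f' - frag_of m')" "u = m + v"
      by (auto elim!: keys_multD)
    then show ?thesis using assms(2) by (fastforce simp: led_def)
  next
    case 2
    then obtain v where "v \<in> keys (f - frag_of m)" "u = v + m'"
      by (auto elim!: keys_multD)
    then show ?thesis using assms(1) by (fastforce simp: led_def)
  next
    case 3
    then obtain v w where vw: "v \<in> keys (f - frag_of m)" "w \<in> keys (f' - frag_of m')" "u = v + w"
      by (elim keys_multD)
    obtain a n where a: "v = m - a" "cone B n a" "1 \<le> n" "n \<le> N"
      using assms(1) vw(1) by (rule ledE)
    obtain b k where b: "w = m' - b" "cone B k b" "1 \<le> k" "k \<le> N'"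
      using assms(2) vw(2) by (rule ledE)
    show ?thesis
      using cone_add[OF b(2) a(2)] a b vw(3) by (intro exI[of _ "a + b"] exI[of _ "n + k"]) simp
  qed
qed

lemma frag_cmul_Suc: "frag_cmul (int (Suc n)) f = f + frag_cmul (int n) f"
  by (simp add: frag_cmul_distrib)

lemma led_power: "led B N m f \<Longrightarrow> led B (n * N) (frag_cmul (int n) m) (f ^ n)"
proof (induction n)
  case 0
  then show ?case by (simp add: led_1[simplified])
next
  case (Suc n)
  then show ?case using led_mult[of B N m f] by (simp only: frag_cmul_Suc mult_Suc power_Suc)
qed

lemma led_prod:
  "(\<And>x. x \<in> I \<Longrightarrow> led B (N x) (m x) (f x)) \<Longrightarrow> led B (sum N I) (sum m I) (prod f I)"
proof (induction I rule: infinite_finite_induct)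
  case (insert x F)
  then show ?case by (simp add: led_mult)
qed (simp_all add: led_1[simplified])

text \<open>The standard monomial: a product of generators and units with leading monomial
  \<open>m\<close>. Negative exponents in \<open>S\<close> are truncated by \<open>nat\<close>, so
  that only \<open>S\<close>-dominant \<open>m\<close> are of interest.\<close>

definition E :: "'v set \<Rightarrow> ('v \<Rightarrow>\<^sub>0 int) \<Rightarrow> ('v \<Rightarrow>\<^sub>0 int) \<Rightarrow>\<^sub>0 int" where
  "E S m = frag_of (vpart (- S) m) * (\<Prod>x\<in>keys m \<inter> S. gen x ^ nat (lookup m x))"

lemma E_superset:
  "finite W \<Longrightarrow> keys m \<inter> S \<subseteq> W \<Longrightarrow> W \<subseteq> S \<Longrightarrow>
    E S m = frag_of (vpart (- S) m) * (\<Prod>x\<in>W. gen x ^ nat (lookup m x))"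
  unfolding E_def by (intro arg_cong2[of _ _ _ _ "(*)"] refl prod.mono_neutral_left)
    (auto simp: in_keys_iff)

lemma E_add:
  assumes "dominant S m" "dominant S m'"
  shows "E S (m + m') = E S m * E S m'"
proof -
  define W where "W = (keys m \<union> keys m') \<inter> S"
  have W: "finite W" "keys m \<inter> S \<subseteq> W" "keys m' \<inter> S \<subseteq> W" "keys (m + m') \<inter> S \<subseteq> W" "W \<subseteq> S"
    using keys_add[of m m'] by (auto simp: W_def)
  have "(\<Prod>x\<in>W. gen x ^ nat (lookup (m + m') x))
      = (\<Prod>x\<in>W. gen x ^ nat (lookup m x) * gen x ^ nat (lookup m' x))"
    using assms W(5) by (intro prod.cong refl) (auto simp: dominant_def lookup_add nat_add_distrib power_add)
  then show ?thesis
    using W by (simp add: E_superset[of W] frag_of_add prod.distrib ac_simps)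
qed

lemma E_outside: "vpart S u = 0 \<Longrightarrow> E S u = frag_of u"
  using vpart_Compl[of S u] vpart_eq_0_iff[of S u] by (simp add: E_def)

lemma E_frag_of: "x \<in> S \<Longrightarrow> E S (frag_of x) = gen x"
  by (simp add: E_def)

lemma E_in_K:
  assumes "keys m \<subseteq> V"
  shows "E S m \<in> K S"
proof -
  have "keys (vpart (- S) m) \<subseteq> keys m"
    by (auto simp: in_keys_iff lookup_vpart split: if_splits)
  moreover have "vpart S (vpart (- S) m) = 0"
    by (rule poly_mapping_eqI) (simp add: lookup_vpart)
  ultimately have "frag_of (vpart (- S) m) \<in> K S"
    using assms by (intro unit_in_K) auto
  moreover have "(\<Prod>x\<in>keys m \<inter> S. gen x ^ nat (lookup m x)) \<in> K S"
    unfolding K_def by (intro gring_prod gring_power gring_incl) auto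
  ultimately show ?thesis unfolding E_def by (rule K_mult)
qed

lemma E_led:
  assumes "dominant S m"
  shows "led S (nat (vdeg S m)) m (E S m)"
proof -
  have "led S (\<Sum>x\<in>keys m \<inter> S. nat (lookup m x) * 1)
      (\<Sum>x\<in>keys m \<inter> S. frag_cmul (int (nat (lookup m x))) (frag_of x))
      (\<Prod>x\<in>keys m \<inter> S. gen x ^ nat (lookup m x))"
    by (rule led_prod, rule led_power, rule led_gen) auto
  moreover have "(\<Sum>x\<in>keys m \<inter> S. nat (lookup m x) * 1) = nat (vdeg S m)"
  proof -
    have "int (\<Sum>x\<in>keys m \<inter> S. nat (lookup m x) * 1) = vdeg S m"
      unfolding vdeg_alt int_sum by (rule sum.cong) (use assms in \<open>auto simp: dominant_def\<close>)
    then show ?thesis by linarith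
  qed
  moreover have "(\<Sum>x\<in>keys m \<inter> S. frag_cmul (int (nat (lookup m x))) (frag_of x)) = vpart S m"
    unfolding vpart_def frag_extend_def
    by (rule sum.mono_neutral_cong_left) (use assms in \<open>auto simp: dominant_def\<close>)
  ultimately have "led S (nat (vdeg S m)) (vpart S m) (\<Prod>x\<in>keys m \<inter> S. gen x ^ nat (lookup m x))"
    by simp
  from led_mult[OF led_frag_of this, of "vpart (- S) m"] show ?thesis
    by (simp add: E_def vpart_Compl)
qed

text \<open>The generators of the ring are standard monomials with dominant exponents, and by
  \<open>E_add\<close> products of these are again of this kind.\<close>

lemma K_span:
  assumes "f \<in> K S" "S \<subseteq> V"
  shows "\<exists>g. (\<forall>m\<in>keys g. dominant S m \<and> keys m \<subseteq> V) \<and> f = frag_extend (E S) g"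
  using assms unfolding K_def
proof (induction rule: gring_induct)
  case one
  have "E S 0 = 1"
    by (simp add: E_def)
  then show ?case
    using frag_extend_of[of "E S" 0] by (intro exI[of _ "frag_of 0"]) (simp add: dominant_def)
next
  case (incl h)
  then consider x where "x \<in> S" "h = gen x" | y where "y \<in> V - S" "h = frag_of (frag_of y)"
    | y where "y \<in> V - S" "h = frag_of (- frag_of y)"
    by blast
  then show ?case
  proof cases
    case (1 x)
    then show ?thesis using incl.prems
      by (intro exI[of _ "frag_of (frag_of x)"]) (auto simp: dominant_def E_frag_of)
  next
    case (2 y)
    then show ?thesis
      by (intro exI[of _ "frag_of (frag_of y)"]) (auto simp: dominant_def E_outside)
  next
    case (3 y)
    then show ?thesis
      by (intro exI[of _ "frag_of (- frag_of y)"]) (auto simp: dominant_def E_outside)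
  qed
next
  case (uminus h)
  then obtain g where "\<forall>m\<in>keys g. dominant S m \<and> keys m \<subseteq> V" "h = frag_extend (E S) g" by blast
  then show ?case by (intro exI[of _ "- g"]) (simp add: frag_extend_minus)
next
  case (add h h')
  then obtain g g' where "\<forall>m\<in>keys g. dominant S m \<and> keys m \<subseteq> V" "h = frag_extend (E S) g"
    "\<forall>m\<in>keys g'. dominant S m \<and> keys m \<subseteq> V" "h' = frag_extend (E S) g'" by blast
  then show ?case by (intro exI[of _ "g + g'"]) (auto simp: frag_extend_add dest: keys_addD)
next
  case (mult h h')
  then obtain g g' where g: "\<forall>m\<in>keys g. dominant S m \<and> keys m \<subseteq> V" "h = frag_extend (E S) g"
    "\<forall>m\<in>keys g'. dominant S m \<and> keys m \<subseteq> V" "h' = frag_extend (E S) g'" by blast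
  have "frag_extend (E S) (g * g') = frag_extend (E S) g * frag_extend (E S) g'"
    by (rule frag_extend_mult) (use g in \<open>auto intro: E_add\<close>)
  moreover have "dominant S m \<and> keys m \<subseteq> V" if m: "m \<in> keys (g * g')" for m
  proof -
    obtain a b where ab: "a \<in> keys g" "b \<in> keys g'" "m = a + b"
      using m by (rule keys_multD)
    then have "dominant S a" "keys a \<subseteq> V" "dominant S b" "keys b \<subseteq> V"
      using g by auto
    then show ?thesis
      using keys_add[of a b] ab(3) unfolding dominant_def by (auto simp: lookup_add)
  qed
  ultimately show ?case using g by (intro exI[of _ "g * g'"]) auto
qed

lemma led_lookup_vdeg:
  assumes "led S N m f" "adm S" "vdeg S m \<le> vdeg S m'"
  shows "lookup f m' = (if m' = m then 1 else 0)"
proof -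
  have "m' \<notin> keys (f - frag_of m)"
  proof
    assume "m' \<in> keys (f - frag_of m)"
    with assms(1) obtain a n where "m' = m - a" "cone S n a" "1 \<le> n" by (rule ledE)
    with assms(2,3) show False using cone_vdeg by fastforce
  qed
  then show ?thesis by (auto simp: in_keys_iff lookup_minus split: if_splits)
qed

text \<open>In an expansion into standard monomials take an \<open>m\<close> of largest
  \<open>S\<close>-degree. The other standard monomials have only terms of smaller degree besides
  their own leading ones, so the coefficient of \<open>m\<close> cannot cancel.\<close>

lemma K_has_dominant:
  assumes "f \<in> K S" "adm S" "\<And>m. m \<in> keys f \<Longrightarrow> \<not> dominant S m"
  shows "f = 0"
proof (rule ccontr)
  assume "f \<noteq> 0"
  obtain g where g: "\<And>m. m \<in> keys g \<Longrightarrow> dominant S m" "f = frag_extend (E S) g"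
    using K_span[OF assms(1)] assms(2) unfolding adm_def by blast
  have "keys g \<noteq> {}" using g(2) \<open>f \<noteq> 0\<close> by auto
  then have "Max (vdeg S ` keys g) \<in> vdeg S ` keys g" by (intro Max_in) auto
  then obtain m where m: "m \<in> keys g" "vdeg S m = Max (vdeg S ` keys g)" by fastforce
  have "lookup f m = (\<Sum>m'\<in>keys g. lookup g m' * (if m = m' then 1 else 0))"
    unfolding g(2) lookup_frag_extend
  proof (rule sum.cong)
    fix m' assume m': "m' \<in> keys g"
    then have "vdeg S m' \<le> vdeg S m" unfolding m(2) by (intro Max_ge) auto
    then show "lookup g m' * lookup (E S m') m = lookup g m' * (if m = m' then 1 else 0)"
      using led_lookup_vdeg[OF E_led[OF g(1)[OF m']] assms(2)] by simp
  qed simp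
  also have "\<dots> = lookup g m" using m(1) by (simp add: if_distrib[of "(*) _"] cong: if_cong)
  finally have "m \<in> keys f" using m(1) by (simp add: in_keys_iff)
  then show False using assms(3) g(1) m(1) by blast
qed

text \<open>From the standard monomial subtract the elements already found for its other dominant
  monomials, which have smaller \<open>S\<close>-degree. The bound on the number of steps survives:
  reaching such a monomial by \<open>n\<close> steps costs \<open>2 * n\<close> of the degree, and
  its own element adds at most the degree that remains.\<close>

lemma F_exists:
  assumes "adm S" "dominant S m" "keys m \<subseteq> V"
  shows "\<exists>f\<in>K S. led S (nat (vdeg S m)) m f \<and> (\<forall>m'\<in>keys (f - frag_of m). \<not> dominant S m')"
  using assms(2,3)
proof (induction "nat (vdeg S m)" arbitrary: m rule: less_induct)
  case less
  let ?d = "nat (vdeg S m)"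
  let ?D = "{m' \<in> keys (E S m - frag_of m). dominant S m'}"
  have led: "led S ?d m (E S m)" using less.prems(1) by (rule E_led)
  have low: "\<exists>a n. m' = m - a \<and> cone S n a \<and> 1 \<le> n \<and> nat (vdeg S m') + 2 * n = ?d
      \<and> n \<le> ?d \<and> keys m' \<subseteq> V" if m': "m' \<in> ?D" for m'
  proof -
    obtain a n where a: "m' = m - a" "cone S n a" "1 \<le> n" "n \<le> ?d"
      using led m' by (auto elim: ledE)
    have "vdeg S m' = vdeg S m - 2 * int n" "0 \<le> vdeg S m'"
      using a cone_vdeg[OF a(2) assms(1)] vdeg_nonneg[of S m'] m' by auto
    moreover have "keys m' \<subseteq> V"
      using a(1) cone_keys[OF a(2)] assms(1) less.prems(2) keys_diff[of m a] by (auto simp: adm_def)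
    ultimately show ?thesis using a by (intro exI[of _ a] exI[of _ n]) auto
  qed
  have "\<forall>m'\<in>?D. \<exists>f. f \<in> K S \<and> led S (nat (vdeg S m')) m' f \<and> (\<forall>u\<in>keys (f - frag_of m'). \<not> dominant S u)"
  proof
    fix m' assume m': "m' \<in> ?D"
    obtain n where "1 \<le> n" "nat (vdeg S m') + 2 * n = ?d" "keys m' \<subseteq> V" using low[OF m'] by blast
    then have "nat (vdeg S m') < ?d" by linarith
    from less.hyps[OF this _ \<open>keys m' \<subseteq> V\<close>]
    show "\<exists>f. f \<in> K S \<and> led S (nat (vdeg S m')) m' f \<and> (\<forall>u\<in>keys (f - frag_of m'). \<not> dominant S u)"
      using m' by blast
  qed
  from bchoice[OF this] obtain F where F': "\<forall>m'\<in>?D. F m' \<in> K S \<and> led S (nat (vdeg S m')) m' (F m')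
      \<and> (\<forall>u\<in>keys (F m' - frag_of m'). \<not> dominant S u)" ..
  have F: "\<And>m'. m' \<in> ?D \<Longrightarrow> F m' \<in> K S"
    "\<And>m'. m' \<in> ?D \<Longrightarrow> led S (nat (vdeg S m')) m' (F m')"
    "\<And>m' u. m' \<in> ?D \<Longrightarrow> u \<in> keys (F m' - frag_of m') \<Longrightarrow> \<not> dominant S u"
    using F' by blast+
  define h where "h = E S m - frag_of m"
  define f where "f = E S m - (\<Sum>m'\<in>?D. frag_cmul (lookup h m') (F m'))"
  have "f \<in> K S"
    unfolding f_def using F(1) less.prems(2) by (intro K_diff E_in_K K_sum K_cmul) auto
  have cases: "u \<in> keys h \<and> \<not> dominant S u \<or> (\<exists>m'\<in>?D. u \<in> keys (F m' - frag_of m'))"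
    if "u \<in> keys (f - frag_of m)" for u
  proof -
    have "f - frag_of m = h - (\<Sum>m'\<in>?D. frag_cmul (lookup h m') (F m'))"
      by (simp add: f_def h_def)
    with that have u: "u \<in> keys (h - (\<Sum>m'\<in>?D. frag_cmul (lookup h m') (F m')))" by simp
    show ?thesis
      using keys_subtract_leading[OF _ u] unfolding h_def by auto
  qed
  have "led S ?d m f"
    unfolding led_def
  proof
    fix u assume "u \<in> keys (f - frag_of m)"
    from cases[OF this] show "\<exists>a n. u = m - a \<and> cone S n a \<and> 1 \<le> n \<and> n \<le> ?d"
    proof
      assume "u \<in> keys h \<and> \<not> dominant S u"
      then show ?thesis using led unfolding h_def led_def by blast
    next
      assume "\<exists>m'\<in>?D. u \<in> keys (F m' - frag_of m')"
      then obtain m' where m': "m' \<in> ?D" "u \<in> keys (F m' - frag_of m')" by blast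
      obtain a n where a: "m' = m - a" "cone S n a" "1 \<le> n" "nat (vdeg S m') + 2 * n = ?d"
        using low[OF m'(1)] by blast
      obtain b k where b: "u = m' - b" "cone S k b" "1 \<le> k" "k \<le> nat (vdeg S m')"
        using F(2)[OF m'(1)] m'(2) by (rule ledE)
      show ?thesis
        using a b cone_add[OF b(2) a(2)] by (intro exI[of _ "a + b"] exI[of _ "n + k"]) auto
    qed
  qed
  moreover have "\<forall>u\<in>keys (f - frag_of m). \<not> dominant S u"
    using cases F(3) by blast
  ultimately show ?case using \<open>f \<in> K S\<close> by blast
qed

end

context screening
begin

subsection \<open>Projection onto the kernel of one screening operator\<close>

definition F :: "'v set \<Rightarrow> ('v \<Rightarrow>\<^sub>0 int) \<Rightarrow> ('v \<Rightarrow>\<^sub>0 int) \<Rightarrow>\<^sub>0 int" where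
  "F S m = (SOME f. f \<in> K S \<and> led S (nat (vdeg S m)) m f \<and>
     (\<forall>u\<in>keys (f - frag_of m). \<not> dominant S u))"

lemma F_props:
  assumes "adm S" "dominant S m" "keys m \<subseteq> V"
  shows F_in_K: "F S m \<in> K S"
    and F_led: "led S (nat (vdeg S m)) m (F S m)"
    and F_nondominant: "u \<in> keys (F S m - frag_of m) \<Longrightarrow> \<not> dominant S u"
proof -
  have "\<exists>f. f \<in> K S \<and> led S (nat (vdeg S m)) m f \<and> (\<forall>u\<in>keys (f - frag_of m). \<not> dominant S u)"
    using F_exists[OF assms] by blast
  from someI_ex[OF this] show "F S m \<in> K S" "led S (nat (vdeg S m)) m (F S m)"
    "u \<in> keys (F S m - frag_of m) \<Longrightarrow> \<not> dominant S u"
    unfolding F_def by blast+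
qed

lemma lookup_F_dominant:
  assumes "adm S" "dominant S m" "keys m \<subseteq> V" "dominant S u"
  shows "lookup (F S m) u = (if u = m then 1 else 0)"
proof -
  have "lookup (F S m - frag_of m) u = 0"
    using F_nondominant[OF assms(1-3), of u] assms(4) by (auto simp: in_keys_iff)
  then show ?thesis by (simp add: lookup_minus split: if_splits)
qed

text \<open>For admissible \<open>S\<close> this is the projection onto \<open>K S\<close> along the
  span of the monomials that are not \<open>S\<close>-dominant.\<close>

definition proj :: "'v set \<Rightarrow> (('v \<Rightarrow>\<^sub>0 int) \<Rightarrow>\<^sub>0 int) \<Rightarrow> ('v \<Rightarrow>\<^sub>0 int) \<Rightarrow>\<^sub>0 int" where
  "proj S = frag_extend (\<lambda>m. if dominant S m then F S m else 0)"

text \<open>The defect of \<open>f\<close>. It vanishes exactly on \<open>K S\<close>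
  (\<open>rest_K\<close>, \<open>rest_0_imp_K\<close>) and lives on monomials that are not
  \<open>S\<close>-dominant. Membership in \<open>K S\<close> thus becomes one linear condition for
  each such monomial, and these conditions can be imposed layer by layer.\<close>

definition rest :: "'v set \<Rightarrow> (('v \<Rightarrow>\<^sub>0 int) \<Rightarrow>\<^sub>0 int) \<Rightarrow> ('v \<Rightarrow>\<^sub>0 int) \<Rightarrow>\<^sub>0 int" where
  "rest S f = proj S f - f"

definition on_V :: "(('v \<Rightarrow>\<^sub>0 int) \<Rightarrow>\<^sub>0 int) \<Rightarrow> bool" where
  "on_V f \<longleftrightarrow> (\<forall>m\<in>keys f. keys m \<subseteq> V)"

lemma on_V_K: "f \<in> K S \<Longrightarrow> S \<subseteq> V \<Longrightarrow> on_V f"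
  unfolding on_V_def using K_keys by blast

lemma on_V_proj: "adm S \<Longrightarrow> on_V f \<Longrightarrow> proj S f \<in> K S"
  unfolding proj_def on_V_def by (rule K_frag_extend) (auto intro: F_in_K K_0)

lemma rest_add: "rest S (f + g) = rest S f + rest S g"
  and rest_diff: "rest S (f - g) = rest S f - rest S g"
  by (simp_all add: rest_def proj_def frag_extend_add frag_extend_diff)

lemma rest_cmul: "rest S (frag_cmul k f) = frag_cmul k (rest S f)"
  unfolding rest_def proj_def frag_extend_cmul
  by (rule poly_mapping_eqI) (simp add: lookup_minus algebra_simps)

lemma rest_zero [simp]: "rest S 0 = 0"
  by (simp add: rest_def proj_def)

lemma rest_sum: "rest S (\<Sum>k\<in>I. g k) = (\<Sum>k\<in>I. rest S (g k))"
  by (induction I rule: infinite_finite_induct) (simp_all add: rest_add)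

lemma lookup_rest_dominant:
  assumes "adm S" "on_V f" "dominant S u"
  shows "lookup (rest S f) u = 0"
proof -
  have "lookup (proj S f) u = (\<Sum>m\<in>keys f. if u = m then lookup f m else 0)"
    unfolding proj_def lookup_frag_extend
    by (rule sum.cong) (use assms lookup_F_dominant[OF assms(1)] in \<open>auto simp: on_V_def\<close>)
  then show ?thesis by (auto simp: rest_def lookup_minus in_keys_iff)
qed

lemma rest_K:
  assumes "adm S" "f \<in> K S"
  shows "rest S f = 0"
proof (rule K_has_dominant[OF _ assms(1)])
  have "on_V f" using assms on_V_K by (auto simp: adm_def)
  then show "rest S f \<in> K S" "\<And>m. m \<in> keys (rest S f) \<Longrightarrow> \<not> dominant S m"
    using assms on_V_proj K_diff lookup_rest_dominant by (auto simp: rest_def in_keys_iff)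
qed

lemma rest_0_imp_K: "adm S \<Longrightarrow> on_V f \<Longrightarrow> rest S f = 0 \<Longrightarrow> f \<in> K S"
  using on_V_proj[of S f] by (simp add: rest_def)

lemma proj_source:
  assumes "adm S" "on_V f" "\<not> dominant S u" "u \<in> keys (proj S f)"
  obtains m a n where "m \<in> keys f" "dominant S m" "u = m - a" "cone S n a" "1 \<le> n" "n \<le> nat (vdeg S m)"
proof -
  obtain m where m: "m \<in> keys f" "u \<in> keys (if dominant S m then F S m else 0)"
    using assms(4) unfolding proj_def by (rule keys_frag_extendD)
  then have dm: "dominant S m" "u \<in> keys (F S m)" by (auto split: if_splits)
  then have "u \<in> keys (F S m - frag_of m)"
    using assms(3) by (auto simp: in_keys_iff lookup_minus)
  moreover have "led S (nat (vdeg S m)) m (F S m)"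
    using assms(1,2) m(1) dm by (intro F_led) (auto simp: on_V_def)
  ultimately obtain a n where "u = m - a" "cone S n a" "1 \<le> n" "n \<le> nat (vdeg S m)"
    by (metis ledE)
  with m(1) dm(1) show ?thesis by (rule that)
qed

text \<open>Where the defect vanishes, the coefficient of a non-dominant monomial is produced
  entirely by the \<open>F S m\<close> of dominant monomials \<open>m\<close> strictly above it. All
  arguments that a topmost monomial must be dominant rest on this.\<close>

lemma rest_source:
  assumes "adm S" "on_V f" "\<not> dominant S u" "u \<in> keys f" "lookup (rest S f) u = 0"
  obtains m a n where "m \<in> keys f" "dominant S m" "u = m - a" "cone S n a" "1 \<le> n" "n \<le> nat (vdeg S m)"
  using assms by (auto simp: rest_def lookup_minus in_keys_iff intro: proj_source[OF assms(1-3)])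

lemma keys_rest:
  assumes "adm S" "on_V f" "u \<in> keys (rest S f)"
  obtains "u \<in> keys f"
  | m a n where "m \<in> keys f" "dominant S m" "u = m - a" "cone S n a" "1 \<le> n" "n \<le> nat (vdeg S m)"
proof (cases "u \<in> keys f")
  case False
  then have up: "u \<in> keys (proj S f)"
    using assms(3) by (auto simp: rest_def in_keys_iff lookup_minus)
  have "\<not> dominant S u"
    using assms lookup_rest_dominant by (auto simp: in_keys_iff)
  from proj_source[OF assms(1,2) this up] show ?thesis using that(2) by blast
qed (rule that(1))

section \<open>The filtration by depth below a fixed monomial\<close>

definition dep :: "('v \<Rightarrow>\<^sub>0 int) \<Rightarrow> nat \<Rightarrow> ('v \<Rightarrow>\<^sub>0 int) \<Rightarrow> bool" where
  "dep m n u \<longleftrightarrow> (\<exists>a. u = m - a \<and> cone V n a)"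

definition deep :: "('v \<Rightarrow>\<^sub>0 int) \<Rightarrow> nat \<Rightarrow> (('v \<Rightarrow>\<^sub>0 int) \<Rightarrow>\<^sub>0 int) \<Rightarrow> bool" where
  "deep m N f \<longleftrightarrow> (\<forall>u\<in>keys f. \<exists>n\<ge>N. dep m n u)"

lemma dep_cone:
  assumes "dep m n u" "cone S k a" "S \<subseteq> V"
  shows "dep m (n + k) (u - a)"
proof -
  obtain b where "u = m - b" "cone V n b" using assms(1) unfolding dep_def by blast
  then show ?thesis
    using cone_add[OF cone_mono[OF assms(2,3)], of n b] unfolding dep_def
    by (intro exI[of _ "b + a"]) (simp add: algebra_simps)
qed

lemma dep_refl: "dep m 0 m"
  unfolding dep_def by (simp add: cone_0_iff)

lemma dep_keys: "dep m n u \<Longrightarrow> keys m \<subseteq> V \<Longrightarrow> keys u \<subseteq> V"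
  unfolding dep_def by (auto dest!: keys_diffD dest: cone_keys[OF _ subset_refl])

lemma deep_on_V: "deep m N f \<Longrightarrow> keys m \<subseteq> V \<Longrightarrow> on_V f"
  unfolding deep_def on_V_def using dep_keys by blast

lemma deep_mono: "deep m N f \<Longrightarrow> N' \<le> N \<Longrightarrow> deep m N' f"
  unfolding deep_def using order_trans by meson

lemma deep_add: "deep m N f \<Longrightarrow> deep m N g \<Longrightarrow> deep m N (f + g)"
  and deep_diff: "deep m N f \<Longrightarrow> deep m N g \<Longrightarrow> deep m N (f - g)"
  unfolding deep_def by (auto dest!: keys_addD keys_diffD)

lemma deep_led:
  assumes "dep m n u" "led V N u f"
  shows "deep m (Suc n) (f - frag_of u)"
  unfolding deep_def
proof
  fix v assume "v \<in> keys (f - frag_of u)"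
  with assms(2) obtain a k where "v = u - a" "cone V k a" "1 \<le> k" by (rule ledE)
  then show "\<exists>k\<ge>Suc n. dep m k v"
    using dep_cone[OF assms(1)] by (intro exI[of _ "n + k"]) auto
qed

lemma deep_proj:
  assumes "deep m N f" "adm S" "keys m \<subseteq> V"
  shows "deep m N (rest S f)"
  unfolding deep_def
proof
  fix u assume "u \<in> keys (rest S f)"
  with assms(2) deep_on_V[OF assms(1,3)] show "\<exists>n\<ge>N. dep m n u"
  proof (cases rule: keys_rest)
    case 1
    then show ?thesis using assms(1) by (auto simp: deep_def)
  next
    case (2 v a k)
    then obtain n where "n \<ge> N" "dep m n v" using assms(1) by (auto simp: deep_def)
    then show ?thesis
      using dep_cone[of m n v S k a] 2 assms(2) by (intro exI[of _ "n + k"]) (auto simp: adm_def)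
  qed
qed

end

section \<open>The algorithm\<close>

text \<open>\<open>ht\<close> turns the depth below a monomial into a well-defined number.
  \<open>rank2\<close> is the only information about the interaction of two orbits, and it is
  required for single variables only; products give the rest.\<close>

locale screening_orbits = screening V A for V :: "'v set" and A +
  fixes ht :: "('v \<Rightarrow>\<^sub>0 int) \<Rightarrow> real" and orb :: "'v \<Rightarrow> 'v set"
  assumes ht_add: "ht (u + v) = ht u + ht v"
    and ht_A: "x \<in> V \<Longrightarrow> ht (A x) = 1"
    and orb_refl: "x \<in> V \<Longrightarrow> x \<in> orb x"
    and orb_adm: "x \<in> V \<Longrightarrow> adm (orb x)"
    and orb_eq: "x \<in> V \<Longrightarrow> y \<in> orb x \<Longrightarrow> orb y = orb x"
    and rank2: "\<lbrakk>x \<in> V; y \<in> V; orb x \<noteq> orb y; w \<in> orb x \<union> orb y\<rbrakk> \<Longrightarrow>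
      \<exists>T\<in>K (orb x) \<inter> K (orb y). \<exists>N. led V N (frag_of w) T"
begin

lemma orb_subset: "x \<in> V \<Longrightarrow> orb x \<subseteq> V"
  using orb_adm unfolding adm_def by blast

lemma ht_zero: "ht 0 = 0"
  using ht_add[of 0 0] by simp

lemma ht_diff: "ht (u - v) = ht u - ht v"
  using ht_add[of "u - v" v] by simp

lemma ht_cone: "cone B n a \<Longrightarrow> B \<subseteq> V \<Longrightarrow> ht a = n"
  by (induction rule: cone.induct) (auto simp: ht_zero ht_add ht_A)

lemma ht_dep: "dep m n u \<Longrightarrow> ht u = ht m - n"
  unfolding dep_def using ht_cone[OF _ subset_refl] by (auto simp: ht_diff)

lemma dep_unique: "dep m n u \<Longrightarrow> dep m k u \<Longrightarrow> n = k"
  using ht_dep[of m n u] ht_dep[of m k u] by simp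

lemma deep_lookup: "deep m N f \<Longrightarrow> dep m n u \<Longrightarrow> n < N \<Longrightarrow> lookup f u = 0"
  unfolding deep_def using dep_unique by (metis in_keys_iff not_le)

text \<open>Multiply the elements led by the single variables. Once the degree in both orbits is
  used up, the dominant monomial that is left contains no variable of either orbit and is a unit in
  both kernels.\<close>

lemma rank2_led:
  assumes "x \<in> V" "y \<in> V" "orb x \<noteq> orb y" "keys m \<subseteq> V" "dominant (orb x) m" "dominant (orb y) m"
  shows "\<exists>T\<in>K (orb x) \<inter> K (orb y). \<exists>N. led V N m T"
proof -
  define J where "J = orb x \<union> orb y"
  have "dominant J m" using assms(5,6) by (auto simp: J_def dominant_def)
  then show ?thesis using assms(4)
  proof (induction "nat (vdeg J m)" arbitrary: m)
    case 0
    then have "vdeg J m = 0" using vdeg_nonneg[of J m] by simp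
    moreover have "\<forall>w\<in>keys m \<inter> J. 0 \<le> lookup m w" using 0 by (auto simp: dominant_def)
    ultimately have "\<forall>w\<in>keys m \<inter> J. lookup m w = 0"
      unfolding vdeg_alt by (subst (asm) sum_nonneg_eq_0_iff) auto
    then have "vpart (orb x) m = 0" "vpart (orb y) m = 0"
      unfolding vpart_eq_0_iff by (auto simp: in_keys_iff J_def)
    then show ?case
      using 0 by (intro bexI[of _ "frag_of m"] exI[of _ 0] IntI unit_in_K led_frag_of)
  next
    case (Suc n)
    have "\<exists>w\<in>keys m \<inter> J. lookup m w > 0"
    proof (rule ccontr)
      assume "\<not> ?thesis"
      then have "vdeg J m \<le> 0" unfolding vdeg_alt by (intro sum_nonpos) force
      with Suc.hyps(2) show False by simp
    qed
    then obtain w where w: "w \<in> J" "w \<in> keys m" "lookup m w > 0" by blast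
    have "n = nat (vdeg J (m - frag_of w))" using Suc.hyps(2) w(1) by simp
    moreover have "dominant J (m - frag_of w)"
      using Suc.prems(1) w(3) by (auto simp: dominant_def lookup_minus)
    moreover have "keys (m - frag_of w) \<subseteq> V"
      using Suc.prems(2) w(2) keys_diff[of m "frag_of w"] by auto
    ultimately obtain T N where T: "T \<in> K (orb x)" "T \<in> K (orb y)" "led V N (m - frag_of w) T"
      using Suc.hyps(1) by blast
    obtain T' N' where T': "T' \<in> K (orb x)" "T' \<in> K (orb y)" "led V N' (frag_of w) T'"
      using rank2[OF assms(1-3)] w(1) unfolding J_def by blast
    have "led V (N + N') (m - frag_of w + frag_of w) (T * T')"
      using T(3) T'(3) by (rule led_mult)
    then show ?case using T T' by (auto intro!: bexI[of _ "T * T'"] K_mult)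
  qed
qed

text \<open>The topmost monomials of \<open>f\<close> are dominant for both orbits; peel them off.\<close>

lemma rank2_approx:
  assumes m: "keys m \<subseteq> V" and f: "deep m 0 f" and xy: "x \<in> V" "y \<in> V" "orb x \<noteq> orb y"
    and rest: "deep m N (rest (orb x) f)" "deep m N (rest (orb y) f)"
  shows "\<exists>g\<in>K (orb x) \<inter> K (orb y). deep m N (f - g)"
proof -
  have "\<exists>g\<in>K (orb x) \<inter> K (orb y). deep m k (f - g)" if "k \<le> N" for k
    using that
  proof (induction k)
    case 0
    then show ?case using f K_0 by (intro bexI[of _ 0]) auto
  next
    case (Suc k)
    then obtain g where g: "g \<in> K (orb x)" "g \<in> K (orb y)" "deep m k (f - g)" by auto
    let ?e = "f - g"
    \<comment> \<open>The defect vanishes at depth \<open>k < N\<close>, so a non-dominant monomial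
      there would come from a monomial of \<open>f - g\<close> at depth less than \<open>k\<close>,
      and there is none.\<close>
    have dominant: "dominant (orb z) u"
      if z: "z \<in> V" "g \<in> K (orb z)" "deep m N (rest (orb z) f)" and u: "u \<in> keys ?e" "dep m k u" for u z
    proof (rule ccontr)
      assume "\<not> dominant (orb z) u"
      moreover have "rest (orb z) ?e = rest (orb z) f"
        using rest_K[OF orb_adm z(2)] z(1) by (simp add: rest_diff)
      then have "lookup (rest (orb z) ?e) u = 0"
        using deep_lookup[OF z(3) u(2)] Suc.prems by simp
      ultimately obtain v a n where v: "v \<in> keys ?e" "u = v - a" "cone (orb z) n a" "1 \<le> n"
        using u(1) orb_adm[OF z(1)] deep_on_V[OF g(3) m] by (metis rest_source)
      then obtain j where "j \<ge> k" "dep m j v" using g(3) by (auto simp: deep_def)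
      then have "dep m (j + n) u" using dep_cone orb_subset[OF z(1)] v by blast
      then show False using dep_unique[OF u(2)] \<open>j \<ge> k\<close> v(4) by fastforce
    qed
    let ?D = "{u \<in> keys ?e. dep m k u}"
    have "\<forall>u\<in>?D. \<exists>T. T \<in> K (orb x) \<inter> K (orb y) \<and> (\<exists>N. led V N u T)"
    proof
      fix u assume u: "u \<in> ?D"
      then show "\<exists>T. T \<in> K (orb x) \<inter> K (orb y) \<and> (\<exists>N. led V N u T)"
        using rank2_led[OF xy, of u] dominant[OF xy(1) g(1) rest(1)] dominant[OF xy(2) g(2) rest(2)]
          dep_keys[OF _ m] by blast
    qed
    from bchoice[OF this] obtain T where
      T: "\<forall>u\<in>?D. T u \<in> K (orb x) \<inter> K (orb y) \<and> (\<exists>N. led V N u (T u))" ..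
    define h where "h = (\<Sum>u\<in>?D. frag_cmul (lookup ?e u) (T u))"
    have "deep m (Suc k) (?e - h)"
      unfolding deep_def
    proof
      fix u assume "u \<in> keys (?e - h)"
      then have "u \<in> keys ?e \<and> u \<notin> ?D \<or> (\<exists>v\<in>?D. v \<in> keys ?e \<and> u \<in> keys (T v - frag_of v))"
        unfolding h_def by (intro keys_subtract_leading) auto
      then show "\<exists>n\<ge>Suc k. dep m n u"
      proof
        assume u: "u \<in> keys ?e \<and> u \<notin> ?D"
        then obtain n where "n \<ge> k" "dep m n u" using g(3) by (auto simp: deep_def)
        then show ?thesis using u by (intro exI[of _ n]) (cases "n = k", auto)
      next
        assume "\<exists>v\<in>?D. v \<in> keys ?e \<and> u \<in> keys (T v - frag_of v)"
        then obtain v where v: "v \<in> ?D" "u \<in> keys (T v - frag_of v)" by blast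
        then obtain N where "led V N v (T v)" using T by blast
        with v show ?thesis using deep_led[of m k v N "T v"] by (auto simp: deep_def)
      qed
    qed
    moreover have "g + h \<in> K (orb x)" "g + h \<in> K (orb y)"
      unfolding h_def using T g(1,2) by (auto intro!: K_add K_sum K_cmul)
    ultimately show ?case by (intro bexI[of _ "g + h"]) (auto simp: diff_diff_eq)
  qed
  then show ?thesis by blast
qed

text \<open>Down to depth \<open>N\<close>, \<open>f\<close> agrees with an element \<open>g\<close>
  of both kernels. Subtracting \<open>g\<close> does not change either defect, and
  \<open>f - g\<close> has no monomial above depth \<open>N\<close> from which a projection could
  reach \<open>u\<close>. For both orbits the defect at \<open>u\<close> is therefore
  \<open>- lookup (f - g) u\<close>, an expression without any orbit in it.\<close>

lemma rest_compatible:
  assumes m: "keys m \<subseteq> V" and f: "deep m 0 f" and xy: "x \<in> V" "y \<in> V"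
    and rest: "deep m N (rest (orb x) f)" "deep m N (rest (orb y) f)"
    and u: "dep m N u" "\<not> dominant (orb x) u" "\<not> dominant (orb y) u"
  shows "lookup (rest (orb x) f) u = lookup (rest (orb y) f) u"
proof (cases "orb x = orb y")
  case False
  obtain g where g: "g \<in> K (orb x)" "g \<in> K (orb y)" "deep m N (f - g)"
    using rank2_approx[OF m f xy False rest] by blast
  have "lookup (rest (orb z) f) u = - lookup (f - g) u"
    if z: "z \<in> V" "g \<in> K (orb z)" "\<not> dominant (orb z) u" for z
  proof -
    have "u \<notin> keys (proj (orb z) (f - g))"
    proof
      assume "u \<in> keys (proj (orb z) (f - g))"
      then obtain v a n where v: "v \<in> keys (f - g)" "u = v - a" "cone (orb z) n a" "1 \<le> n"
        using orb_adm[OF z(1)] deep_on_V[OF g(3) m] z(3) by (metis proj_source)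
      then obtain j where "j \<ge> N" "dep m j v" using g(3) by (auto simp: deep_def)
      then have "dep m (j + n) u" using dep_cone orb_subset[OF z(1)] v by blast
      then show False using dep_unique[OF u(1)] \<open>j \<ge> N\<close> v(4) by fastforce
    qed
    moreover have "rest (orb z) f = rest (orb z) (f - g)"
      using rest_K[OF orb_adm z(2)] z(1) by (simp add: rest_diff)
    ultimately show ?thesis by (simp add: rest_def[of _ "f - g"] lookup_minus in_keys_iff)
  qed
  then show ?thesis using g xy u by simp
qed simp

text \<open>There may be infinitely many orbits, but an orbit that meets no variable of
  \<open>m\<close> has degree 0 on \<open>m\<close>, and then \<open>F\<close> adds no terms below
  \<open>m\<close>. This makes the next layer of the algorithm a finite sum.\<close>

lemma finite_rest_support:
  assumes "on_V f"
  shows "finite {u. \<exists>x\<in>V. u \<in> keys (rest (orb x) f)}"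
proof (rule finite_subset)
  show "{u. \<exists>x\<in>V. u \<in> keys (rest (orb x) f)} \<subseteq> keys f \<union> (\<Union>m\<in>keys f. \<Union>x\<in>keys m. keys (rest (orb x) f))"
  proof
    fix u assume "u \<in> {u. \<exists>x\<in>V. u \<in> keys (rest (orb x) f)}"
    then obtain x where x: "x \<in> V" "u \<in> keys (rest (orb x) f)" by blast
    from orb_adm[OF x(1)] assms x(2)
    show "u \<in> keys f \<union> (\<Union>m\<in>keys f. \<Union>x\<in>keys m. keys (rest (orb x) f))"
    proof (cases rule: keys_rest)
      case (2 m a n)
      then have "vdeg (orb x) m \<noteq> 0" by auto
      then have "keys m \<inter> orb x \<noteq> {}" unfolding vdeg_alt by (metis sum.empty)
      then obtain y where y: "y \<in> keys m" "y \<in> orb x" by blast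
      then have "orb y = orb x" using orb_eq x(1) by blast
      then have "u \<in> keys (rest (orb y) f)" using x(2) by simp
      then show ?thesis using y(1) 2(1) by blast
    qed simp
  qed
qed auto

lemma rest_frag_of:
  assumes "keys m \<subseteq> V" "dep m n u" "x \<in> V"
  shows "if dominant (orb x) u then deep m (Suc n) (rest (orb x) (frag_of u))
    else rest (orb x) (frag_of u) = - frag_of u"
proof -
  have "deep m (Suc n) (F (orb x) u - frag_of u)" if "dominant (orb x) u"
    using F_led[OF orb_adm[OF assms(3)] that dep_keys[OF assms(2,1)]] orb_subset[OF assms(3)]
    by (intro deep_led[OF assms(2)]) (auto intro: led_mono)
  then show ?thesis by (auto simp: rest_def proj_def)
qed

text \<open>The next layer of coefficients is forced; it is independent of the orbit used to
  compute it by \<open>rest_compatible\<close>.\<close>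

lemma algorithm:
  assumes m: "keys m \<subseteq> V" "dominant V m"
  shows "\<exists>f. deep m 0 f \<and> lookup f m = 1 \<and> (\<forall>u\<in>keys f. u \<noteq> m \<longrightarrow> \<not> dominant V u) \<and>
    (\<forall>x\<in>V. deep m (Suc N) (rest (orb x) f))"
proof (induction N)
  case 0
  have "deep m 0 (frag_of m)" using dep_refl by (auto simp: deep_def)
  moreover have "deep m (Suc 0) (rest (orb x) (frag_of m))" if "x \<in> V" for x
    using rest_frag_of[OF m(1) dep_refl that] m(2) orb_subset[OF that]
    by (auto simp: dominant_def split: if_splits)
  ultimately show ?case by (intro exI[of _ "frag_of m"]) auto
next
  case (Suc N)
  then obtain f where f: "deep m 0 f" "lookup f m = 1" "\<And>u. u \<in> keys f \<Longrightarrow> u \<noteq> m \<Longrightarrow> \<not> dominant V u"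
    "\<And>x. x \<in> V \<Longrightarrow> deep m (Suc N) (rest (orb x) f)" by blast
  \<comment> \<open>\<open>p u\<close> is an arbitrary choice of an orbit that witnesses
    non-dominance, and \<open>c u\<close> is the defect there. A single non-dominant monomial
    \<open>u\<close> has defect \<open>- u\<close>, so adding \<open>c u\<close> times
    \<open>u\<close> removes the defect at \<open>u\<close>, for the chosen orbit by definition and
    for all others by \<open>rest_compatible\<close>.\<close>
  define p where "p u = (SOME x. x \<in> V \<and> \<not> dominant (orb x) u)" for u
  define c where "c u = lookup (rest (orb (p u)) f) u" for u
  have p: "p u \<in> V" "\<not> dominant (orb (p u)) u" if u: "\<not> dominant V u" for u
  proof -
    have "\<exists>x. x \<in> V \<and> \<not> dominant (orb x) u"
      using u orb_refl unfolding dominant_def by blast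
    from someI_ex[OF this] show "p u \<in> V" "\<not> dominant (orb (p u)) u" unfolding p_def by auto
  qed
  define W where "W = {u. \<not> dominant V u \<and> dep m (Suc N) u \<and> c u \<noteq> 0}"
  have W: "finite W"
    by (rule finite_subset[OF _ finite_rest_support[OF deep_on_V[OF f(1) m(1)]]])
      (use p in \<open>auto simp: W_def c_def in_keys_iff\<close>)
  define h where "h = (\<Sum>u\<in>W. frag_cmul (c u) (frag_of u))"
  have lookup_h: "lookup h u = (if u \<in> W then c u else 0)" for u
  proof -
    have "lookup h u = (\<Sum>v\<in>W. if u = v then c v else 0)"
      unfolding h_def lookup_sum by (rule sum.cong) auto
    then show ?thesis using W by simp
  qed
  have h: "deep m (Suc N) h" unfolding deep_def
    by (auto simp: in_keys_iff lookup_h W_def split: if_splits)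
  have "deep m (Suc (Suc N)) (rest (orb x) (f + h))" if x: "x \<in> V" for x
    unfolding deep_def
  proof
    fix u assume u: "u \<in> keys (rest (orb x) (f + h))"
    have "deep m (Suc N) (rest (orb x) (f + h))"
      unfolding rest_add by (intro deep_add f(4)[OF x] deep_proj[OF h orb_adm[OF x] m(1)])
    then obtain n where n: "n \<ge> Suc N" "dep m n u" using u by (auto simp: deep_def)
    have "n \<noteq> Suc N"
    proof
      assume nN: "n = Suc N"
      have nd: "\<not> dominant (orb x) u"
        using u lookup_rest_dominant[OF orb_adm[OF x], of "f + h" u]
          deep_on_V[OF deep_add[OF f(1) deep_mono[OF h]] m(1)] by (auto simp: in_keys_iff)
      then have nV: "\<not> dominant V u" using orb_subset[OF x] by (auto simp: dominant_def)
      have "lookup (rest (orb x) (frag_of v)) u = (if u = v then -1 else 0)" if v: "v \<in> W" for v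
      proof -
        have dv: "dep m (Suc N) v" using v by (simp add: W_def)
        show ?thesis
          using rest_frag_of[OF m(1) dv x] deep_lookup[of m "Suc (Suc N)" _ n u] n(2) nN nd
          by (auto split: if_splits)
      qed
      then have "lookup (rest (orb x) h) u = (\<Sum>v\<in>W. if u = v then - c v else 0)"
        unfolding h_def rest_sum rest_cmul lookup_sum by (intro sum.cong) auto
      also have "\<dots> = - c u" using W n(2) nN nV by (auto simp: W_def)
      also have "c u = lookup (rest (orb x) f) u"
        unfolding c_def
        by (rule rest_compatible[OF m(1) f(1) p(1)[OF nV] x f(4)[OF p(1)[OF nV]] f(4)[OF x]])
          (use n(2) nN nd p(2)[OF nV] in auto)
      finally show False using u by (simp add: rest_add lookup_add in_keys_iff)
    qed
    then show "\<exists>n\<ge>Suc (Suc N). dep m n u" using n by (intro exI[of _ n]) auto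
  qed
  moreover have "deep m 0 (f + h)" using f(1) deep_mono[OF h] by (intro deep_add) auto
  moreover have "lookup (f + h) m = 1"
    using f(2) m(2) by (simp add: lookup_add lookup_h W_def)
  moreover have "\<forall>u\<in>keys (f + h). u \<noteq> m \<longrightarrow> \<not> dominant V u"
  proof (intro ballI impI)
    fix u assume u: "u \<in> keys (f + h)" "u \<noteq> m"
    consider "u \<in> keys f" | "u \<in> keys h" using keys_addD[OF u(1)] by blast
    then show "\<not> dominant V u"
    proof cases
      case 2
      then show ?thesis by (auto simp: in_keys_iff lookup_h W_def split: if_splits)
    qed (use f(3) u(2) in auto)
  qed
  ultimately show ?case by blast
qed

text \<open>Passes from single orbits to all variables of a node. A topmost monomial of the defect
  \<open>e\<close> has a negative exponent at some \<open>x\<close> in \<open>S\<close>. Up to sign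
  \<open>e\<close> and \<open>f\<close> have the same defect for the orbit of \<open>x\<close>,
  which vanishes at this depth, so the monomial would need a source in \<open>e\<close> above
  it.\<close>

lemma deep_rest_union:
  assumes m: "keys m \<subseteq> V" and f: "deep m 0 f" "\<And>x. x \<in> S \<Longrightarrow> deep m N (rest (orb x) f)"
    and S: "adm S" "\<And>x. x \<in> S \<Longrightarrow> K S \<subseteq> K (orb x)"
  shows "deep m N (rest S f)"
proof (rule ccontr)
  assume not: "\<not> ?thesis"
  let ?e = "rest S f"
  have e: "deep m 0 ?e" using f(1) S(1) m by (rule deep_proj)
  define P where "P n \<longleftrightarrow> (\<exists>u\<in>keys ?e. dep m n u)" for n
  obtain u n where "u \<in> keys ?e" "dep m n u" "n < N"
  proof -
    obtain u where u: "u \<in> keys ?e" "\<forall>n\<ge>N. \<not> dep m n u" using not unfolding deep_def by blast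
    moreover obtain n where "dep m n u" using e u(1) unfolding deep_def by blast
    ultimately show ?thesis using that[of u n] by (meson not_le)
  qed
  then have "P n" "n < N" unfolding P_def by blast+
  obtain n where n: "P n" "n < N" "\<And>k. k < n \<Longrightarrow> \<not> P k"
  proof
    show "P (LEAST n. P n)" using \<open>P n\<close> by (rule LeastI)
    show "(LEAST n. P n) < N" using Least_le[of P n, OF \<open>P n\<close>] \<open>n < N\<close> by simp
    show "\<And>k. k < (LEAST n. P n) \<Longrightarrow> \<not> P k" by (rule not_less_Least)
  qed
  then obtain u where u: "u \<in> keys ?e" "dep m n u" unfolding P_def by blast
  have "\<not> dominant S u"
    using u(1) lookup_rest_dominant[OF S(1) deep_on_V[OF f(1) m]] by (auto simp: in_keys_iff)
  then obtain x where x: "x \<in> S" "lookup u x < 0" by (auto simp: dominant_def not_le)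
  have xV: "x \<in> V" using S(1) x(1) by (auto simp: adm_def)
  have "\<not> dominant (orb x) u" using x orb_refl[OF xV] unfolding dominant_def by force
  moreover have "rest (orb x) ?e = - rest (orb x) f"
  proof -
    have "proj S f \<in> K (orb x)"
      using on_V_proj[OF S(1) deep_on_V[OF f(1) m]] S(2)[OF x(1)] by blast
    then show ?thesis
      using rest_K[OF orb_adm[OF xV]] by (simp add: rest_def[of S] rest_diff)
  qed
  then have "lookup (rest (orb x) ?e) u = 0"
    using deep_lookup[OF f(2)[OF x(1)] u(2) n(2)] by simp
  ultimately obtain v a k where v: "v \<in> keys ?e" "u = v - a" "cone (orb x) k a" "1 \<le> k"
    using u(1) orb_adm[OF xV] deep_on_V[OF e m] by (metis rest_source)
  obtain j where "dep m j v" using e v(1) by (auto simp: deep_def)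
  then have "dep m (j + k) u" using dep_cone orb_subset[OF xV] v by blast
  then have "j + k = n" using dep_unique[OF u(2)] by blast
  then show False using n(3)[of j] v(1,4) \<open>dep m j v\<close> unfolding P_def by auto
qed

end

section \<open>Finiteness and uniqueness\<close>

text \<open>A vector in the kernel of \<open>M\<close> becomes isotropic after division of its
  entries by \<open>W\<close>, hence is zero.\<close>

lemma pos_def_inverse:
  fixes M :: "'i::finite \<Rightarrow> 'i \<Rightarrow> real" and W :: "'i \<Rightarrow> real"
  assumes pos: "\<And>x. x \<noteq> (\<lambda>_. 0) \<Longrightarrow> (\<Sum>i\<in>UNIV. \<Sum>j\<in>UNIV. M i j * W j * x i * x j) > 0"
    and W: "\<And>i. W i > 0"
  shows "\<exists>N. (\<forall>i k. (\<Sum>j\<in>UNIV. M i j * N j k) = (if i = k then 1 else 0)) \<and>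
    (\<forall>i k. (\<Sum>j\<in>UNIV. N i j * M j k) = (if i = k then 1 else 0))"
proof -
  define B :: "real ^ 'i ^ 'i" where "B = (\<chi> i j. M i j)"
  have "inj ((*v) B)"
  proof (rule linear_injective_0[THEN iffD2, rule_format])
    show "linear ((*v) B)" by (rule matrix_vector_mul_linear)
    fix y assume y: "B *v y = 0"
    define x where "x i = y $ i / W i" for i
    have Wx: "W j * x j = y $ j" for j
      using W[of j] by (simp add: x_def)
    have "(\<Sum>i\<in>UNIV. \<Sum>j\<in>UNIV. M i j * W j * x i * x j) = (\<Sum>i\<in>UNIV. x i * (B *v y) $ i)"
      unfolding B_def matrix_vector_mult_def
      by (intro sum.cong refl) (simp flip: Wx add: sum_distrib_left ac_simps)
    then have "x = (\<lambda>_. 0)" using pos[of x] y by force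
    then show "y = 0" using Wx by (metis mult_zero_right vec_eq_iff zero_index)
  qed
  then obtain N where N: "N ** B = mat 1"
    using matrix_left_invertible_injective[of B] by blast
  then have N': "B ** N = mat 1" using matrix_left_right_inverse by blast
  have "(\<Sum>j\<in>UNIV. M i j * N $ j $ k) = (if i = k then 1 else 0)" for i k
    using arg_cong[OF N', of "\<lambda>A. A $ i $ k"] by (simp add: matrix_matrix_mult_def mat_def B_def)
  moreover have "(\<Sum>j\<in>UNIV. N $ i $ j * M j k) = (if i = k then 1 else 0)" for i k
    using arg_cong[OF N, of "\<lambda>A. A $ i $ k"] by (simp add: matrix_matrix_mult_def mat_def B_def)
  ultimately show ?thesis by (intro exI[of _ "\<lambda>i j. N $ i $ j"]) auto
qed

text \<open>The degrees in the variables of the single nodes are the coordinates of a weight in the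
  fundamental weights, and \<open>A x\<close> has as weight the simple root of its node.
  \<open>W j\<close> is half the squared length of the simple root \<open>j\<close>, so that
  \<open>M i j * W j\<close> is the Gram matrix of the simple roots.\<close>

locale cartan_screening = screening V A for V :: "'v set" and A +
  fixes col :: "'v \<Rightarrow> 'i::finite" and M :: "'i \<Rightarrow> 'i \<Rightarrow> int" and W :: "'i \<Rightarrow> real"
    and orb :: "'v \<Rightarrow> 'v set"
  assumes orb_refl: "x \<in> V \<Longrightarrow> x \<in> orb x"
    and orb_adm: "x \<in> V \<Longrightarrow> adm (orb x)"
    and orb_eq: "x \<in> V \<Longrightarrow> y \<in> orb x \<Longrightarrow> orb y = orb x"
    and rank2: "\<lbrakk>x \<in> V; y \<in> V; orb x \<noteq> orb y; w \<in> orb x \<union> orb y\<rbrakk> \<Longrightarrow>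
      \<exists>T\<in>K (orb x) \<inter> K (orb y). \<exists>N. led V N (frag_of w) T"
    and orb_K: "x \<in> V \<Longrightarrow> K {y \<in> V. col y = col x} \<subseteq> K (orb x)"
    and vdeg_A: "x \<in> V \<Longrightarrow> vdeg {y \<in> V. col y = j} (A x) = M (col x) j"
    and M_diag: "M i i = 2"
    and W_pos: "W i > 0"
    and M_symm: "of_int (M i j) * W j = of_int (M j i) * W i"
    and M_pos: "c \<noteq> (\<lambda>_. 0) \<Longrightarrow> (\<Sum>i\<in>UNIV. \<Sum>j\<in>UNIV. of_int (M i j) * W j * c i * c j) > (0::real)"
begin

definition S :: "'i \<Rightarrow> 'v set" where
  "S i = {x \<in> V. col x = i}"

lemma S_adm: "adm (S i)"
  unfolding adm_def S_def using vdeg_A M_diag by auto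

definition Minv :: "'i \<Rightarrow> 'i \<Rightarrow> real" where
  "Minv = (SOME N. (\<forall>i k. (\<Sum>j\<in>UNIV. of_int (M i j) * N j k) = (if i = k then 1 else 0)) \<and>
    (\<forall>i k. (\<Sum>j\<in>UNIV. N i j * of_int (M j k)) = (if i = k then 1 else 0)))"

lemma Minv: "(\<Sum>j\<in>UNIV. of_int (M i j) * Minv j k) = (if i = k then 1 else 0)"
    "(\<Sum>j\<in>UNIV. Minv i j * of_int (M j k)) = (if i = k then 1 else 0)"
  using someI_ex[OF pos_def_inverse[of "\<lambda>i j. of_int (M i j)" W, OF M_pos W_pos]]
  unfolding Minv_def by blast+

text \<open>The weight of a monomial in the basis of simple roots.\<close>

definition wt :: "('v \<Rightarrow>\<^sub>0 int) \<Rightarrow> 'i \<Rightarrow> real" where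
  "wt u k = (\<Sum>j\<in>UNIV. of_int (vdeg (S j) u) * Minv j k)"

definition ht :: "('v \<Rightarrow>\<^sub>0 int) \<Rightarrow> real" where
  "ht u = (\<Sum>k\<in>UNIV. wt u k)"

lemma wt_add: "wt (u + v) k = wt u k + wt v k"
  and wt_diff: "wt (u - v) k = wt u k - wt v k"
  by (simp_all add: wt_def algebra_simps sum.distrib sum_subtractf)

lemma wt_zero: "wt 0 k = 0"
  by (simp add: wt_def)

lemma wt_A: "x \<in> V \<Longrightarrow> wt (A x) k = (if k = col x then 1 else 0)"
  using vdeg_A[of x] Minv(1)[of "col x" k] by (auto simp: wt_def S_def)

lemma wt_cone: "cone (S i) n a \<Longrightarrow> wt a k = (if k = i then real n else 0)"
  by (induction rule: cone.induct) (auto simp: wt_zero wt_add wt_A S_def)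

lemma vdeg_wt: "of_int (vdeg (S i) u) = (\<Sum>k\<in>UNIV. wt u k * of_int (M k i))"
proof -
  have "(\<Sum>k\<in>UNIV. wt u k * of_int (M k i))
      = (\<Sum>j\<in>UNIV. \<Sum>k\<in>UNIV. of_int (vdeg (S j) u) * (Minv j k * of_int (M k i)))"
    unfolding wt_def sum_distrib_right by (subst sum.swap) (simp add: ac_simps)
  also have "\<dots> = (\<Sum>j\<in>UNIV. of_int (vdeg (S j) u) * (if j = i then 1 else 0))"
    unfolding sum_distrib_left[symmetric] Minv by simp
  also have "\<dots> = of_int (vdeg (S i) u)"
    by (simp add: if_distrib[of "(*) _"] cong: if_cong)
  finally show ?thesis by simp
qed

sublocale screening_orbits V A ht orb
proof
  show "ht (u + v) = ht u + ht v" for u v by (simp add: ht_def wt_add sum.distrib)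
  show "x \<in> V \<Longrightarrow> ht (A x) = 1" for x by (simp add: ht_def wt_A)
qed (fact orb_refl orb_adm orb_eq rank2)+

section \<open>The invariant form on weights\<close>

definition form :: "('i \<Rightarrow> real) \<Rightarrow> ('i \<Rightarrow> real) \<Rightarrow> real" where
  "form x y = (\<Sum>i\<in>UNIV. \<Sum>j\<in>UNIV. of_int (M i j) * W j * x i * y j)"

lemma form_add_left: "form (\<lambda>k. x k + c * x' k) y = form x y + c * form x' y"
  by (simp add: form_def algebra_simps sum.distrib sum_distrib_left)

lemma form_sym: "form x y = form y x"
proof -
  have "form x y = (\<Sum>j\<in>UNIV. \<Sum>i\<in>UNIV. of_int (M i j) * W j * x i * y j)"
    unfolding form_def by (rule sum.swap)
  also have "\<dots> = form y x"
    unfolding form_def using M_symm by (intro sum.cong refl) (simp add: ac_simps)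
  finally show ?thesis .
qed

lemma form_add_right: "form x (\<lambda>k. y k + c * y' k) = form x y + c * form x y'"
  using form_add_left[of y c y' x] by (simp add: form_sym)

lemma form_nonneg: "0 \<le> form x x"
proof (cases "x = (\<lambda>_. 0)")
  case False
  then show ?thesis using M_pos[of x] by (simp add: form_def)
qed (simp add: form_def)

lemma form_quadratic:
  "form (\<lambda>k. x k + c * y k) (\<lambda>k. x k + c * y k) = form x x + 2 * c * form x y + c\<^sup>2 * form y y"
  unfolding form_add_left form_add_right using form_sym[of y x] by (simp add: power2_eq_square algebra_simps)

lemma form_bound: "2 * \<bar>form x y\<bar> \<le> form x x + form y y"
  using form_nonneg[of "\<lambda>k. x k + 1 * y k"] form_nonneg[of "\<lambda>k. x k + (-1) * y k"]
  unfolding form_quadratic by simp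

definition unit_vec :: "'i \<Rightarrow> 'i \<Rightarrow> real" where
  "unit_vec i k = (if k = i then 1 else 0)"

lemma form_unit_vec: "form (wt u) (unit_vec i) = W i * of_int (vdeg (S i) u)"
proof -
  have "form (wt u) (unit_vec i) = (\<Sum>k\<in>UNIV. of_int (M k i) * W i * wt u k)"
    unfolding form_def unit_vec_def by (simp add: if_distrib[of "(*) _"] cong: if_cong)
  then show ?thesis by (simp add: vdeg_wt sum_distrib_left ac_simps)
qed

lemma form_unit_vec_unit_vec: "form (unit_vec i) (unit_vec i) = 2 * W i"
  unfolding form_def unit_vec_def
  by (simp add: if_distrib[of "(*) _"] if_distrib[of "\<lambda>x. x * _"] M_diag cong: if_cong)

text \<open>The vector on the right has pairing 1 with every simple root. Expressing the height
  through the form is what bounds it, by \<open>form_bound\<close>, on a ball of weights.\<close>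

lemma ht_form: "ht u = form (wt u) (\<lambda>j. (\<Sum>k\<in>UNIV. Minv j k) / W j)"
proof -
  have "form (wt u) (\<lambda>j. (\<Sum>k\<in>UNIV. Minv j k) / W j)
      = (\<Sum>i\<in>UNIV. wt u i * (\<Sum>j\<in>UNIV. \<Sum>k\<in>UNIV. of_int (M i j) * Minv j k))"
    unfolding form_def sum_distrib_left
    using W_pos by (intro sum.cong refl) (simp add: sum_distrib_left sum_divide_distrib ac_simps less_imp_neq[symmetric])
  also have "\<dots> = (\<Sum>i\<in>UNIV. wt u i * (\<Sum>k\<in>UNIV. \<Sum>j\<in>UNIV. of_int (M i j) * Minv j k))"
    by (subst (2) sum.swap) simp
  also have "\<dots> = ht u" unfolding Minv by (simp add: ht_def)
  finally show ?thesis by simp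
qed

text \<open>Going up a root string from its lower half does not decrease the norm of the weight, so the
  weights below a unique dominant monomial stay in a ball. This makes the algorithm stop.\<close>

lemma form_wt_string:
  assumes "cone (S i) n a" "n \<le> nat (vdeg (S i) u)"
  shows "form (wt (u - a)) (wt (u - a)) \<le> form (wt u) (wt u)"
proof -
  have *: "wt (u - a) = (\<lambda>k. wt u k + (- real n) * unit_vec i k)"
    by (rule ext) (simp add: wt_diff wt_cone[OF assms(1)] unit_vec_def)
  have "form (wt (u - a)) (wt (u - a))
      = form (wt u) (wt u) - 2 * W i * (real n * (of_int (vdeg (S i) u) - real n))"
    unfolding * form_quadratic form_unit_vec form_unit_vec_unit_vec
    by (simp add: power2_eq_square algebra_simps)
  moreover have "0 \<le> real n * (of_int (vdeg (S i) u) - real n)"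
    using assms(2) by (cases "n = 0") (auto simp: le_nat_iff)
  ultimately show ?thesis using W_pos[of i] by simp
qed

lemma V_dominant: "(\<And>i. dominant (S i) u) \<Longrightarrow> dominant V u"
  unfolding dominant_def S_def by blast

lemma orb_K_S: "x \<in> S i \<Longrightarrow> K (S i) \<subseteq> K (orb x)"
  using orb_K[of x] unfolding S_def by auto

text \<open>Induction on the depth: a monomial other than \<open>m\<close> is non-dominant for some
  node, and its source lies higher on a root string, in the range where
  \<open>form_wt_string\<close> applies. Beyond depth \<open>N\<close> the coefficients of
  \<open>f\<close> are not controlled.\<close>

lemma norm_bound:
  assumes m: "keys m \<subseteq> V" and f: "deep m 0 f" "\<And>u. u \<in> keys f \<Longrightarrow> u \<noteq> m \<Longrightarrow> \<not> dominant V u"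
    and rest: "\<And>i. deep m (Suc N) (rest (S i) f)"
    and u: "u \<in> keys f" "dep m n u" "n \<le> N"
  shows "form (wt u) (wt u) \<le> form (wt m) (wt m)"
  using u
proof (induction n arbitrary: u rule: less_induct)
  case (less n)
  show ?case
  proof (cases "u = m")
    case False
    then obtain i where i: "\<not> dominant (S i) u" using f(2) less.prems(1) V_dominant by blast
    have "lookup (rest (S i) f) u = 0"
      using deep_lookup[OF rest less.prems(2)] less.prems(3) by simp
    with S_adm deep_on_V[OF f(1) m] i less.prems(1)
    obtain v a k where v: "v \<in> keys f" "dominant (S i) v" "u = v - a" "cone (S i) k a" "1 \<le> k"
      "k \<le> nat (vdeg (S i) v)" by (rule rest_source)
    obtain j where j: "dep m j v" using f(1) v(1) by (auto simp: deep_def)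
    have "S i \<subseteq> V" by (auto simp: S_def)
    then have "dep m (j + k) u" using dep_cone[OF j v(4)] v(3) by simp
    then have "j + k = n" using dep_unique[OF less.prems(2)] by blast
    then have "form (wt v) (wt v) \<le> form (wt m) (wt m)"
      using less.IH[OF _ v(1) j] v(5) less.prems(3) by simp
    then show ?thesis using form_wt_string[OF v(4,6)] v(3) by simp
  qed simp
qed

theorem unique_dominant_exists:
  assumes m: "keys m \<subseteq> V" "dominant V m"
  shows "\<exists>f. (\<forall>i. f \<in> K (S i)) \<and> lookup f m = 1 \<and> (\<forall>u\<in>keys f. u \<noteq> m \<longrightarrow> \<not> dominant V u)"
proof -
  define c where "c = form (wt m) (wt m)"
  define \<rho> where "\<rho> j = (\<Sum>k\<in>UNIV. Minv j k) / W j" for j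
  \<comment> \<open>\<open>B\<close> bounds the depth of a monomial whose weight lies in the ball of
    \<open>m\<close>, and \<open>B'\<close> bounds the length of the strings that \<open>F\<close>
    attaches to such a monomial. The sum over the nodes serves as an upper bound for all of
    them.\<close>
  define B where "B = nat \<lceil>ht m + c + form \<rho> \<rho>\<rceil>"
  define B' where "B' = (\<Sum>i\<in>UNIV. nat \<lceil>(c + 2 * W i) / W i\<rceil>)"
  have dep_le: "n \<le> B" if "dep m n u" "form (wt u) (wt u) \<le> c" for n u
  proof -
    have "2 * \<bar>ht u\<bar> \<le> c + form \<rho> \<rho>"
      using form_bound[of "wt u" \<rho>] that(2) ht_form[of u] unfolding \<rho>_def by simp
    then have "real n \<le> ht m + c + form \<rho> \<rho>" using ht_dep[OF that(1)] form_nonneg[of \<rho>] form_nonneg[of "wt m"]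
      unfolding c_def by linarith
    then show ?thesis unfolding B_def by linarith
  qed
  have vdeg_le: "nat (vdeg (S i) u) \<le> B'" if "form (wt u) (wt u) \<le> c" for i u
  proof -
    have "2 * (W i * of_int (vdeg (S i) u)) \<le> c + 2 * W i"
      using form_bound[of "wt u" "unit_vec i"] that by (simp add: form_unit_vec form_unit_vec_unit_vec)
    moreover have "0 \<le> c + 2 * W i" using W_pos[of i] form_nonneg[of "wt m"] by (simp add: c_def)
    ultimately have "W i * of_int (vdeg (S i) u) \<le> c + 2 * W i" by linarith
    then have "of_int (vdeg (S i) u) \<le> (c + 2 * W i) / W i"
      using W_pos[of i] by (simp add: field_simps)
    then have "nat (vdeg (S i) u) \<le> nat \<lceil>(c + 2 * W i) / W i\<rceil>" by linarith
    also have "\<dots> \<le> B'" unfolding B'_def by (rule member_le_sum) auto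
    finally show ?thesis .
  qed
  obtain f where f: "deep m 0 f" "lookup f m = 1" "\<And>u. u \<in> keys f \<Longrightarrow> u \<noteq> m \<Longrightarrow> \<not> dominant V u"
    "\<And>x. x \<in> V \<Longrightarrow> deep m (Suc (B + B')) (rest (orb x) f)"
    using algorithm[OF m, of "B + B'"] by blast
  have rest: "deep m (Suc (B + B')) (rest (S i) f)" for i
  proof (rule deep_rest_union[OF m(1) f(1) _ S_adm orb_K_S])
    fix x assume "x \<in> S i"
    then show "deep m (Suc (B + B')) (rest (orb x) f)" by (intro f(4)) (simp add: S_def)
  qed
  have small: "n \<le> B" if "u \<in> keys f" "dep m n u" "n \<le> B + B'" for u n
    using dep_le[OF that(2)] norm_bound[OF m(1) f(1,3) rest that] unfolding c_def by blast
  \<comment> \<open>Cut \<open>f\<close> at depth \<open>B\<close>. By \<open>small\<close> the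
    layers up to depth \<open>B + B'\<close> that are removed are empty, so the defect of
    \<open>g\<close> lies deeper than \<open>B + B'\<close>. But it arises from monomials of depth
    at most \<open>B\<close> by strings of length at most \<open>B'\<close>, so it is zero.\<close>
  define g where "g = frag_extend (\<lambda>u. if ht m - real B \<le> ht u then frag_of u else 0) f"
  have lookup_g: "lookup g u = (if ht m - real B \<le> ht u then lookup f u else 0)" for u
  proof -
    have "lookup g u = (\<Sum>v\<in>keys f. if v = u then (if ht m - real B \<le> ht u then lookup f u else 0) else 0)"
      unfolding g_def lookup_frag_extend by (rule sum.cong) auto
    then show ?thesis by (auto simp: in_keys_iff)
  qed
  have keys_g: "u \<in> keys f" "ht m - real B \<le> ht u" if "u \<in> keys g" for u
    using that by (auto simp: in_keys_iff lookup_g split: if_splits)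
  have g0: "deep m 0 g" using f(1) keys_g(1) by (auto simp: deep_def)
  have g_dep: "n \<le> B" if "u \<in> keys g" "dep m n u" for u n
    using keys_g(2)[OF that(1)] ht_dep[OF that(2)] by simp
  have diff: "deep m (Suc (B + B')) (f - g)"
    unfolding deep_def
  proof
    fix u assume "u \<in> keys (f - g)"
    then have u: "u \<in> keys f" "ht u < ht m - real B"
      by (auto simp: in_keys_iff lookup_minus lookup_g split: if_splits)
    obtain n where n: "dep m n u" using f(1) u(1) by (auto simp: deep_def)
    have "\<not> n \<le> B" using u(2) ht_dep[OF n] by simp
    then have "Suc (B + B') \<le> n" using small[OF u(1) n] by (meson not_less_eq_eq)
    then show "\<exists>n\<ge>Suc (B + B'). dep m n u" using n by blast
  qed
  have "g \<in> K (S i)" for i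
  proof (rule rest_0_imp_K[OF S_adm deep_on_V[OF g0 m(1)]])
    have "deep m (Suc (B + B')) (rest (S i) f - rest (S i) (f - g))"
      by (rule deep_diff[OF rest deep_proj[OF diff S_adm m(1)]])
    then have deep: "deep m (Suc (B + B')) (rest (S i) g)" by (simp add: rest_diff)
    have "u \<notin> keys (rest (S i) g)" for u
    proof
      assume u: "u \<in> keys (rest (S i) g)"
      then obtain l where l: "l > B + B'" "dep m l u" using deep unfolding deep_def Suc_le_eq by blast
      from S_adm deep_on_V[OF g0 m(1)] u show False
      proof (cases rule: keys_rest)
        case 1
        then show False using g_dep l by fastforce
      next
        case (2 v a k)
        obtain j where j: "dep m j v" using g0 2(1) by (auto simp: deep_def)
        have jB: "j \<le> B" using g_dep[OF 2(1) j] .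
        have "dep m (j + k) u" using dep_cone[OF j 2(4)] 2(3) by (auto simp: S_def)
        then have "j + k = l" using dep_unique[OF l(2)] by blast
        moreover have "form (wt v) (wt v) \<le> c"
          using norm_bound[OF m(1) f(1,3) rest keys_g(1)[OF 2(1)] j] jB unfolding c_def by simp
        then have "k \<le> B'" using vdeg_le[of v i] 2(6) by simp
        ultimately show False using l(1) jB by simp
      qed
    qed
    then show "rest (S i) g = 0" by (metis all_not_in_conv keys_eq_empty)
  qed
  moreover have "lookup g m = 1" using f(2) by (simp add: lookup_g)
  moreover have "\<forall>u\<in>keys g. u \<noteq> m \<longrightarrow> \<not> dominant V u" using f(3) keys_g(1) by blast
  ultimately show ?thesis by blast
qed

text \<open>A monomial of largest height that is not dominant for some node would have a source of
  larger height.\<close>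

theorem dominant_exists:
  assumes "\<And>i. f \<in> K (S i)" "\<And>u. u \<in> keys f \<Longrightarrow> \<not> dominant V u"
  shows "f = 0"
proof (rule ccontr)
  assume "f \<noteq> 0"
  then have "keys f \<noteq> {}" by simp
  then have "Max (ht ` keys f) \<in> ht ` keys f" by (intro Max_in) auto
  then obtain u where u: "u \<in> keys f" "ht u = Max (ht ` keys f)" by fastforce
  obtain i where i: "\<not> dominant (S i) u" using assms(2) u(1) V_dominant by blast
  have SV: "S i \<subseteq> V" by (auto simp: S_def)
  have "lookup (rest (S i) f) u = 0" using rest_K[OF S_adm assms(1)] by simp
  with S_adm on_V_K[OF assms(1) SV] i u(1)
  obtain v a n where v: "v \<in> keys f" "dominant (S i) v" "u = v - a" "cone (S i) n a" "1 \<le> n"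
      "n \<le> nat (vdeg (S i) v)" by (rule rest_source)
  have "ht u < ht v" using v(3,5) ht_cone[OF v(4) SV] by (simp add: ht_diff)
  moreover have "ht v \<le> ht u" unfolding u(2) using v(1) by (intro Max_ge) auto
  ultimately show False by simp
qed

lemma unique_dominant_unique:
  assumes "\<And>i. f \<in> K (S i)" "\<And>i. g \<in> K (S i)"
    and "\<And>u. keys u \<subseteq> V \<Longrightarrow> dominant V u \<Longrightarrow> u \<notin> keys (f - h) \<and> u \<notin> keys (g - h)"
  shows "f = g"
proof -
  have K: "f - g \<in> K (S i)" for i using assms(1,2) by (rule K_diff)
  have "f - g = 0"
  proof (rule dominant_exists[OF K])
    fix u assume u: "u \<in> keys (f - g)"
    then have "u \<in> keys ((f - h) - (g - h))" by simp
    moreover have "keys u \<subseteq> V" using K_keys[OF K _ u] by (auto simp: S_def)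
    ultimately show "\<not> dominant V u" using assms(3) keys_diffD by metis
  qed
  then show ?thesis by simp
qed

end

section \<open>Rank two\<close>

context screening
begin

lemma led_add:
  assumes f: "led V N m f" and g: "led V N' (m - a) g" and a: "cone V k a" "1 \<le> k"
  shows "led V (N + N' + k) m (f + g)"
  unfolding led_def
proof
  fix u assume u: "u \<in> keys (f + g - frag_of m)"
  have eq: "f + g - frag_of m = (f - frag_of m) + ((g - frag_of (m - a)) + frag_of (m - a))"
    by simp
  consider "u \<in> keys (f - frag_of m)" | "u \<in> keys (g - frag_of (m - a))" | "u = m - a"
    using keys_addD[OF u[unfolded eq]] keys_addD[of u "g - frag_of (m - a)" "frag_of (m - a)"]
    unfolding keys_frag_of by blast
  then show "\<exists>b n. u = m - b \<and> cone V n b \<and> 1 \<le> n \<and> n \<le> N + N' + k"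
  proof cases
    case 1
    with f obtain b n where "u = m - b" "cone V n b" "1 \<le> n" "n \<le> N" by (rule ledE)
    then show ?thesis by (intro exI[of _ b] exI[of _ n]) auto
  next
    case 2
    with g obtain b n where "u = m - a - b" "cone V n b" "1 \<le> n" "n \<le> N'" by (rule ledE)
    then show ?thesis
      using cone_add[OF _ a(1), of n b] by (intro exI[of _ "b + a"] exI[of _ "n + k"]) (auto simp: ac_simps)
  next
    case 3
    then show ?thesis using a by (intro exI[of _ a] exI[of _ k]) auto
  qed
qed

text \<open>The analogue of the \<open>q\<close>-character of a Kirillov--Reshetikhin module of rank one, with
  highest monomial \<open>y 0 + \<dots> + y (k - 1)\<close>.\<close>

fun KR :: "(nat \<Rightarrow> 'v) \<Rightarrow> nat \<Rightarrow> ('v \<Rightarrow>\<^sub>0 int) \<Rightarrow>\<^sub>0 int" where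
  "KR y 0 = 1"
| "KR y (Suc k) = frag_of (\<Sum>l<Suc k. frag_of (y l)) + frag_of (frag_of (y k) - A (y k)) * KR y k"

lemma keys_frag_of_A: "x \<in> V \<Longrightarrow> keys (frag_of x - A x) \<subseteq> V"
  using keys_diff[of "frag_of x" "A x"] keys_A[of x] by auto

lemma keys_sum_frag_of: "(\<And>l. l < k \<Longrightarrow> y l \<in> V) \<Longrightarrow> keys (\<Sum>l<k. frag_of (y l)) \<subseteq> V"
  using keys_sum[of "\<lambda>l. frag_of (y l)" "{..<k}"] by auto

lemma KR_led:
  assumes "\<And>l. l < k \<Longrightarrow> y l \<in> V"
  shows "\<exists>N. led V N (\<Sum>l<k. frag_of (y l)) (KR y k)"
  using assms
proof (induction k)
  case 0
  then show ?case using led_1[of V] by auto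
next
  case (Suc k)
  then obtain N where N: "led V N (\<Sum>l<k. frag_of (y l)) (KR y k)" by auto
  let ?m = "\<Sum>l<Suc k. frag_of (y l)"
  have "led V (0 + N) (frag_of (y k) - A (y k) + (\<Sum>l<k. frag_of (y l)))
      (frag_of (frag_of (y k) - A (y k)) * KR y k)"
    using led_frag_of N by (rule led_mult)
  then have "led V (0 + N) (?m - A (y k)) (frag_of (frag_of (y k) - A (y k)) * KR y k)"
    by (simp add: algebra_simps)
  from led_add[OF led_frag_of this cone_1[OF Suc.prems]]
  show ?case by (auto simp del: sum.lessThan_Suc)
qed

text \<open>A three-term recursion: \<open>KR y (Suc j) * gen (y (Suc j))\<close> has, besides the
  wanted terms, those in which \<open>y j\<close> is lowered while \<open>y (Suc j)\<close> is kept.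
  They sum up to \<open>frag_of ?u * KR y j\<close>, and \<open>?u\<close> is a unit of
  \<open>K S\<close> because the part of \<open>A (y j)\<close> in \<open>S\<close> is exactly
  \<open>y j\<close> and \<open>y (Suc j)\<close>.\<close>

lemma KR_in_K:
  assumes "S \<subseteq> V" "\<And>l. l < k \<Longrightarrow> y l \<in> S"
    and "\<And>l. Suc l < k \<Longrightarrow> vpart S (A (y l)) = frag_of (y l) + frag_of (y (Suc l))"
  shows "KR y k \<in> K S"
  using assms(2,3)
proof (induction k rule: less_induct)
  case (less k)
  consider "k = 0" | "k = 1" | j where "k = Suc (Suc j)" by (metis One_nat_def old.nat.exhaust)
  then show ?case
  proof cases
    case 1
    then show ?thesis by (simp add: K_1)
  next
    case 2
    then have "KR y k = gen (y 0)" by (simp add: gen_def)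
    then show ?thesis using less.prems(1)[of 0] 2 gen_in_K by simp
  next
    case (3 j)
    let ?u = "frag_of (y j) + frag_of (y (Suc j)) - A (y j)"
    have "KR y k = KR y (Suc j) * gen (y (Suc j)) - frag_of ?u * KR y j"
    proof -
      have "frag_of ?u = frag_of (frag_of (y (Suc j))) * frag_of (frag_of (y j) - A (y j))"
        by (simp flip: frag_of_add add: algebra_simps)
      moreover have "frag_of (\<Sum>l<k. frag_of (y l))
          = frag_of (frag_of (y (Suc j))) * frag_of (\<Sum>l<Suc j. frag_of (y l))"
        unfolding 3 by (simp flip: frag_of_add add: algebra_simps)
      ultimately show ?thesis
        unfolding 3 by (simp add: gen_def algebra_simps del: sum.lessThan_Suc)
    qed
    moreover have "keys ?u \<subseteq> V"
      using keys_frag_of_A[of "y j"] less.prems(1)[of j] less.prems(1)[of "Suc j"] 3 assms(1)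
        keys_add[of "frag_of (y j) - A (y j)" "frag_of (y (Suc j))"] by (auto simp: algebra_simps)
    moreover have "vpart S ?u = 0"
      using less.prems(1)[of j] less.prems(1)[of "Suc j"] less.prems(2)[of j] 3 by simp
    moreover have "KR y (Suc j) \<in> K S" "KR y j \<in> K S" "gen (y (Suc j)) \<in> K S"
      using 3 less.prems by (auto intro!: less.IH gen_in_K simp del: KR.simps)
    ultimately show ?thesis by (auto intro!: K_diff K_mult unit_in_K)
  qed
qed

lemma KR_in_K_units:
  assumes "\<And>l. l < k \<Longrightarrow> y l \<in> V" "\<And>l. l < k \<Longrightarrow> y l \<notin> S" "\<And>l. l < k \<Longrightarrow> vpart S (A (y l)) = 0"
  shows "KR y k \<in> K S"
  using assms
proof (induction k)
  case (Suc k)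
  have "frag_of (\<Sum>l<Suc k. frag_of (y l)) \<in> K S"
    by (rule unit_in_K[OF keys_sum_frag_of]) (use Suc.prems in \<open>auto simp del: sum.lessThan_Suc\<close>)
  moreover have "frag_of (frag_of (y k) - A (y k)) \<in> K S"
    by (rule unit_in_K[OF keys_frag_of_A]) (use Suc.prems in auto)
  ultimately show ?case using Suc by (auto intro!: K_add K_mult simp del: sum.lessThan_Suc)
qed (simp add: K_1)

lemma KR_diff: "KR y (Suc k) - frag_of (\<Sum>l<Suc k. frag_of (y l)) = frag_of (frag_of (y k) - A (y k)) * KR y k"
  by simp

text \<open>The two kinds of fundamental elements of rank two. Here \<open>P\<close> is the orbit of the long node and
  \<open>Q\<close> the orbit of the short one.\<close>

lemma rank2_long:
  assumes sub: "P \<subseteq> V" "Q \<subseteq> V" "P \<inter> Q = {}"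
    and x: "x \<in> P" "x' \<in> P" "vpart P (A x) = frag_of x + frag_of x'"
      "vpart Q (A x) = - (\<Sum>l<Suc s. frag_of (y l))"
    and y: "\<And>l. l \<le> s \<Longrightarrow> y l \<in> Q" "\<And>l. l < s \<Longrightarrow> vpart Q (A (y l)) = frag_of (y l) + frag_of (y (Suc l))"
      "\<And>l. l < s \<Longrightarrow> vpart P (A (y l)) = 0" "vpart P (A (y s)) = - frag_of x'"
  shows "\<exists>T\<in>K P \<inter> K Q. \<exists>N. led V N (frag_of x) T"
proof -
  define \<sigma> where "\<sigma> = (\<Sum>l<Suc s. frag_of (y l))"
  \<comment> \<open>Lowering \<open>x\<close> creates the factor \<open>\<sigma>\<close> in the
    variables of \<open>Q\<close>. \<open>u\<close> is what is left without it, a unit of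
    \<open>K Q\<close>, and \<open>KR\<close> completes \<open>\<sigma>\<close> to an element of
    \<open>K Q\<close>.\<close>
  define u where "u = frag_of x - A x - \<sigma>"
  define T where "T = frag_of (frag_of x) + frag_of u * KR y (Suc s)"
  have notin: "x \<notin> Q" "x' \<notin> Q" "\<And>l. l \<le> s \<Longrightarrow> y l \<notin> P" using x(1,2) y(1) sub(3) by auto
  have V: "x \<in> V" "\<And>l. l \<le> s \<Longrightarrow> y l \<in> V" using x(1) y(1) sub by auto
  have \<sigma>V: "keys \<sigma> \<subseteq> V" unfolding \<sigma>_def by (rule keys_sum_frag_of) (use V in auto)
  have \<sigma>Q: "vpart Q \<sigma> = \<sigma>" and \<sigma>P: "vpart P \<sigma> = 0"
    unfolding \<sigma>_def using y(1) notin(3) by (auto intro!: sum.cong sum.neutral simp del: sum.lessThan_Suc)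
  have uV: "keys u \<subseteq> V"
    unfolding u_def using keys_frag_of_A[OF V(1)] \<sigma>V keys_diff[of "frag_of x - A x" \<sigma>] by blast
  have "T \<in> K Q"
    unfolding T_def
  proof (intro K_add K_mult unit_in_K KR_in_K)
    show "vpart Q u = 0" unfolding u_def using \<sigma>Q x(4) notin by (simp add: \<sigma>_def)
  qed (use V uV sub y notin in auto)
  moreover have "T \<in> K P"
  proof -
    \<comment> \<open>Seen from \<open>P\<close>, the leading term \<open>u + \<sigma>\<close>
      completes \<open>x\<close> to \<open>gen x\<close>. In all other terms \<open>y s\<close> is
      lowered, which contributes \<open>x'\<close> and cancels the \<open>- x'\<close> contained in
      \<open>u\<close>; hence \<open>v\<close> is a unit of \<open>K P\<close>.\<close>
    define v where "v = u + (frag_of (y s) - A (y s))"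
    have "frag_of u * KR y (Suc s) = frag_of (u + \<sigma>) + frag_of v * KR y s"
      unfolding v_def frag_of_add \<sigma>_def by (simp add: algebra_simps)
    then have "T = gen x + frag_of v * KR y s" by (simp add: T_def gen_def u_def)
    moreover have "frag_of v \<in> K P"
    proof (rule unit_in_K)
      show "keys v \<subseteq> V"
        unfolding v_def using uV keys_frag_of_A[OF V(2)[of s]] keys_add[of u "frag_of (y s) - A (y s)"] by auto
      show "vpart P v = 0"
        unfolding v_def u_def using \<sigma>P x notin y(4) by simp
    qed
    moreover have "KR y s \<in> K P" by (rule KR_in_K_units) (use V notin y in auto)
    ultimately show ?thesis using x(1) by (auto intro!: K_add K_mult gen_in_K)
  qed
  moreover have "\<exists>N. led V N (frag_of x) T"
  proof -
    obtain N where "led V N \<sigma> (KR y (Suc s))"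
      unfolding \<sigma>_def using KR_led[of "Suc s" y] V by auto
    from led_mult[OF led_frag_of this, of u]
    have "led V (0 + N) (frag_of x - A x) (frag_of u * KR y (Suc s))" by (simp add: u_def)
    from led_add[OF led_frag_of this cone_1[OF V(1)]] show ?thesis unfolding T_def by auto
  qed
  ultimately show ?thesis by blast
qed

text \<open>Lowering \<open>w\<close> creates \<open>x\<close>, which must be lowered in turn. This
  creates \<open>w'\<close>, cancelled by the \<open>w'\<close> in \<open>A w\<close>, and the
  string \<open>\<sigma>\<close>, completed by \<open>KR\<close>. For \<open>s = 0\<close> these are
  the three terms of type A2. A variable of \<open>Q\<close> whose \<open>A\<close> does not meet
  \<open>P\<close> is left to \<open>rank2_decoupled\<close>.\<close>

lemma rank2_short:
  assumes sub: "P \<subseteq> V" "Q \<subseteq> V" "P \<inter> Q = {}"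
    and w: "w \<in> Q" "w' \<in> Q" "vpart Q (A w) = frag_of w + frag_of w'" "vpart P (A w) = - frag_of x"
    and x: "x \<in> P" "x' \<in> P" "vpart P (A x) = frag_of x + frag_of x'"
      "vpart Q (A x) = - (frag_of w' + (\<Sum>l<s. frag_of (y l)))"
    and y: "\<And>l. l < s \<Longrightarrow> y l \<in> Q" "\<And>l. Suc l < s \<Longrightarrow> vpart Q (A (y l)) = frag_of (y l) + frag_of (y (Suc l))"
      "\<And>l. Suc l < s \<Longrightarrow> vpart P (A (y l)) = 0" "\<And>l. Suc l = s \<Longrightarrow> vpart P (A (y l)) = - frag_of x'"
  shows "\<exists>T\<in>K P \<inter> K Q. \<exists>N. led V N (frag_of w) T"
proof -
  define \<sigma> where "\<sigma> = (\<Sum>l<s. frag_of (y l))"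
  define v where "v = frag_of w - A w - A x - \<sigma>"
  define T where "T = gen w + frag_of v * KR y s"
  have notin: "x \<notin> Q" "x' \<notin> Q" "w \<notin> P" "w' \<notin> P" "\<And>l. l < s \<Longrightarrow> y l \<notin> P"
    using x(1,2) w(1,2) y(1) sub(3) by auto
  have V: "x \<in> V" "w \<in> V" "\<And>l. l < s \<Longrightarrow> y l \<in> V" using x(1) w(1) y(1) sub by auto
  have \<sigma>V: "keys \<sigma> \<subseteq> V" unfolding \<sigma>_def by (rule keys_sum_frag_of) (use V in auto)
  have \<sigma>Q: "vpart Q \<sigma> = \<sigma>" and \<sigma>P: "vpart P \<sigma> = 0"
    unfolding \<sigma>_def using y(1) notin(5) by (auto intro!: sum.cong sum.neutral)
  have wxV: "keys (frag_of w - A w - A x) \<subseteq> V"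
    using keys_frag_of_A[OF V(2)] keys_A[OF V(1)] keys_diff[of "frag_of w - A w" "A x"] by blast
  have vV: "keys v \<subseteq> V"
    unfolding v_def using wxV \<sigma>V keys_diff[of "frag_of w - A w - A x" \<sigma>] by blast
  have "T \<in> K Q"
    unfolding T_def
  proof (intro K_add K_mult unit_in_K KR_in_K gen_in_K)
    show "vpart Q v = 0" unfolding v_def using \<sigma>Q x(4) w notin by (simp add: \<sigma>_def)
  qed (use V vV sub y w in auto)
  moreover have "T \<in> K P"
  proof -
    let ?u = "frag_of w - A w - frag_of x"
    \<comment> \<open>Seen from \<open>P\<close> the terms are regrouped: \<open>w\<close> is a
      unit, the lowered \<open>w\<close> and the leading term of \<open>frag_of v * KR y s\<close>
      form a unit multiple of \<open>gen x\<close>, and in all remaining terms the last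
      \<open>y\<close> is lowered, which cancels \<open>x'\<close> as in the long case.\<close>
    have "frag_of ?u * gen x = frag_of (frag_of w - A w) + frag_of (v + \<sigma>)"
      unfolding gen_def distrib_left by (simp flip: frag_of_add add: v_def algebra_simps)
    then have T: "T = frag_of (frag_of w) + frag_of ?u * gen x + frag_of v * (KR y s - frag_of \<sigma>)"
      by (simp add: T_def gen_def frag_of_add algebra_simps)
    have t1: "frag_of v * (KR y s - frag_of \<sigma>) \<in> K P"
    proof (cases s)
      case 0
      then show ?thesis by (simp add: \<sigma>_def K_0)
    next
      case (Suc s')
      define v' where "v' = v + (frag_of (y s') - A (y s'))"
      have "frag_of v * (KR y s - frag_of \<sigma>) = frag_of v' * KR y s'"
        unfolding Suc \<sigma>_def KR_diff v'_def frag_of_add by (simp add: mult.assoc)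
      moreover have "frag_of v' \<in> K P"
      proof (rule unit_in_K)
        show "keys v' \<subseteq> V"
          unfolding v'_def using vV keys_frag_of_A[OF V(3)[of s']] keys_add[of v "frag_of (y s') - A (y s')"] Suc by auto
        show "vpart P v' = 0"
          unfolding v'_def v_def using \<sigma>P x w notin y(4)[of s'] Suc by simp
      qed
      moreover have "KR y s' \<in> K P" by (rule KR_in_K_units) (use V notin y Suc in auto)
      ultimately show ?thesis by (auto intro: K_mult)
    qed
    have t2: "frag_of ?u \<in> K P"
    proof (rule unit_in_K)
      show "keys ?u \<subseteq> V"
        using keys_frag_of_A[OF V(2)] V(1) keys_diff[of "frag_of w - A w" "frag_of x"] by auto
      show "vpart P ?u = 0" using notin w x by simp
    qed
    have t3: "frag_of (frag_of w) \<in> K P" by (rule unit_in_K) (use V notin in auto)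
    show ?thesis
      using K_add[OF K_add[OF t3 K_mult[OF t2 gen_in_K[OF x(1)]]] t1] unfolding T .
  qed
  moreover have "\<exists>N. led V N (frag_of w) T"
  proof -
    obtain N where "led V N \<sigma> (KR y s)"
      unfolding \<sigma>_def using KR_led[of s y] V by auto
    from led_mult[OF led_frag_of this, of v]
    have "led V (0 + N) (frag_of w - (A w + A x)) (frag_of v * KR y s)" by (simp add: v_def algebra_simps)
    from led_add[OF led_gen[OF V(2)] this cone_add[OF cone_1[OF V(1)] cone_1[OF V(2)]]]
    show ?thesis unfolding T_def by auto
  qed
  ultimately show ?thesis by blast
qed

lemma rank2_decoupled:
  assumes "P \<subseteq> V" "Q \<subseteq> V" "P \<inter> Q = {}" "w \<in> Q" "vpart P (A w) = 0"
  shows "\<exists>T\<in>K P \<inter> K Q. \<exists>N. led V N (frag_of w) T"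
proof -
  have w: "w \<in> V" "w \<notin> P" using assms by auto
  have "gen w \<in> K P"
    unfolding gen_def by (intro K_add unit_in_K keys_frag_of_A) (use w assms(5) in auto)
  then show ?thesis using gen_in_K[OF assms(4)] led_gen[OF w(1)] by blast
qed

end

section \<open>Spectral parameters\<close>

text \<open>Variables are pairs of a node \<open>i\<close> and a parameter in \<open>Vs i\<close>; the shift of node \<open>i\<close> is
  multiplication by \<open>P i\<close>, and \<open>A (i, a)\<close> involves the variables of \<open>j\<close> with parameters in
  \<open>N i j a\<close>. In \<open>pattern i j s y\<close> the node \<open>i\<close> is at least as long as \<open>j\<close>.\<close>

locale spectral =
  fixes Vs :: "'i::finite \<Rightarrow> complex set" and P :: "'i \<Rightarrow> complex"
    and N :: "'i \<Rightarrow> 'i \<Rightarrow> complex \<Rightarrow> complex set" and M :: "'i \<Rightarrow> 'i \<Rightarrow> int" and W :: "'i \<Rightarrow> real"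
  assumes Vs_nz: "a \<in> Vs i \<Longrightarrow> a \<noteq> 0"
    and P_nz: "P i \<noteq> 0"
    and P_generic: "P i powi n = 1 \<Longrightarrow> n = 0"
    and Vs_P: "a \<in> Vs i \<Longrightarrow> a * P i powi n \<in> Vs i"
    and N_subset: "a \<in> Vs i \<Longrightarrow> N i j a \<subseteq> Vs j"
    and N_finite: "a \<in> Vs i \<Longrightarrow> finite (N i j a)"
    and N_self: "N i i a = {}"
    and N_card: "a \<in> Vs i \<Longrightarrow> i \<noteq> j \<Longrightarrow> M i j = - int (card (N i j a))"
    and M_diag: "M i i = 2"
    and W_pos: "W i > 0"
    and M_symm: "of_int (M i j) * W j = of_int (M j i) * W i"
    and M_pos: "c \<noteq> (\<lambda>_. 0) \<Longrightarrow> (\<Sum>i\<in>UNIV. \<Sum>j\<in>UNIV. of_int (M i j) * W j * c i * c j) > (0::real)"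
begin

text \<open>Under \<open>y\<close> one shift by \<open>P i\<close> becomes \<open>s + 1\<close>
  shifts by \<open>P j\<close>, so the neighbour strings of the successive points of an orbit of
  \<open>i\<close> tile an orbit of \<open>j\<close>. The last condition is the reciprocal relation:
  the variable of node \<open>j\<close> whose \<open>A\<close> involves \<open>a * P i\<close> is
  the last one of the string of \<open>a\<close>. The \<open>q\<close>-side has
  \<open>s + 1 = d i div d j\<close>, the \<open>t\<close>-side \<open>s = 0\<close>.\<close>

definition pattern :: "'i \<Rightarrow> 'i \<Rightarrow> nat \<Rightarrow> (complex \<Rightarrow> complex) \<Rightarrow> bool" where
  "pattern i j s y \<longleftrightarrow> (\<forall>a\<in>Vs i. y a \<in> Vs j \<and> N i j a = (\<lambda>k. y a * P j ^ k) ` {..<Suc s} \<and>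
      y (a * P i) = y a * P j ^ Suc s) \<and>
    (\<forall>a\<in>Vs i. \<forall>w\<in>Vs j. a * P i \<in> N j i w \<longleftrightarrow> w = y a * P j ^ s)"

definition V :: "('i \<times> complex) set" where
  "V = {(i, a). a \<in> Vs i}"

text \<open>Indexed by the first of the two variables of its own node instead of the point midway
  between them, so that \<open>x\<close> and \<open>A x\<close> fit together in
  \<open>gen x\<close>. For the \<open>B_ex\<close> the midpoint belonging to \<open>a\<close> is
  \<open>a * q ^ d i * t\<close>.\<close>

definition A :: "'i \<times> complex \<Rightarrow> ('i \<times> complex) \<Rightarrow>\<^sub>0 int" where
  "A x = frag_of x + frag_of (fst x, snd x * P (fst x))
     - (\<Sum>j\<in>UNIV. \<Sum>b\<in>N (fst x) j (snd x). frag_of (j, b))"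

definition orb :: "'i \<times> complex \<Rightarrow> ('i \<times> complex) set" where
  "orb x = {(fst x, snd x * P (fst x) powi n) | n. True}"

lemma Vs_P1: "a \<in> Vs i \<Longrightarrow> a * P i \<in> Vs i"
  using Vs_P[of a i 1] by simp

lemma Vs_Pn: "a \<in> Vs i \<Longrightarrow> a * P i ^ n \<in> Vs i"
  using Vs_P[of a i "int n"] by simp

lemma P_inj: "P i powi n = P i powi k \<longleftrightarrow> n = k"
proof
  assume "P i powi n = P i powi k"
  then have "P i powi (n - k) = 1" using P_nz[of i] by (simp add: power_int_diff)
  then show "n = k" using P_generic by fastforce
qed simp

sublocale screening V A
proof
  fix x assume "x \<in> V"
  then have x: "snd x \<in> Vs (fst x)" by (auto simp: V_def)
  have "keys (\<Sum>j\<in>UNIV. \<Sum>b\<in>N (fst x) j (snd x). frag_of (j, b)) \<subseteq> V"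
  proof
    fix u assume "u \<in> keys (\<Sum>j\<in>UNIV. \<Sum>b\<in>N (fst x) j (snd x). frag_of (j, b))"
    then obtain j where "u \<in> keys (\<Sum>b\<in>N (fst x) j (snd x). frag_of (j, b))"
      using keys_sum[of "\<lambda>j. \<Sum>b\<in>N (fst x) j (snd x). frag_of (j, b)" UNIV] by blast
    then obtain b where "b \<in> N (fst x) j (snd x)" "u \<in> keys (frag_of (j, b))"
      using keys_sum[of "\<lambda>b. frag_of (j, b)" "N (fst x) j (snd x)"] by blast
    then show "u \<in> V" using N_subset[OF x, of j] by (auto simp: V_def)
  qed
  moreover have "x \<in> V" "(fst x, snd x * P (fst x)) \<in> V" using x Vs_P1[OF x] by (auto simp: V_def)
  ultimately show "keys (A x) \<subseteq> V"
    unfolding A_def by (auto dest!: keys_diffD keys_addD)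
qed

lemma vpart_A:
  assumes "S \<subseteq> {j} \<times> UNIV" "a \<in> Vs i"
  shows "vpart S (A (i, a)) = (if (i, a) \<in> S then frag_of (i, a) else 0)
    + (if (i, a * P i) \<in> S then frag_of (i, a * P i) else 0)
    - (\<Sum>b\<in>{b \<in> N i j a. (j, b) \<in> S}. frag_of (j, b))"
proof -
  have "(\<Sum>k\<in>UNIV. \<Sum>b\<in>N i k a. vpart S (frag_of (k, b)))
      = (\<Sum>k\<in>UNIV. if k = j then (\<Sum>b\<in>N i j a. vpart S (frag_of (j, b))) else 0)"
    using assms(1) by (intro sum.cong refl) (auto intro!: sum.neutral)
  also have "\<dots> = (\<Sum>b\<in>{b \<in> N i j a. (j, b) \<in> S}. frag_of (j, b))"
    using N_finite[OF assms(2)] by (simp add: sum.inter_filter)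
  finally show ?thesis by (simp add: A_def)
qed

lemma vdeg_A_eq:
  assumes "S \<subseteq> {j} \<times> UNIV" "a \<in> Vs i"
  shows "vdeg S (A (i, a)) = (if (i, a) \<in> S then 1 else 0) + (if (i, a * P i) \<in> S then 1 else 0)
    - int (card {b \<in> N i j a. (j, b) \<in> S})"
proof -
  have "(\<Sum>k\<in>UNIV. \<Sum>b\<in>N i k a. vdeg S (frag_of (k, b)))
      = (\<Sum>k\<in>UNIV. if k = j then (\<Sum>b\<in>N i j a. vdeg S (frag_of (j, b))) else 0)"
    using assms(1) by (intro sum.cong refl) (auto intro!: sum.neutral)
  also have "\<dots> = int (card {b \<in> N i j a. (j, b) \<in> S})"
    using N_finite[OF assms(2)] by (simp add: sum.inter_filter[symmetric])
  finally show ?thesis by (simp add: A_def)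
qed

lemma orb_fst: "orb (i, a) \<subseteq> {i} \<times> UNIV"
  by (auto simp: orb_def)

lemma in_orb_iff: "(j, b) \<in> orb (i, a) \<longleftrightarrow> j = i \<and> (\<exists>n. b = a * P i powi n)"
  by (auto simp: orb_def)

lemma orb_P: "(i, b * P i) \<in> orb (i, a) \<longleftrightarrow> (i, b) \<in> orb (i, a)"
proof
  assume "(i, b * P i) \<in> orb (i, a)"
  then obtain n where "b * P i = a * P i powi n" by (auto simp: in_orb_iff)
  then have "b = a * P i powi (n - 1)" using P_nz[of i] by (simp add: power_int_diff field_simps)
  then show "(i, b) \<in> orb (i, a)" by (auto simp: in_orb_iff)
next
  assume "(i, b) \<in> orb (i, a)"
  then obtain n where "b = a * P i powi n" by (auto simp: in_orb_iff)
  then have "b * P i = a * P i powi (n + 1)" using P_nz[of i] by (simp add: power_int_add)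
  then show "(i, b * P i) \<in> orb (i, a)" unfolding in_orb_iff by blast
qed

lemma orb_Pn: "(i, b * P i ^ k) \<in> orb (i, a) \<longleftrightarrow> (i, b) \<in> orb (i, a)"
proof (induction k)
  case (Suc k)
  then show ?case using orb_P[of i "b * P i ^ k" a] by (simp add: ac_simps)
qed simp

lemma orb_refl: "x \<in> orb x"
  by (cases x) (auto simp: in_orb_iff intro: exI[of _ 0])

lemma orb_sub: "x \<in> V \<Longrightarrow> orb x \<subseteq> V"
  by (auto simp: orb_def V_def Vs_P)

lemma orb_eq:
  assumes "y \<in> orb x"
  shows "orb y = orb x"
proof -
  obtain i a n where xy: "x = (i, a)" "y = (i, a * P i powi n)"
    using assms by (cases x) (auto simp: orb_def)
  have "(\<exists>k. c = a * P i powi n * P i powi k) \<longleftrightarrow> (\<exists>k. c = a * P i powi k)" for c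
  proof
    assume "\<exists>k. c = a * P i powi n * P i powi k"
    then obtain k where "c = a * P i powi n * P i powi k" ..
    then have "c = a * P i powi (n + k)" using P_nz[of i] by (simp add: power_int_add)
    then show "\<exists>k. c = a * P i powi k" ..
  next
    assume "\<exists>k. c = a * P i powi k"
    then obtain k where "c = a * P i powi k" ..
    then have "c = a * P i powi n * P i powi (k - n)" using P_nz[of i] by (simp add: power_int_diff)
    then show "\<exists>k. c = a * P i powi n * P i powi k" ..
  qed
  then show ?thesis unfolding xy by (simp add: set_eq_iff in_orb_iff split_paired_All)
qed

lemma orb_disjoint: "orb x \<noteq> orb y \<Longrightarrow> orb x \<inter> orb y = {}"
  using orb_eq by blast

lemma orb_admissible:
  assumes "x \<in> V"
  shows "adm (orb x)"
proof -
  obtain i a where x: "x = (i, a)" by (cases x)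
  have "vdeg (orb x) (A y) = 2" if yx: "y \<in> orb x" for y
  proof -
    obtain b where y: "y = (i, b)" using yx x by (auto simp: orb_def)
    have "b \<in> Vs i" using yx orb_sub[OF assms] by (auto simp: y V_def)
    then show ?thesis
      using yx vdeg_A_eq[OF orb_fst, of b i i a] by (simp add: x y N_self orb_P)
  qed
  then show ?thesis using orb_sub[OF assms] by (simp add: adm_def)
qed

text \<open>Since \<open>N i i a\<close> is empty, different orbits of the same node do not
  interact: a generator belonging to another orbit is a sum of two units.\<close>

lemma orb_K:
  assumes "x \<in> V"
  shows "K {y \<in> V. fst y = fst x} \<subseteq> K (orb x)"
proof -
  obtain i a where x: "x = (i, a)" by (cases x)
  have "gen y \<in> K (orb x)" if y: "y \<in> V" "fst y = i" for y
  proof (cases "y \<in> orb x")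
    case False
    obtain b where yb: "y = (i, b)" using y by (cases y) auto
    have "vpart (orb x) (A y) = 0"
      using False vpart_A[OF orb_fst, of b i i a] y by (simp add: x yb V_def N_self orb_P)
    then show ?thesis unfolding gen_def using False y keys_frag_of_A[of y]
      by (intro K_add unit_in_K) auto
  qed (rule gen_in_K)
  moreover have "frag_of (frag_of y) \<in> K (orb x)" "frag_of (- frag_of y) \<in> K (orb x)"
    if "y \<in> V" "fst y \<noteq> i" for y
    using that by (auto intro!: unit_in_K simp: x orb_def)
  ultimately show ?thesis by (intro K_subset) (auto simp: x)
qed

context
  fixes i j :: 'i and s :: nat and y :: "complex \<Rightarrow> complex" and a b :: complex
  assumes ij: "i \<noteq> j" and pat: "pattern i j s y" and a: "a \<in> Vs i" and b: "b \<in> Vs j"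
begin

lemma pattern_y: "c \<in> Vs i \<Longrightarrow> y c \<in> Vs j"
  and pattern_N: "c \<in> Vs i \<Longrightarrow> N i j c = (\<lambda>k. y c * P j ^ k) ` {..<Suc s}"
  and pattern_shift: "c \<in> Vs i \<Longrightarrow> y (c * P i) = y c * P j ^ Suc s"
  and pattern_back: "c \<in> Vs i \<Longrightarrow> w \<in> Vs j \<Longrightarrow> c * P i \<in> N j i w \<longleftrightarrow> w = y c * P j ^ s"
  using pat unfolding pattern_def by blast+

lemma pattern_shift_int:
  assumes "c \<in> Vs i"
  shows "y (c * P i powi n) = y c * P j powi (n * int (Suc s))"
proof -
  have nat: "y (c * P i ^ k) = y c * P j ^ (k * Suc s)" if "c \<in> Vs i" for c k
  proof (induction k)
    case (Suc k)
    then show ?case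
      using pattern_shift[OF Vs_Pn[OF that, of k]] by (simp add: power_add ac_simps)
  qed simp
  have int: "P j powi (int k * int (Suc s)) = P j ^ (k * Suc s)" for k
    unfolding of_nat_mult[symmetric] power_int_of_nat ..
  show ?thesis
  proof (cases "n \<ge> 0")
    case True
    then obtain k where k: "n = int k" using nonneg_int_cases by blast
    show ?thesis unfolding k int power_int_of_nat by (rule nat[OF assms])
  next
    case False
    then obtain k where k: "n = - int k" using nonpos_int_cases by (metis linear)
    have eq: "c * P i powi n * P i ^ k = c"
      using P_nz[of i] by (simp add: k power_int_minus field_simps)
    have "y c = y (c * P i powi n) * P j ^ (k * Suc s)"
      using nat[OF Vs_P[OF assms, of n], of k] by (simp only: eq)
    then show ?thesis using P_nz[of j]
      unfolding k mult_minus_left power_int_minus[of "P j"] int by (simp add: field_simps)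
  qed
qed

lemma pattern_back_orb:
  assumes "w \<in> Vs j"
  shows "{c \<in> N j i w. (i, c) \<in> orb (i, a)} = {a * P i powi n * P i | n. w = y (a * P i powi n) * P j ^ s}"
proof -
  have "a * P i powi n * P i \<in> N j i w \<longleftrightarrow> w = y (a * P i powi n) * P j ^ s" for n
    using pattern_back[OF Vs_P[OF a] assms] .
  moreover have "\<exists>n. c = a * P i powi n * P i" if c: "(i, c) \<in> orb (i, a)" for c
  proof -
    obtain n where "c = a * P i powi n" using c by (auto simp: in_orb_iff)
    then have "c = a * P i powi (n - 1) * P i" using P_nz[of i] by (simp add: power_int_diff)
    then show ?thesis by blast
  qed
  moreover have "(i, a * P i powi n * P i) \<in> orb (i, a)" for n
    unfolding orb_P by (auto simp: in_orb_iff)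
  ultimately show ?thesis by auto metis+
qed

lemma pattern_vpart_back:
  assumes "w \<in> Vs j"
  shows "vpart (orb (i, a)) (A (j, w))
    = - (\<Sum>c\<in>{a * P i powi n * P i | n. w = y (a * P i powi n) * P j ^ s}. frag_of (i, c))"
  using vpart_A[OF orb_fst assms, of i a] ij unfolding pattern_back_orb[OF assms]
  by (simp add: in_orb_iff)

text \<open>The point in question has position \<open>n * (s + 1) + l\<close> on the orbit of
  \<open>y a\<close>. With \<open>l \<le> s\<close>, division with remainder recovers
  \<open>n\<close> and \<open>l\<close>, so only the last point of a string sees the orbit of
  \<open>(i, a)\<close>, and it sees a single variable of it.\<close>

lemma pattern_vpart_back_string:
  assumes "l \<le> s"
  shows "vpart (orb (i, a)) (A (j, y (a * P i powi n) * P j ^ l))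
    = (if l = s then - frag_of (i, a * P i powi n * P i) else 0)"
proof -
  have "y (a * P i powi n) * P j ^ l = y (a * P i powi k) * P j ^ s \<longleftrightarrow> l = s \<and> k = n" for k
  proof -
    have y: "y (a * P i powi k) * P j ^ l = y a * P j powi (k * int (Suc s) + int l)" for k l
      using P_nz[of j] by (simp add: pattern_shift_int[OF a] power_int_add)
    have "y (a * P i powi n) * P j ^ l = y (a * P i powi k) * P j ^ s \<longleftrightarrow>
        n * int (Suc s) + int l = k * int (Suc s) + int s"
      unfolding y using Vs_nz[OF pattern_y[OF a]] by (simp add: P_inj)
    also have "\<dots> \<longleftrightarrow> l = s \<and> k = n"
    proof
      assume eq: "n * int (Suc s) + int l = k * int (Suc s) + int s"
      then have "(n * int (Suc s) + int l) mod int (Suc s) = (k * int (Suc s) + int s) mod int (Suc s)" by simp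
      then have "int l = int s" using assms by (simp add: mod_mult_self3 del: of_nat_Suc)
      then show "l = s \<and> k = n" using eq by simp
    qed simp
    finally show ?thesis .
  qed
  moreover have "y (a * P i powi n) * P j ^ l \<in> Vs j" by (intro Vs_Pn pattern_y Vs_P a)
  ultimately show ?thesis
    using pattern_vpart_back[of "y (a * P i powi n) * P j ^ l"] by auto
qed

lemma pattern_vpart_front:
  assumes "c \<in> Vs i"
  shows "vpart (orb (j, b)) (A (i, c))
    = - (if (j, y c) \<in> orb (j, b) then \<Sum>l<Suc s. frag_of (j, y c * P j ^ l) else 0)"
proof -
  have inj: "inj_on (\<lambda>k. y c * P j ^ k) {..<Suc s}"
    using Vs_nz[OF pattern_y[OF assms]] P_inj[of j "int _" "int _"] by (auto simp: inj_on_def)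
  have "{d \<in> N i j c. (j, d) \<in> orb (j, b)} = (if (j, y c) \<in> orb (j, b) then (\<lambda>k. y c * P j ^ k) ` {..<Suc s} else {})"
    unfolding pattern_N[OF assms] using orb_Pn[of j "y c" _ b] by auto
  then show ?thesis
    using vpart_A[OF orb_fst assms, of j b] ij sum.reindex[OF inj, of "\<lambda>d. frag_of (j, d)"]
    by (simp add: in_orb_iff del: sum.lessThan_Suc)
qed

lemma pattern_rank2:
  assumes w: "w \<in> orb (i, a) \<union> orb (j, b)"
  shows "\<exists>T\<in>K (orb (i, a)) \<inter> K (orb (j, b)). \<exists>N. led V N (frag_of w) T"
proof -
  let ?P = "orb (i, a)" and ?Q = "orb (j, b)"
  have sub: "?P \<subseteq> V" "?Q \<subseteq> V" "?P \<inter> ?Q = {}" "?Q \<inter> ?P = {}"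
    using orb_sub[of "(i, a)"] orb_sub[of "(j, b)"] a b ij by (auto simp: V_def orb_def)
  have self_j: "vpart ?Q (A (j, c)) = frag_of (j, c) + frag_of (j, c * P j)" if "(j, c) \<in> ?Q" for c
  proof -
    have "c \<in> Vs j" using that sub by (auto simp: V_def)
    then show ?thesis using vpart_A[OF orb_fst, of c j j b] that by (simp add: N_self orb_P)
  qed
  have self_i: "vpart ?P (A (i, c)) = frag_of (i, c) + frag_of (i, c * P i)" if "(i, c) \<in> ?P" for c
  proof -
    have "c \<in> Vs i" using that sub by (auto simp: V_def)
    then show ?thesis using vpart_A[OF orb_fst, of c i i a] that by (simp add: N_self orb_P)
  qed
  have P_orb: "(i, a * P i powi n) \<in> ?P" for n by (auto simp: in_orb_iff)
  have an: "a * P i powi n \<in> Vs i" for n using a by (rule Vs_P)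
  have Q_y: "(j, y (a * P i powi n)) \<in> ?Q \<longleftrightarrow> (j, y a) \<in> ?Q" for n
  proof
    assume "(j, y (a * P i powi n)) \<in> ?Q"
    then obtain k where "y a * P j powi (n * int (Suc s)) = b * P j powi k"
      unfolding pattern_shift_int[OF a] in_orb_iff by blast
    then have "y a = b * P j powi (k - n * int (Suc s))"
      using P_nz[of j] by (simp add: power_int_diff field_simps del: of_nat_Suc)
    then show "(j, y a) \<in> ?Q" unfolding in_orb_iff by blast
  next
    assume "(j, y a) \<in> ?Q"
    then obtain k where "y a = b * P j powi k" unfolding in_orb_iff by blast
    then have "y (a * P i powi n) = b * P j powi (k + n * int (Suc s))"
      using P_nz[of j] by (simp add: pattern_shift_int[OF a] power_int_add del: of_nat_Suc)
    then show "(j, y (a * P i powi n)) \<in> ?Q" unfolding in_orb_iff by blast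
  qed
  show ?thesis
  \<comment> \<open>By \<open>Q_y\<close> either all strings attached to the orbit of
    \<open>(i, a)\<close> lie in \<open>?Q\<close> or none does; in the second case the two orbits
    do not see each other.\<close>
  proof (cases "(j, y a) \<in> ?Q")
    case False
    from w show ?thesis
    proof
      assume wP: "w \<in> ?P"
      then obtain n where n: "w = (i, a * P i powi n)" by (auto simp: orb_def)
      have "vpart ?Q (A w) = 0" using pattern_vpart_front[OF an[of n]] False by (simp add: n Q_y)
      then show ?thesis using rank2_decoupled[OF sub(2,1,4) wP] by auto
    next
      assume wQ: "w \<in> ?Q"
      then obtain c where c: "w = (j, c)" "c \<in> Vs j" using sub(2) by (auto simp: orb_def V_def)
      have "c \<noteq> y (a * P i powi n) * P j ^ s" for n
        using wQ orb_Pn[of j _ s b] Q_y[of n] False c(1) by auto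
      then have "vpart ?P (A w) = 0" using pattern_vpart_back[OF c(2)] by (simp add: c(1))
      then show ?thesis by (rule rank2_decoupled[OF sub(1-3) wQ])
    qed
  next
    case True
    have long_Q: "vpart ?Q (A (i, a * P i powi n)) = - (\<Sum>l<Suc s. frag_of (j, y (a * P i powi n) * P j ^ l))" for n
      using pattern_vpart_front[OF an[of n]] True by (simp add: Q_y del: sum.lessThan_Suc)
    have string_Q: "(j, y (a * P i powi n) * P j ^ l) \<in> ?Q" for n l
      using True by (simp add: orb_Pn Q_y)
    from w show ?thesis
    proof
      assume wP: "w \<in> ?P"
      then obtain n where n: "w = (i, a * P i powi n)" by (auto simp: orb_def)
      show ?thesis
      proof (rule rank2_long[OF sub(1-3) wP])
        show "(i, a * P i powi n * P i) \<in> ?P" by (simp add: orb_P P_orb)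
        show "vpart ?P (A w) = frag_of w + frag_of (i, a * P i powi n * P i)"
          unfolding n by (rule self_i[OF P_orb])
        show "vpart ?Q (A w) = - (\<Sum>l<Suc s. frag_of (j, y (a * P i powi n) * P j ^ l))"
          unfolding n by (rule long_Q)
        show "vpart ?Q (A (j, y (a * P i powi n) * P j ^ l))
            = frag_of (j, y (a * P i powi n) * P j ^ l) + frag_of (j, y (a * P i powi n) * P j ^ Suc l)" for l
          using self_j[OF string_Q] by (simp add: ac_simps)
        show "vpart ?P (A (j, y (a * P i powi n) * P j ^ l)) = 0" if "l < s" for l
          using pattern_vpart_back_string[of l n] that by simp
        show "vpart ?P (A (j, y (a * P i powi n) * P j ^ s)) = - frag_of (i, a * P i powi n * P i)"
          using pattern_vpart_back_string[of s n] by simp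
      qed (rule string_Q)
    next
      assume wQ: "w \<in> ?Q"
      then obtain c where c: "w = (j, c)" "c \<in> Vs j" using sub(2) by (auto simp: orb_def V_def)
      show ?thesis
      proof (cases "\<exists>n. c = y (a * P i powi n) * P j ^ s")
        case False
        then have "vpart ?P (A w) = 0" using pattern_vpart_back[OF c(2)] by (simp add: c(1))
        then show ?thesis by (rule rank2_decoupled[OF sub(1-3) wQ])
      next
        case True
        then obtain n where n: "c = y (a * P i powi n) * P j ^ s" by blast
        have n1: "a * P i powi (n + 1) = a * P i powi n * P i" using P_nz[of i] by (simp add: power_int_add)
        have yn1: "y (a * P i powi (n + 1)) = c * P j"
          unfolding n1 pattern_shift[OF an] by (simp add: n)
        \<comment> \<open>The string of the next point \<open>a * P i powi (n + 1)\<close> starts at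
          \<open>c * P j\<close>, which plays the role of \<open>w'\<close> in
          \<open>rank2_short\<close>. The \<open>s\<close> points after it are
          \<open>c * P j ^ (l + 2)\<close>.\<close>
        have y_string: "c * P j ^ (l + 2) = y (a * P i powi (n + 1)) * P j ^ Suc l" for l
          by (simp add: yn1)
        show ?thesis
        proof (rule rank2_short[OF sub(1-3) wQ])
          show "(j, c * P j) \<in> ?Q" using wQ by (simp add: c(1) orb_P)
          show "vpart ?Q (A w) = frag_of w + frag_of (j, c * P j)" using self_j wQ by (simp add: c(1))
          show "vpart ?P (A w) = - frag_of (i, a * P i powi (n + 1))"
            using pattern_vpart_back_string[of s n] by (simp add: c(1) n n1)
          show "(i, a * P i powi (n + 1)) \<in> ?P" "(i, a * P i powi (n + 1) * P i) \<in> ?P"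
            by (simp_all only: orb_P P_orb)
          show "vpart ?P (A (i, a * P i powi (n + 1)))
              = frag_of (i, a * P i powi (n + 1)) + frag_of (i, a * P i powi (n + 1) * P i)"
            by (rule self_i[OF P_orb])
          show "vpart ?Q (A (i, a * P i powi (n + 1)))
              = - (frag_of (j, c * P j) + (\<Sum>l<s. frag_of (j, c * P j ^ (l + 2))))"
            unfolding long_Q yn1 sum.lessThan_Suc_shift by (simp add: ac_simps)
          show "(j, c * P j ^ (l + 2)) \<in> ?Q" for l using wQ by (simp only: orb_Pn c(1))
          then show "vpart ?Q (A (j, c * P j ^ (l + 2)))
              = frag_of (j, c * P j ^ (l + 2)) + frag_of (j, c * P j ^ (Suc l + 2))" for l
            using self_j[of "c * P j ^ (l + 2)"] by (simp add: ac_simps)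
          show "vpart ?P (A (j, c * P j ^ (l + 2))) = 0" if "Suc l < s" for l
            using pattern_vpart_back_string[of "Suc l" "n + 1"] that unfolding y_string by simp
          show "vpart ?P (A (j, c * P j ^ (l + 2))) = - frag_of (i, a * P i powi (n + 1) * P i)" if "Suc l = s" for l
            using pattern_vpart_back_string[of "Suc l" "n + 1"] that unfolding y_string by simp
        qed
      qed
    qed
  qed
qed

end

end

locale spectral_cartan = spectral +
  assumes patterns: "i \<noteq> j \<Longrightarrow> (\<forall>a\<in>Vs i. N i j a = {}) \<and> (\<forall>b\<in>Vs j. N j i b = {}) \<or>
      (\<exists>s y. pattern i j s y) \<or> (\<exists>s y. pattern j i s y)"
begin

lemma rank2:
  assumes "x \<in> V" "x' \<in> V" "orb x \<noteq> orb x'" "w \<in> orb x \<union> orb x'"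
  shows "\<exists>T\<in>K (orb x) \<inter> K (orb x'). \<exists>N. led V N (frag_of w) T"
proof -
  obtain i a j b where x: "x = (i, a)" "x' = (j, b)" "a \<in> Vs i" "b \<in> Vs j"
    using assms(1,2) by (auto simp: V_def)
  have sub: "orb x \<subseteq> V" "orb x' \<subseteq> V" "orb x \<inter> orb x' = {}"
    using orb_sub[OF assms(1)] orb_sub[OF assms(2)] orb_disjoint[OF assms(3)] by auto
  have decoupled: ?thesis
    if no: "\<And>c. c \<in> Vs i \<Longrightarrow> N i j c = {}" "\<And>c. c \<in> Vs j \<Longrightarrow> N j i c = {}"
  proof -
    from assms(4) show ?thesis
    proof
      assume w: "w \<in> orb x"
      then obtain c where c: "w = (i, c)" "c \<in> Vs i" using sub(1) by (auto simp: x orb_def V_def)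
      have "(i, c) \<notin> orb x'" "(i, c * P i) \<notin> orb x'"
        using w c sub(3) orb_P[of i c a] unfolding x by blast+
      then have "vpart (orb x') (A w) = 0"
        using vpart_A[OF orb_fst c(2), of j b] no(1)[OF c(2)] by (simp add: c(1) x)
      then show ?thesis using rank2_decoupled[OF sub(2,1) _ w] sub(3) by auto
    next
      assume w: "w \<in> orb x'"
      then obtain c where c: "w = (j, c)" "c \<in> Vs j" using sub(2) by (auto simp: x orb_def V_def)
      have "(j, c) \<notin> orb x" "(j, c * P j) \<notin> orb x"
        using w c sub(3) orb_P[of j c b] unfolding x by blast+
      then have "vpart (orb x) (A w) = 0"
        using vpart_A[OF orb_fst c(2), of i a] no(2)[OF c(2)] by (simp add: c(1) x)
      then show ?thesis using rank2_decoupled[OF sub(1-3) w] by auto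
    qed
  qed
  show ?thesis
  proof (cases "i = j")
    case True
    then show ?thesis using decoupled N_self by blast
  next
    case False
    from patterns[OF False] show ?thesis
    proof (elim disjE exE)
      fix s y assume "pattern i j s y"
      from pattern_rank2[OF False this x(3,4), of w] assms(4) show ?thesis by (simp add: x)
    next
      fix s y assume "pattern j i s y"
      from pattern_rank2[OF False[symmetric] this x(4,3), of w] assms(4) show ?thesis by (auto simp: x)
    qed (use decoupled in blast)
  qed
qed

sublocale cartan_screening V A fst M W orb
proof
  fix x :: "'a \<times> complex" and j :: 'a
  assume x: "x \<in> V"
  show "vdeg {y \<in> V. fst y = j} (A x) = M (fst x) j"
  proof -
    obtain i a where ia: "x = (i, a)" "a \<in> Vs i" using x by (auto simp: V_def)
    have "{y \<in> V. fst y = j} \<subseteq> {j} \<times> UNIV" by auto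
    from vdeg_A_eq[OF this ia(2)] have "vdeg {y \<in> V. fst y = j} (A x)
        = (if i = j then 2 else 0) - int (card {b \<in> N i j a. b \<in> Vs j})"
      using ia Vs_P1[OF ia(2)] by (auto simp: V_def)
    also have "{b \<in> N i j a. b \<in> Vs j} = N i j a" using N_subset[OF ia(2)] by blast
    finally show ?thesis using N_card[OF ia(2), of j] by (auto simp: ia(1) M_diag N_self)
  qed
qed (use orb_refl orb_admissible orb_eq rank2 orb_K M_diag W_pos M_symm M_pos in auto)

end

section \<open>The Cartan matrix\<close>

locale langlands_lacing = langlands_setting +
  assumes lacing: "r \<in> {2, 3}"
begin

lemma d_pos: "1 \<le> d i"
  using min_d Min_le[of "range d" "d i"] by simp

lemma d_le: "d i \<le> r"
  using max_d Max_ge[of "range d" "d i"] by simp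

lemma C_diag: "C i i = 2"
  and C_nonpos: "i \<noteq> j \<Longrightarrow> C i j \<le> 0"
  and C_zero: "C i j = 0 \<longleftrightarrow> C j i = 0"
proof -
  note * = cartan(1)[unfolded finite_type_cartan_matrix_def]
  show "C i i = 2"
    using *[THEN conjunct1] by (rule spec)
  show "i \<noteq> j \<Longrightarrow> C i j \<le> 0"
    using *[THEN conjunct2, THEN conjunct1, rule_format] .
  show "C i j = 0 \<longleftrightarrow> C j i = 0"
    using *[THEN conjunct2, THEN conjunct2, THEN conjunct1, rule_format] .
qed

lemma connected_nodes:
  assumes "J \<noteq> {}" "\<And>i j. i \<in> J \<Longrightarrow> C i j \<noteq> 0 \<Longrightarrow> j \<in> J"
  shows "J = UNIV"
proof (rule ccontr)
  assume "J \<noteq> UNIV"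
  then have "\<exists>i\<in>J. \<exists>j\<in>- J. C i j \<noteq> 0"
    using cartan(2) assms(1) unfolding indecomposable_matrix_def by simp
  then show False using assms(2) by blast
qed

definition qform :: "('a \<Rightarrow> real) \<Rightarrow> real" where
  "qform x = (\<Sum>i\<in>UNIV. \<Sum>j\<in>UNIV. real (d i) * of_int (C i j) * x i * x j)"

text \<open>By indecomposability the symmetrizer in the definition of finite type is proportional
  to \<open>d\<close>.\<close>

lemma qform_pos:
  assumes "x \<noteq> (\<lambda>_. 0)"
  shows "qform x > 0"
proof -
  from cartan(1)[unfolded finite_type_cartan_matrix_def, THEN conjunct2, THEN conjunct2, THEN conjunct2]
  obtain D :: "'a \<Rightarrow> real" where D': "\<forall>i. D i > 0"
    "\<forall>i j. D i * of_int (C i j) = D j * of_int (C j i)"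
    "\<forall>x. x \<noteq> (\<lambda>_. 0) \<longrightarrow> (\<Sum>i\<in>UNIV. \<Sum>j\<in>UNIV. D i * of_int (C i j) * x i * x j) > 0"
    by (elim conjE exE)
  note D = D'[rule_format]
  have dpos: "real (d i) > 0" for i using d_pos[of i] by simp
  define c where "c = D undefined / real (d undefined)"
  have cpos: "c > 0" using D(1) dpos by (simp add: c_def)
  define J where "J = {i. D i / real (d i) = c}"
  have "J = UNIV"
  proof (rule connected_nodes)
    show "J \<noteq> {}" by (auto simp: J_def c_def)
  next
    fix i j assume ij: "i \<in> J" "C i j \<noteq> 0"
    have "real (d i) * of_int (C i j) = real (d j) * of_int (C j i)"
      using arg_cong[OF symm[of i j], of real_of_int] by simp
    moreover have "real_of_int (C i j) \<noteq> 0" "real_of_int (C j i) \<noteq> 0" using ij(2) C_zero by auto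
    moreover have "D i * real (d j) = D j * real (d i)"
      if "di * c = dj * c'" "c \<noteq> 0" "c' \<noteq> 0" "D i * c = D j * c'" "di = real (d i)" "dj = real (d j)" for di dj c c'
    proof -
      have "(D i * dj) * (c * c') = (D i * c) * (dj * c')" by simp
      also have "\<dots> = (D j * di) * (c * c')" unfolding that(4) that(1)[symmetric] by simp
      finally show ?thesis using that by simp
    qed
    ultimately have "D i * real (d j) = D j * real (d i)" using D(2)[of i j] by blast
    then have "D i / real (d i) = D j / real (d j)"
      using dpos[of i] dpos[of j] by (simp add: field_simps)
    then show "j \<in> J" using ij(1) by (simp add: J_def)
  qed
  then have "D i / real (d i) = c" for i
    by (auto simp: J_def)
  then have "D i = c * real (d i)" for i
    using dpos[of i] by (metis divide_eq_eq less_irrefl)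
  then have "(\<Sum>i\<in>UNIV. \<Sum>j\<in>UNIV. D i * of_int (C i j) * x i * x j) = c * qform x"
    unfolding qform_def sum_distrib_left by (intro sum.cong refl) simp
  then show ?thesis using D(3)[OF assms] cpos by (simp add: zero_less_mult_iff)
qed

lemma qform_add:
  "qform (\<lambda>k. x k + (if k = j then b else 0))
    = qform x + 2 * b * (\<Sum>i\<in>UNIV. real (d i) * of_int (C i j) * x i) + 2 * real (d j) * b\<^sup>2"
proof -
  let ?D = "\<lambda>i k. real (d i) * of_int (C i k)"
  have "real (d k) * of_int (C k j) = real (d j) * of_int (C j k)" for k
    using arg_cong[OF symm[of k j], of real_of_int] by simp
  then have s: "?D k j = ?D j k" for k .
  have "qform (\<lambda>k. x k + (if k = j then b else 0))
      = (\<Sum>i\<in>UNIV. \<Sum>k\<in>UNIV. ?D i k * x i * x k + (if k = j then ?D i k * x i * b else 0)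
          + (if i = j then ?D i k * b * x k + (if k = j then ?D i k * b * b else 0) else 0))"
    unfolding qform_def by (intro sum.cong refl) (auto simp: algebra_simps)
  also have "\<dots> = qform x + (\<Sum>i\<in>UNIV. ?D i j * x i * b) + ((\<Sum>k\<in>UNIV. ?D j k * b * x k) + ?D j j * b * b)"
  proof -
    have "(\<Sum>i\<in>UNIV. \<Sum>k\<in>UNIV. if i = j then ?D i k * b * x k + (if k = j then ?D i k * b * b else 0) else 0)
        = (\<Sum>i\<in>UNIV. if i = j then \<Sum>k\<in>UNIV. ?D i k * b * x k + (if k = j then ?D i k * b * b else 0) else 0)"
      by (intro sum.cong refl) auto
    then show ?thesis by (simp add: sum.distrib qform_def)
  qed
  also have "(\<Sum>k\<in>UNIV. ?D j k * b * x k) = (\<Sum>i\<in>UNIV. ?D i j * x i * b)"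
    by (intro sum.cong refl) (simp add: s ac_simps)
  finally show ?thesis
    by (simp add: C_diag power2_eq_square sum_distrib_left ac_simps)
qed

lemma qform_single: "qform (\<lambda>k. if k = i then a else 0) = 2 * real (d i) * a\<^sup>2"
  using qform_add[of "\<lambda>_. 0" i a] by (simp add: qform_def)

lemma qform_pair:
  assumes "i \<noteq> j"
  shows "qform (\<lambda>k. (if k = i then a else 0) + (if k = j then b else 0))
    = 2 * real (d i) * a\<^sup>2 + 2 * b * (real (d i) * of_int (C i j) * a) + 2 * real (d j) * b\<^sup>2"
  unfolding qform_add qform_single by (simp add: if_distrib[of "(*) _"] cong: if_cong)

text \<open>Test vector with entry \<open>d j\<close> at \<open>i\<close> and \<open>d i\<close> at
  \<open>j\<close>: for \<open>C i j \<le> -2\<close> the form is at most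
  \<open>2 * a * b * (a - b)\<close>, which is not positive as \<open>d j \<le> d i\<close>.\<close>

lemma C_long:
  assumes "i \<noteq> j" "d j \<le> d i"
  shows "C i j = 0 \<or> C i j = -1"
proof (rule ccontr)
  assume "\<not> ?thesis"
  then have "C i j \<le> -2" using C_nonpos[OF assms(1)] by simp
  then have C: "real_of_int (C i j) \<le> -2" by simp
  define a where "a = real (d j)"
  define b where "b = real (d i)"
  have ab: "0 < a" "0 < b" "a \<le> b" using d_pos[of j] assms(2) d_pos[of i] by (auto simp: a_def b_def)
  have "(\<lambda>k. (if k = i then a else 0) + (if k = j then b else 0)) \<noteq> (\<lambda>_. 0)"
    using ab assms(1) by (auto dest!: fun_cong[of _ _ i])
  then have "0 < qform (\<lambda>k. (if k = i then a else 0) + (if k = j then b else 0))"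
    by (rule qform_pos)
  also have "\<dots> = 2 * a * b * (a + b + b * of_int (C i j))"
    unfolding qform_pair[OF assms(1)] a_def b_def by (simp add: power2_eq_square algebra_simps)
  finally have "0 < a + b + b * of_int (C i j)"
    by (rule zero_less_mult_pos) (intro mult_pos_pos ab, simp)
  moreover have "b * of_int (C i j) \<le> b * (-2)" using C ab by (intro mult_left_mono) auto
  ultimately show False using ab by simp
qed

text \<open>For \<open>r = 3\<close>, a path from a node with \<open>d = 3\<close> through nodes with \<open>d = 1\<close> to one with \<open>d = 2\<close>
  is excluded by the test vector \<open>1/2, 1, \<dots>, 1, 1/2\<close> on it.\<close>

lemma d_cases: "d i = 1 \<or> d i = r"
proof -
  have "d i = 1 \<or> d i = r" if r: "r = 3"
  proof -
    \<comment> \<open>\<open>R k\<close> says that a test vector has been built along a path that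
      ends in \<open>k\<close>. Its first edge gives the form \<open>3/2 - 3 + 2 = 1/2\<close>, a
      further node with \<open>d = 1\<close> does not raise it, and a final node with
      \<open>d = 2\<close> and entry 1/2 lowers it by at least 1. Entries 0 or 1 at the nodes with
      \<open>d = 1\<close> tell whether a node is already on the path.\<close>
    define R where "R k \<longleftrightarrow> d k = 1 \<and> (\<exists>x. (\<forall>l. x l \<ge> 0) \<and> x k = 1 \<and>
      (\<forall>l. d l = 1 \<longrightarrow> x l \<in> {0, 1}) \<and> (\<forall>l. d l = 2 \<longrightarrow> x l = 0) \<and> qform x \<le> 1 / 2)" for k
    define J where "J = {k. d k = 3} \<union> {k. R k}"
    have sum_le: "(\<Sum>i\<in>UNIV. real (d i) * of_int (C i l) * x i) \<le> real (d k) * of_int (C k l)"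
      if x: "\<And>i. x i \<ge> 0" "x l = 0" "x k = 1" for x k l
    proof -
      have "(\<Sum>i\<in>UNIV. real (d i) * of_int (C i l) * x i)
          = real (d k) * of_int (C k l) * x k + (\<Sum>i\<in>UNIV - {k}. real (d i) * of_int (C i l) * x i)"
        by (rule sum.remove) auto
      moreover have "(\<Sum>i\<in>UNIV - {k}. real (d i) * of_int (C i l) * x i) \<le> 0"
      proof (rule sum_nonpos)
        fix i show "real (d i) * of_int (C i l) * x i \<le> 0"
          using C_nonpos[of i l] x(1)[of i] x(2) by (cases "i = l") (auto simp: mult_nonneg_nonpos mult_nonpos_nonneg)
      qed
      ultimately show ?thesis using x(3) by simp
    qed
    have R_long: "R j" if ij: "d i = 3" "d j = 1" "C i j \<noteq> 0" for i j
    proof -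
      have ne: "i \<noteq> j" using ij by auto
      have "C i j = -1" using C_long[OF ne] ij by simp
      then have "qform (\<lambda>k. (if k = i then 1 / 2 else 0) + (if k = j then 1 else 0)) = 1 / 2"
        unfolding qform_pair[OF ne] using ij by (simp add: power2_eq_square)
      then show ?thesis unfolding R_def
        using ij ne by (intro conjI exI[of _ "\<lambda>k. (if k = i then 1 / 2 else 0) + (if k = j then 1 else 0)"]) auto
    qed
    have R_step: "R l" if kl: "R k" "d l = 1" "C k l \<noteq> 0" for k l
    proof -
      obtain x where x: "\<And>l. x l \<ge> 0" "x k = 1" "\<And>l. d l = 1 \<Longrightarrow> x l \<in> {0, 1}"
        "\<And>l. d l = 2 \<Longrightarrow> x l = 0" "qform x \<le> 1 / 2" using kl(1) unfolding R_def by blast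
      show ?thesis
      proof (cases "x l = 1")
        case True
        then show ?thesis unfolding R_def using x kl(2) by blast
      next
        case False
        then have xl: "x l = 0" using x(3)[OF kl(2)] by auto
        then have "k \<noteq> l" using x(2) by auto
        have dk: "d k = 1" using kl(1) by (simp add: R_def)
        have "C k l = -1" using C_long[OF \<open>k \<noteq> l\<close>] kl dk by auto
        then have "qform (\<lambda>i. x i + (if i = l then 1 else 0)) \<le> 1 / 2"
          using sum_le[OF x(1) xl x(2)] x(5) unfolding qform_add by (simp add: kl(2) dk)
        then show ?thesis unfolding R_def
          using x xl kl(2) by (intro conjI exI[of _ "\<lambda>i. x i + (if i = l then 1 else 0)"]) (auto simp: add_nonneg_nonneg)
      qed
    qed
    have R_two: False if kl: "R k" "d l = 2" "C k l \<noteq> 0" for k l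
    proof -
      obtain x where x: "\<And>l. x l \<ge> 0" "x k = 1" "\<And>l. d l = 2 \<Longrightarrow> x l = 0" "qform x \<le> 1 / 2"
        using kl(1) unfolding R_def by blast
      have dk: "d k = 1" using kl(1) by (simp add: R_def)
      have ne: "l \<noteq> k" using kl(2) dk by auto
      have "C l k = -1" using C_long[OF ne] kl dk C_zero[of k l] by auto
      then have "C k l = -2" using symm[of k l] by (simp add: kl(2) dk)
      then have "qform (\<lambda>i. x i + (if i = l then 1 / 2 else 0)) \<le> - (1 / 2)"
        using sum_le[OF x(1) x(3)[OF kl(2)] x(2)] x(4) unfolding qform_add
        by (simp add: kl(2) dk power2_eq_square)
      moreover have "(\<lambda>i. x i + (if i = l then 1 / 2 else 0)) k \<noteq> 0" using x(2) ne by simp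
      then have "0 < qform (\<lambda>i. x i + (if i = l then 1 / 2 else 0))"
        by (intro qform_pos) (auto dest: fun_cong)
      ultimately show False by simp
    qed
    have d3: "d k \<in> {1, 2, 3}" for k using d_pos[of k] d_le[of k] r by auto
    have "J = UNIV"
    proof (rule connected_nodes)
      have "3 \<in> range d" using Max_in[of "range d"] max_d r by simp
      then show "J \<noteq> {}" by (auto simp: J_def)
    next
      fix i j assume ij: "i \<in> J" "C i j \<noteq> 0"
      show "j \<in> J"
      proof (rule ccontr)
        assume "j \<notin> J"
        then have "d j \<noteq> 3" "\<not> R j" by (auto simp: J_def)
        show False
        proof (cases "d i = 3")
        case True
        then have dj: "d j = 2" using R_long[of i j] ij(2) d3[of j] \<open>d j \<noteq> 3\<close> \<open>\<not> R j\<close> by auto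
        then have "i \<noteq> j" using True by auto
        then have "C i j = -1" using C_long[of i j] True dj ij(2) by auto
        then have "2 * C j i = -3" using symm[of i j] True dj by simp
        then show False by presburger
      next
        case False
        then have "R i" using ij(1) by (auto simp: J_def)
        then show False using R_step[of i j] R_two[of i j] ij(2) d3[of j] \<open>d j \<noteq> 3\<close> \<open>\<not> R j\<close> by auto
        qed
      qed
    qed
    then have "d i = 3 \<or> R i" unfolding J_def by blast
    then show ?thesis using r by (auto simp: R_def)
  qed
  then show ?thesis using lacing d_pos[of i] d_le[of i] by (cases "r = 3") auto
qed

lemma C_short:
  assumes "d i < d j"
  shows "d i = 1" "d j = r" "C i j = 0 \<or> C i j = - int r"
proof -
  show "d i = 1" "d j = r" using assms d_cases[of i] d_cases[of j] d_pos[of i] d_pos[of j] lacing by auto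
  then have "C i j = int r * C j i" using symm[of i j] by simp
  moreover have "j \<noteq> i" using assms by auto
  ultimately show "C i j = 0 \<or> C i j = - int r" using C_long[of j i] assms by auto
qed

section \<open>The two specializations\<close>

lemma q_powi_eq_1: "q powi n = 1 \<Longrightarrow> n = 0"
  and t_powi_eq_1: "t powi n = 1 \<Longrightarrow> n = 0"
proof -
  have *: "n = 0" if x: "x \<noteq> 0" "\<And>n. n > 0 \<Longrightarrow> x ^ n \<noteq> 1" "x powi n = 1" for x :: complex and n :: int
  proof (rule ccontr)
    assume "n \<noteq> 0"
    then have "x ^ nat \<bar>n\<bar> = 1"
      using x(1,3) by (cases "n > 0") (auto simp: power_int_def field_simps split: if_splits)
    then show False using x(2)[of "nat \<bar>n\<bar>"] \<open>n \<noteq> 0\<close> by simp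
  qed
  show "q powi n = 1 \<Longrightarrow> n = 0" by (rule *) (use q_nz q_generic in auto)
  show "t powi n = 1 \<Longrightarrow> n = 0" by (rule *) (use t_nz t_generic in auto)
qed

lemma qt_exponents: "qt_exponents (q powi l * t powi m) = (l, m)"
  unfolding qt_exponents_def
proof (rule the_equality)
  fix lm assume "q powi l * t powi m = q powi fst lm * t powi snd lm"
  then have "q powi (l - fst lm) = t powi (snd lm - m)"
    using q_nz t_nz by (simp add: power_int_diff field_simps)
  then have "q powi (l - fst lm) \<in> range (\<lambda>l::int. q powi l) \<inter> range (\<lambda>m::int. t powi m)"
    by (metis IntI rangeI)
  then have "q powi (l - fst lm) = 1" using qt_generic by blast
  moreover from this have "t powi (snd lm - m) = 1"
    using \<open>q powi (l - fst lm) = t powi (snd lm - m)\<close> by simp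
  ultimately show "lm = (l, m)" using q_powi_eq_1 t_powi_eq_1 by (cases lm) fastforce
qed simp

lemma eps_nz: "eps \<noteq> 0"
  by (simp add: eps_def)

lemma eps_r: "eps ^ r = -1"
proof -
  have "real r * (pi / real r) = pi" using lacing by auto
  then have "cis (real r * (pi / real r)) = -1" by (simp only: cis_pi)
  then show ?thesis unfolding eps_def Complex.DeMoivre .
qed

lemma CC_E:
  assumes "a \<in> CC"
  obtains l m where "a = q powi l * t powi m"
  using assms unfolding CC_def by blast

lemma CC_nz: "a \<in> CC \<Longrightarrow> a \<noteq> 0"
  using q_nz t_nz by (auto elim: CC_E)

lemma CC_mult:
  assumes "a \<in> CC"
  shows "a * q powi k * t powi n \<in> CC"
    and "spec_t (a * q powi k * t powi n) = spec_t a * eps powi k * t powi n"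
    and "spec_q (a * q powi k * t powi n) = spec_q a * q powi k"
proof -
  obtain l m where a: "a = q powi l * t powi m" using assms by (rule CC_E)
  have eq: "a * q powi k * t powi n = q powi (l + k) * t powi (m + n)"
    using q_nz t_nz by (simp add: a power_int_add)
  then show "a * q powi k * t powi n \<in> CC" unfolding CC_def by blast
  show "spec_t (a * q powi k * t powi n) = spec_t a * eps powi k * t powi n"
    unfolding eq unfolding a spec_t_def qt_exponents using eps_nz t_nz by (simp add: power_int_add)
  show "spec_q (a * q powi k * t powi n) = spec_q a * q powi k"
    unfolding eq unfolding a spec_q_def qt_exponents using q_nz by (simp add: power_int_add)
qed

lemma CC_1: "1 \<in> CC"
  unfolding CC_def using power_int_0_right by (intro CollectI exI[of _ 0]) simp

lemma spec_t_nz: "spec_t a \<noteq> 0"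
  unfolding spec_t_def using eps_nz t_nz by simp

end

context langlands_lacing
begin

subsection \<open>The \<open>q\<close>-side\<close>

definition Vq :: "'a \<Rightarrow> complex set" where
  "Vq i = range (\<lambda>l::int. q powi l)"

definition Pq :: "'a \<Rightarrow> complex" where
  "Pq i = q ^ (2 * d i)"

text \<open>The parameters at node \<open>j\<close> in the variable \<open>A\<close> of the
  untwisted \<open>q\<close>-characters with centre \<open>a * q ^ d i\<close>; for
  \<open>d j \<le> d i\<close> they are spread symmetrically about this centre with ratio
  \<open>q ^ (2 * d j)\<close>.\<close>

definition Nq :: "'a \<Rightarrow> 'a \<Rightarrow> complex \<Rightarrow> complex set" where
  "Nq i j a = (if j = i \<or> C i j = 0 then {}
     else if d j \<le> d i then (\<lambda>k. a * q ^ d j * q ^ (2 * d j * k)) ` {..<d i div d j}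
     else {a * q ^ d i})"

lemma Vq_mult: "a \<in> Vq i \<Longrightarrow> a * q powi n \<in> Vq j"
  unfolding Vq_def using q_nz by (auto simp flip: power_int_add)

lemma Vq_mult_power: "a \<in> Vq i \<Longrightarrow> a * q ^ n \<in> Vq j"
  using Vq_mult[of a i "int n" j] by simp

lemma Vq_nz: "a \<in> Vq i \<Longrightarrow> a \<noteq> 0"
  unfolding Vq_def using q_nz by auto

lemma Pq_powi: "Pq i powi n = q powi (2 * int (d i) * n)"
  using power_int_mult[of q "int (2 * d i)" n] unfolding Pq_def power_int_of_nat by simp

lemma q_power_inj: "q ^ m = q ^ n \<longleftrightarrow> m = n"
proof
  assume "q ^ m = q ^ n"
  then have "q powi (int m - int n) = 1" using q_nz by (simp add: power_int_diff)
  then show "m = n" using q_powi_eq_1 by fastforce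
qed simp

lemma d_ratio:
  assumes "i \<noteq> j" "C i j \<noteq> 0" "d j \<le> d i"
  shows "C i j = -1" "C j i = - int (d i div d j)" "d j * (d i div d j) = d i" "1 \<le> d i div d j"
proof -
  show C: "C i j = -1" using C_long[OF assms(1,3)] assms(2) by simp
  have "d i = d j \<or> d j = 1" using C_short(1)[of j i] assms(3) by linarith
  moreover have "- int (d i) = int (d j) * C j i" using symm[of i j] C by simp
  moreover have "C j i = -1" if "d i = d j" using C_long[of j i] assms C_zero[of i j] that by auto
  ultimately show "C j i = - int (d i div d j)" "d j * (d i div d j) = d i" "1 \<le> d i div d j"
    using d_pos[of j] d_pos[of i] by (elim disjE; force)+
qed

lemma d_ratio_neg:
  assumes "i \<noteq> j" "C i j \<noteq> 0" "\<not> d j \<le> d i"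
  shows "d i = 1" "d j = r" "C i j = - int r" "C j i = -1"
proof -
  show "d i = 1" "d j = r" "C i j = - int r" using C_short[of i j] assms by auto
  show "C j i = -1" using C_long[of j i] assms C_zero by auto
qed

text \<open>\<open>M i j\<close> counts the variables of node \<open>j\<close> in an
  \<open>A\<close> of node \<open>i\<close>. This is \<open>C j i\<close> here and
  \<open>C i j\<close> on the \<open>t\<close>-side: the two sides belong to Langlands dual root
  systems.\<close>

sublocale qs: spectral Vq Pq Nq "\<lambda>i j. C j i" "\<lambda>i. real (d i)"
proof
  fix a i j assume a: "a \<in> Vq i"
  show "Nq i j a \<subseteq> Vq j"
    unfolding Nq_def using Vq_mult_power[OF a] Vq_mult_power[OF Vq_mult_power[OF a]] by auto
  show "finite (Nq i j a)" by (simp add: Nq_def)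
  show "C j i = - int (card (Nq i j a))" if ij: "i \<noteq> j"
  proof (cases "C i j = 0")
    case True
    then show ?thesis using C_zero[of i j] by (simp add: Nq_def)
  next
    case False
    show ?thesis
    proof (cases "d j \<le> d i")
      case True
      have "inj_on (\<lambda>k. a * q ^ d j * q ^ (2 * d j * k)) {..<d i div d j}"
        using Vq_nz[OF a] q_nz d_pos[of j] by (auto simp: inj_on_def q_power_inj)
      then show ?thesis using d_ratio[OF ij False True] ij True False by (simp add: Nq_def card_image)
    next
      case nd: False
      then show ?thesis using d_ratio_neg[OF ij False nd] ij False by (simp add: Nq_def)
    qed
  qed
next
  fix i n assume "Pq i powi n = 1"
  then show "n = 0" using q_powi_eq_1[of "2 * int (d i) * n"] d_pos[of i] by (simp add: Pq_powi)
next
  fix a i n assume "a \<in> Vq i"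
  then show "a * Pq i powi n \<in> Vq i" unfolding Pq_powi by (rule Vq_mult)
next
  fix c :: "'a \<Rightarrow> real" assume "c \<noteq> (\<lambda>_. 0)"
  then have "0 < qform c" by (rule qform_pos)
  also have "qform c = (\<Sum>j\<in>UNIV. \<Sum>i\<in>UNIV. real (d i) * of_int (C i j) * c i * c j)"
    unfolding qform_def by (rule sum.swap)
  finally show "0 < (\<Sum>i\<in>UNIV. \<Sum>j\<in>UNIV. of_int (C j i) * real (d j) * c i * c j)"
    by (simp add: ac_simps)
next
  show "of_int (C j i) * real (d j) = of_int (C i j) * real (d i)" for i j
    using arg_cong[OF symm[of i j], of real_of_int] by (simp add: ac_simps)
  show "0 < real (d i)" for i using d_pos[of i] by simp
qed (auto simp: Vq_nz Pq_def q_nz Nq_def C_diag)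

lemma q_pattern:
  assumes ij: "i \<noteq> j" "C i j \<noteq> 0" "d j \<le> d i"
  shows "qs.pattern i j (d i div d j - 1) (\<lambda>a. a * q ^ d j)"
proof -
  note ratio = d_ratio[OF ij]
  have Suc: "Suc (d i div d j - 1) = d i div d j" using ratio(4) by simp
  show ?thesis
    unfolding qs.pattern_def Suc
  proof (intro conjI ballI)
    fix a assume a: "a \<in> Vq i"
    show "a * q ^ d j \<in> Vq j" by (rule Vq_mult_power[OF a])
    show "Nq i j a = (\<lambda>k. a * q ^ d j * Pq j ^ k) ` {..<d i div d j}"
      using ij by (simp add: Nq_def Pq_def power_mult)
    have "q ^ (2 * d i) = q ^ (2 * (d j * (d i div d j)))" by (simp only: ratio(3))
    then show "a * Pq i * q ^ d j = a * q ^ d j * Pq j ^ (d i div d j)"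
      by (simp add: Pq_def ac_simps flip: power_mult)
    fix w assume "w \<in> Vq j"
    show "a * Pq i \<in> Nq j i w \<longleftrightarrow> w = a * q ^ d j * Pq j ^ (d i div d j - 1)"
    proof -
      have N: "Nq j i w = {w * q ^ d j}"
        using ij ratio(2) C_zero[of i j] d_pos[of j] unfolding Nq_def
        by (auto simp: lessThan_Suc numeral_eq_Suc)
      have "2 * d i = d j + 2 * d j * (d i div d j - 1) + d j"
        using ratio(3,4) by (metis (no_types, lifting) Suc add.assoc add.commute mult.assoc mult_2 mult_Suc_right)
      then have "a * Pq i = a * q ^ d j * Pq j ^ (d i div d j - 1) * q ^ d j"
        by (simp add: Pq_def power_add[symmetric] flip: power_mult)
      then show ?thesis using q_nz unfolding N by auto
    qed
  qed
qed

sublocale qs: spectral_cartan Vq Pq Nq "\<lambda>i j. C j i" "\<lambda>i. real (d i)"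
proof
  fix i j :: 'a assume ij: "i \<noteq> j"
  show "(\<forall>a\<in>Vq i. Nq i j a = {}) \<and> (\<forall>b\<in>Vq j. Nq j i b = {}) \<or>
      (\<exists>s y. qs.pattern i j s y) \<or> (\<exists>s y. qs.pattern j i s y)"
  proof (cases "C i j = 0")
    case True
    then show ?thesis using C_zero[of i j] by (simp add: Nq_def)
  next
    case False
    moreover have "C j i \<noteq> 0" using False C_zero by blast
    ultimately show ?thesis using q_pattern[of i j] q_pattern[of j i] ij by (metis linear)
  qed
qed

subsection \<open>The \<open>t\<close>-side\<close>

definition zsign :: "'a \<Rightarrow> complex" where
  "zsign i = (if r = 2 then (-1) ^ (1 + phi i) else if d i = 3 then -1 else 1)"

lemma zsign_sq: "zsign i * zsign i = 1"
  unfolding zsign_def by (simp flip: power_add)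

lemma zsign_nz: "zsign i \<noteq> 0"
  using zsign_sq[of i] by auto

lemma dual_d_cases: "d i = 1 \<and> dual_d i = r \<or> d i = r \<and> dual_d i = 1"
  using d_cases[of i] lacing by (auto simp: dual_d_def)

lemma dual_d_pos: "1 \<le> dual_d i"
  using dual_d_cases[of i] lacing by auto

lemma d_dual_d: "d i * dual_d i = r"
  using dual_d_cases[of i] by auto

lemma Z_param_eq: "Z_param i a = zsign i * spec_t a ^ dual_d i"
proof (cases "r = 2")
  case False
  then have "r = 3" using lacing by simp
  then have "d i = 1 \<and> dual_d i = 3 \<or> d i = 3 \<and> dual_d i = 1" using dual_d_cases[of i] by metis
  then show ?thesis using False by (auto simp: Z_param_def zsign_def)
next
  case True
  show ?thesis unfolding Z_param_def zsign_def if_P[OF True] by (rule refl)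
qed

definition Vt :: "'a \<Rightarrow> complex set" where
  "Vt i = Z_param i ` CC"

definition Pt :: "'a \<Rightarrow> complex" where
  "Pt i = t ^ (2 * dual_d i)"

text \<open>For \<open>d j \<le> d i\<close> this is the map that
  \<open>a \<mapsto> a * q ^ d i * t\<close> induces on the specialized parameters
  (\<open>yt_Z_param\<close>). It is written in terms of the image because \<open>Z_param i\<close>
  is not injective; a formula exists since \<open>dual_d i\<close> divides \<open>dual_d j\<close>.
  A sign is its own inverse, which explains the power of \<open>zsign i\<close>.\<close>

definition yt :: "'a \<Rightarrow> 'a \<Rightarrow> complex \<Rightarrow> complex" where
  "yt i j b = zsign j * zsign i ^ (dual_d j div dual_d i) * eps ^ (d i * dual_d j)
     * b ^ (dual_d j div dual_d i) * t ^ dual_d j"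

text \<open>From a short node to a long one there are \<open>r\<close> neighbours, defined as a
  fibre of the map in the opposite direction, up to the shift \<open>Pt j\<close>. The reciprocal
  condition of \<open>pattern\<close> then holds by definition for nodes of different length, and
  the comparison with \<open>B_ex\<close> is shifted to \<open>Nt_short_alt\<close>.\<close>

definition Nt :: "'a \<Rightarrow> 'a \<Rightarrow> complex \<Rightarrow> complex set" where
  "Nt i j b = (if j = i \<or> C i j = 0 then {} else if d j \<le> d i then {yt i j b}
     else {c. yt j i (c / t ^ (2 * dual_d j)) = b})"

lemma dual_d_ratio:
  assumes "d j \<le> d i"
  shows "dual_d i * (dual_d j div dual_d i) = dual_d j"
proof -
  have "1 < r" using lacing by auto
  then show ?thesis using assms dual_d_cases[of i] dual_d_cases[of j] by auto
qed

lemma CC_shift: "a \<in> CC \<Longrightarrow> a * q ^ k * t ^ n \<in> CC"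
  and spec_t_shift: "a \<in> CC \<Longrightarrow> spec_t (a * q ^ k * t ^ n) = spec_t a * eps ^ k * t ^ n"
  and spec_q_shift: "a \<in> CC \<Longrightarrow> spec_q (a * q ^ k * t ^ n) = spec_q a * q ^ k"
  using CC_mult[of a "int k" "int n"] by simp_all

lemma yt_Z_param:
  assumes "a \<in> CC" "d j \<le> d i"
  shows "yt i j (Z_param i a) = Z_param j (a * q ^ d i * t)"
proof -
  let ?k = "dual_d j div dual_d i"
  have "yt i j (Z_param i a) = zsign j * (zsign i * zsign i) ^ ?k * eps ^ (d i * dual_d j)
      * spec_t a ^ (dual_d i * ?k) * t ^ dual_d j"
    by (simp add: yt_def Z_param_eq power_mult_distrib power_mult ac_simps)
  also have "\<dots> = zsign j * (spec_t a * eps ^ d i * t) ^ dual_d j"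
    unfolding dual_d_ratio[OF assms(2)] zsign_sq by (simp add: power_mult_distrib power_mult ac_simps)
  finally show ?thesis using spec_t_shift[OF assms(1), of "d i" 1] by (simp add: Z_param_eq)
qed

text \<open>The exponents run through 2, ..., 2r and not through 0, ..., 2r - 2, to match the
  parameters \<open>q powi (2 + 2 * int k - int r)\<close> of the long neighbours.\<close>

lemma eps_roots: "(\<lambda>k. eps ^ (2 * Suc k)) ` {..<r} = {w. w ^ r = 1}"
proof -
  have r: "r > 0" using lacing by auto
  have cis: "cis (2 * pi * real k / real r) = eps ^ (2 * k)" for k
    unfolding eps_def Complex.DeMoivre by (simp add: ac_simps)
  have "eps ^ (2 * r) = 1" using eps_r by (metis mult.commute power2_minus power_mult power_one)
  then have "(\<lambda>k. eps ^ (2 * k)) ` insert r {1..<r} = (\<lambda>k. eps ^ (2 * k)) ` insert 0 {1..<r}" by simp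
  moreover have "insert r {1..<r} = Suc ` {..<r}" "insert 0 {1..<r} = {..<r}"
    using r by (auto simp: image_Suc_lessThan)
  ultimately have "(\<lambda>k. eps ^ (2 * Suc k)) ` {..<r} = (\<lambda>k. eps ^ (2 * k)) ` {..<r}"
    by (metis (no_types, lifting) image_cong image_image)
  also have "\<dots> = {w. w ^ r = 1}"
    using bij_betw_imp_surj_on[OF Complex.bij_betw_roots_unity[OF r]] unfolding cis .
  finally show ?thesis .
qed

lemma Nt_short:
  assumes a: "a \<in> CC" and ij: "i \<noteq> j" "C i j \<noteq> 0" "d i < d j"
  shows "Nt i j (Z_param i a) = (\<lambda>k. zsign j * spec_t a * t * (- (eps ^ (2 * Suc k)))) ` {..<r}"
    (is "_ = ?g ` _")
proof -
  have d: "d i = 1" "d j = r" using C_short[OF ij(3)] by auto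
  have e: "dual_d i = r" "dual_d j = 1" using d lacing by (auto simp: dual_d_def)
  let ?s = "spec_t a" and ?x = "zsign j"
  have r: "r > 0" using lacing by auto
  have iff: "yt j i (c / t ^ 2) = Z_param i a \<longleftrightarrow> (- (?x * c) / (?s * t)) ^ r = 1" for c
  proof -
    have yt: "yt j i (c / t ^ 2) = zsign i * ((?x * c) ^ r * (eps ^ r) ^ r / t ^ r)"
      unfolding yt_def e d using t_nz by (simp add: power_mult_distrib power_divide power_mult[symmetric] mult_2_right power_add field_simps)
    have "yt j i (c / t ^ 2) = Z_param i a \<longleftrightarrow> (?x * c) ^ r * (eps ^ r) ^ r / t ^ r = ?s ^ r"
      unfolding yt Z_param_eq e using zsign_nz[of i] by (simp add: mult.assoc flip: times_divide_eq_right)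
    also have "\<dots> \<longleftrightarrow> (- (?x * c)) ^ r = ?s ^ r * t ^ r"
      unfolding eps_r using t_nz power_mult_distrib[of "?x * c" "-1" r] by (simp add: field_simps)
    also have "\<dots> \<longleftrightarrow> (- (?x * c) / (?s * t)) ^ r = 1"
    proof -
      have "u ^ r = ?s ^ r * t ^ r \<longleftrightarrow> (u / (?s * t)) ^ r = 1" for u
        using t_nz spec_t_nz by (simp add: power_divide power_mult_distrib)
      then show ?thesis .
    qed
    finally show ?thesis .
  qed
  have "Nt i j (Z_param i a) = {c. (- (?x * c) / (?s * t)) ^ r = 1}"
    using ij unfolding Nt_def e by (simp add: iff)
  also have "\<dots> = (\<lambda>w. ?x * ?s * t * (- w)) ` {w. w ^ r = 1}"
  proof (intro equalityI subsetI)
    fix c assume c: "c \<in> {c. (- (?x * c) / (?s * t)) ^ r = 1}"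
    have "c = ?x * ?s * t * (- (- (?x * c) / (?s * t)))"
      using t_nz spec_t_nz zsign_sq[of j] by (simp add: field_simps)
    then show "c \<in> (\<lambda>w. ?x * ?s * t * (- w)) ` {w. w ^ r = 1}" using c by blast
  next
    fix c assume "c \<in> (\<lambda>w. ?x * ?s * t * (- w)) ` {w. w ^ r = 1}"
    then obtain w where w: "w ^ r = 1" "c = ?x * ?s * t * (- w)" by blast
    have "- (?x * c) / (?s * t) = (?x * ?x) * w" using t_nz spec_t_nz by (simp add: w(2) field_simps)
    then show "c \<in> {c. (- (?x * c) / (?s * t)) ^ r = 1}" using w(1) by (simp add: zsign_sq)
  qed
  also have "\<dots> = ?g ` {..<r}" unfolding eps_roots[symmetric] by (simp add: image_image)
  finally show ?thesis .
qed

lemma Nt_long: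
  assumes "a \<in> CC" "i \<noteq> j" "C i j \<noteq> 0" "d j \<le> d i"
  shows "Nt i j (Z_param i a) = {Z_param j (a * q ^ d i * t)}"
  using assms by (simp add: Nt_def yt_Z_param)

text \<open>The minus sign in \<open>Nt_short\<close> is absorbed by \<open>eps ^ r = -1\<close> as
  a shift of the exponent by \<open>- r\<close>. The points are then those of \<open>X_ex j\<close>
  with centre \<open>a * q * t\<close>.\<close>

lemma Nt_short_alt:
  assumes a: "a \<in> CC" and ij: "i \<noteq> j" "C i j \<noteq> 0" "d i < d j"
  shows "Nt i j (Z_param i a) = (\<lambda>k. Z_param j (a * q powi (2 + 2 * int k - int r) * t)) ` {..<r}"
proof -
  have "dual_d j = 1" using C_short[OF ij(3)] by (simp add: dual_d_def)
  moreover have "spec_t (a * q powi (2 + 2 * int k - int r) * t) = spec_t a * t * (- (eps ^ (2 * Suc k)))" for k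
  proof -
    have "eps powi (2 + 2 * int k - int r) = eps powi int (2 * Suc k) / eps ^ r"
      using eps_nz by (simp add: power_int_diff)
    then show ?thesis
      using CC_mult(2)[OF a, of "2 + 2 * int k - int r" 1] unfolding eps_r power_int_of_nat by simp
  qed
  ultimately have "Z_param j (a * q powi (2 + 2 * int k - int r) * t)
      = zsign j * spec_t a * t * (- (eps ^ (2 * Suc k)))" for k
    unfolding Z_param_eq by (simp only: power_one_right mult.assoc)
  then show ?thesis by (simp only: Nt_short[OF assms])
qed

lemma CC_shift_powi: "a \<in> CC \<Longrightarrow> a * q powi k * t \<in> CC"
  using CC_mult(1)[of a k 1] by simp

lemma Vt_nz: "b \<in> Vt i \<Longrightarrow> b \<noteq> 0"
  unfolding Vt_def Z_param_eq using zsign_nz spec_t_nz by auto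

lemma Pt_powi: "Pt i powi n = (t powi (2 * n)) ^ dual_d i"
proof -
  have "Pt i powi n = t powi (int (2 * dual_d i) * n)"
    using power_int_mult[of t "int (2 * dual_d i)" n] unfolding Pt_def power_int_of_nat by simp
  also have "\<dots> = (t powi (2 * n)) powi int (dual_d i)"
    unfolding power_int_mult[symmetric] by (simp add: ac_simps)
  finally show ?thesis by simp
qed

text \<open>Positivity is that of \<open>qform\<close> at the rescaled vector
  \<open>c i / d i\<close>, the passage from roots to coroots. The number of neighbours of a short
  variable is the number of \<open>r\<close>-th roots of unity.\<close>

sublocale ts: spectral Vt Pt Nt C "\<lambda>i. 1 / real (d i)"
proof
  fix b i j assume "b \<in> Vt i"
  then obtain a where a: "a \<in> CC" and b: "b = Z_param i a" unfolding Vt_def by blast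
  have N: "Nt i j b = (if j = i \<or> C i j = 0 then {} else if d j \<le> d i then {Z_param j (a * q ^ d i * t)}
      else (\<lambda>k. Z_param j (a * q powi (2 + 2 * int k - int r) * t)) ` {..<r})"
  proof (cases "j = i \<or> C i j = 0")
    case False
    then show ?thesis
      using Nt_long[OF a, of i j] Nt_short_alt[OF a, of i j] by (cases "d j \<le> d i") (auto simp: b)
  qed (simp add: Nt_def)
  show "Nt i j b \<subseteq> Vt j"
    unfolding N Vt_def using CC_shift[OF a, of "d i" 1] CC_shift_powi[OF a] by auto
  show "finite (Nt i j b)" unfolding N by simp
  show "C i j = - int (card (Nt i j b))" if ij: "i \<noteq> j"
  proof (cases "C i j = 0")
    case True
    then show ?thesis by (simp add: Nt_def)
  next
    case False
    show ?thesis
    proof (cases "d j \<le> d i")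
      case True
      then show ?thesis using d_ratio(1)[OF ij False True] ij False unfolding N by simp
    next
      case nd: False
      have "card (Nt i j b) = card ((\<lambda>w. zsign j * spec_t a * t * (- w)) ` {w. w ^ r = 1})"
        using Nt_short[OF a ij False] nd unfolding b eps_roots[symmetric] by (simp add: image_image)
      also have "\<dots> = card {w :: complex. w ^ r = 1}"
        by (rule card_image) (use zsign_nz[of j] spec_t_nz[of a] t_nz in \<open>auto simp: inj_on_def\<close>)
      also have "\<dots> = r" by (rule card_roots_unity_eq) (use lacing in auto)
      finally show ?thesis using d_ratio_neg(3)[OF ij False nd] by simp
    qed
  qed
next
  fix i n assume "Pt i powi n = 1"
  then have "t powi (int (2 * dual_d i) * n) = 1"
    using power_int_mult[of t "int (2 * dual_d i)" n] unfolding Pt_def power_int_of_nat by simp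
  then show "n = 0" using t_powi_eq_1[of "int (2 * dual_d i) * n"] dual_d_pos[of i] by simp
next
  fix b i n assume "b \<in> Vt i"
  then obtain a where a: "a \<in> CC" "b = Z_param i a" unfolding Vt_def by blast
  have "b * Pt i powi n = Z_param i (a * q powi 0 * t powi (2 * n))"
    unfolding a(2) Z_param_eq Pt_powi CC_mult(2)[OF a(1)] by (simp add: power_mult_distrib)
  then show "b * Pt i powi n \<in> Vt i" using CC_mult(1)[OF a(1), of 0 "2 * n"] unfolding Vt_def by blast
next
  fix c :: "'a \<Rightarrow> real" assume c: "c \<noteq> (\<lambda>_. 0)"
  have dpos: "real (d i) \<noteq> 0" for i using d_pos[of i] by simp
  have "(\<lambda>i. c i / real (d i)) \<noteq> (\<lambda>_. 0)" using c dpos by (auto simp: fun_eq_iff)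
  then have "0 < qform (\<lambda>i. c i / real (d i))" by (rule qform_pos)
  also have "\<dots> = (\<Sum>i\<in>UNIV. \<Sum>j\<in>UNIV. of_int (C i j) * (1 / real (d j)) * c i * c j)"
  proof -
    have "real (d i) * of_int (C i j) * (c i / real (d i)) * (c j / real (d j))
        = of_int (C i j) * (1 / real (d j)) * c i * c j" for i j
      using dpos[of i] by simp
    then show ?thesis unfolding qform_def by (simp only:)
  qed
  finally show "0 < (\<Sum>i\<in>UNIV. \<Sum>j\<in>UNIV. of_int (C i j) * (1 / real (d j)) * c i * c j)" .
next
  fix i j
  have "real (d i) \<noteq> 0" "real (d j) \<noteq> 0" using d_pos[of i] d_pos[of j] by auto
  then show "of_int (C i j) * (1 / real (d j)) = of_int (C j i) * (1 / real (d i))"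
    using arg_cong[OF symm[of i j], of real_of_int] by (simp add: field_simps)
  show "0 < 1 / real (d i)" using d_pos[of i] by simp
qed (auto simp: Vt_nz Pt_def t_nz Nt_def C_diag)

lemma t_pattern:
  assumes ij: "i \<noteq> j" "C i j \<noteq> 0" "d j \<le> d i"
  shows "ts.pattern i j 0 (yt i j)"
  unfolding ts.pattern_def
proof (intro conjI ballI)
  fix b assume "b \<in> Vt i"
  then obtain a where a: "a \<in> CC" "b = Z_param i a" unfolding Vt_def by blast
  show "yt i j b \<in> Vt j"
    unfolding a(2) yt_Z_param[OF a(1) ij(3)] Vt_def using CC_shift[OF a(1), of "d i" 1] by auto
  show "Nt i j b = (\<lambda>k. yt i j b * Pt j ^ k) ` {..<Suc 0}"
    using ij by (simp add: Nt_def lessThan_Suc)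
  have P: "Pt i ^ (dual_d j div dual_d i) = Pt j"
    unfolding Pt_def power_mult[symmetric] mult.assoc dual_d_ratio[OF ij(3)] ..
  have "yt i j (c * Pt i) = yt i j c * Pt i ^ (dual_d j div dual_d i)" for c
    by (simp add: yt_def power_mult_distrib ac_simps)
  then show "yt i j (b * Pt i) = yt i j b * Pt j ^ Suc 0" unfolding P by simp
  fix w assume "w \<in> Vt j"
  show "b * Pt i \<in> Nt j i w \<longleftrightarrow> w = yt i j b * Pt j ^ 0"
  \<comment> \<open>For equal lengths both directions are given by \<open>yt\<close>, and their
    composition has to be the shift \<open>Pt i\<close>: the signs square to 1 and the factor
    \<open>eps ^ r = -1\<close> occurs twice.\<close>
  proof (cases "d j = d i")
    case True
    then have e: "dual_d j = dual_d i" by (simp add: dual_d_def)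
    have "dual_d i div dual_d i = 1" using dual_d_pos[of i] by simp
    then have yt: "yt i j c = zsign i * zsign j * eps ^ r * c * t ^ dual_d i"
        "yt j i c = zsign i * zsign j * eps ^ r * c * t ^ dual_d i" for c
      using d_dual_d[of i] True by (simp_all add: yt_def e)
    have t2: "t ^ (2 * dual_d i) = t ^ dual_d i * t ^ dual_d i" by (simp add: mult_2 power_add)
    have sq: "zsign i * zsign j * (zsign i * zsign j) = 1"
      using zsign_sq[of i] zsign_sq[of j] by (metis (no_types, lifting) mult.assoc mult.commute mult_1)
    have "b * Pt i \<in> Nt j i w \<longleftrightarrow> b * t ^ (2 * dual_d i) = yt j i w"
      using ij True C_zero[of i j] by (auto simp: Nt_def Pt_def)
    also have "\<dots> \<longleftrightarrow> b * t ^ dual_d i = - (zsign i * zsign j) * w"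
    proof -
      have "b * t ^ (2 * dual_d i) = (b * t ^ dual_d i) * t ^ dual_d i"
        "yt j i w = (- (zsign i * zsign j) * w) * t ^ dual_d i"
        unfolding t2 yt eps_r by simp_all
      then show ?thesis using t_nz by (simp only: mult_cancel_right) simp
    qed
    also have "\<dots> \<longleftrightarrow> w = - (zsign i * zsign j) * (b * t ^ dual_d i)"
    proof
      assume *: "b * t ^ dual_d i = - (zsign i * zsign j) * w"
      show "w = - (zsign i * zsign j) * (b * t ^ dual_d i)"
        unfolding * using sq by (simp add: mult.assoc[symmetric])
    next
      assume *: "w = - (zsign i * zsign j) * (b * t ^ dual_d i)"
      show "b * t ^ dual_d i = - (zsign i * zsign j) * w"
        unfolding * using sq by (simp add: mult.assoc[symmetric])
    qed
    finally show ?thesis unfolding yt eps_r by (simp add: mult.assoc)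
  next
    case False
    then have "b * Pt i \<in> Nt j i w \<longleftrightarrow> yt i j (b * Pt i / t ^ (2 * dual_d i)) = w"
      using ij C_zero[of i j] by (auto simp: Nt_def)
    then show ?thesis using t_nz by (auto simp: Pt_def)
  qed
qed

sublocale ts: spectral_cartan Vt Pt Nt C "\<lambda>i. 1 / real (d i)"
proof
  fix i j :: 'a assume ij: "i \<noteq> j"
  show "(\<forall>a\<in>Vt i. Nt i j a = {}) \<and> (\<forall>b\<in>Vt j. Nt j i b = {}) \<or>
      (\<exists>s y. ts.pattern i j s y) \<or> (\<exists>s y. ts.pattern j i s y)"
  proof (cases "C i j = 0")
    case True
    then show ?thesis using C_zero[of i j] by (simp add: Nt_def)
  next
    case False
    moreover have "C j i \<noteq> 0" using False C_zero by blast
    ultimately show ?thesis using t_pattern[of i j] t_pattern[of j i] ij by (metis linear)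
  qed
qed

end

text \<open>The images of \<open>m\<close> are integer multiples of monomials, and the one under
  \<open>Pi_q\<close> may fail to be dominant. This version covers such cases at once: combine the
  elements belonging to the dominant monomials of \<open>f\<close> with the coefficients of
  \<open>f\<close>.\<close>

lemma (in cartan_screening) unique_dominant_correction:
  assumes "on_V f"
  shows "\<exists>g. (\<forall>i. g \<in> K (S i)) \<and> (\<forall>u\<in>keys (g - f). \<not> dominant V u)"
proof -
  define D where "D = {u \<in> keys f. dominant V u}"
  have "\<forall>u\<in>D. \<exists>g. (\<forall>i. g \<in> K (S i)) \<and> lookup g u = 1 \<and> (\<forall>v\<in>keys g. v \<noteq> u \<longrightarrow> \<not> dominant V v)"
    using assms unique_dominant_exists unfolding on_V_def D_def by blast
  from bchoice[OF this] obtain G where G: "\<forall>u\<in>D. (\<forall>i. G u \<in> K (S i)) \<and> lookup (G u) u = 1 \<and>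
      (\<forall>v\<in>keys (G u). v \<noteq> u \<longrightarrow> \<not> dominant V v)" ..
  define g where "g = (\<Sum>u\<in>D. frag_cmul (lookup f u) (G u))"
  have "g \<in> K (S i)" for i
    unfolding g_def using G by (intro K_sum K_cmul) blast
  moreover have "\<not> dominant V u" if u: "u \<in> keys (g - f)" for u
  proof
    assume dom: "dominant V u"
    have "u \<in> keys (f - g)" using u by (simp add: in_keys_iff lookup_minus)
    then have "u \<in> keys f \<and> u \<notin> D \<or> (\<exists>v\<in>D. v \<in> keys f \<and> u \<in> keys (G v - frag_of v))"
      unfolding g_def by (intro keys_subtract_leading) (simp add: D_def)
    then obtain v where v: "v \<in> D" "u \<in> keys (G v - frag_of v)" using dom unfolding D_def by blast
    show False
    proof (cases "u = v")
      case True
      then show False using v G by (auto simp: in_keys_iff lookup_minus)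
    next
      case False
      then have "u \<in> keys (G v)" using v(2) by (auto simp: in_keys_iff lookup_minus)
      then show False using G v(1) False dom by blast
    qed
  qed
  ultimately show ?thesis by blast
qed

text \<open>Multiplicativity is asked on the generated ring only, since \<open>ev_q\<close> has it
  only on Laurent polynomials in the \<open>X_ex i a\<close>.\<close>

lemma gring_image:
  assumes "\<phi> 1 = 1" "\<And>x. \<phi> (- x) = - \<phi> x" "\<And>x y. \<phi> (x + y) = \<phi> x + \<phi> y"
    and "\<And>x y. x \<in> gring H \<Longrightarrow> y \<in> gring H \<Longrightarrow> \<phi> (x * y) = \<phi> x * \<phi> y"
  shows "\<phi> ` gring H = gring (\<phi> ` H)"
proof (intro equalityI subsetI)
  fix y assume "y \<in> \<phi> ` gring H"
  then obtain x where x: "x \<in> gring H" "y = \<phi> x" by blast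
  from x(1) have "\<phi> x \<in> gring (\<phi> ` H)"
    by (induction rule: gring_induct) (auto simp: assms gring_incl gring_uminus gring_add gring_mult)
  then show "y \<in> gring (\<phi> ` H)" using x(2) by simp
next
  fix y assume "y \<in> gring (\<phi> ` H)"
  then show "y \<in> \<phi> ` gring H"
  proof (induction rule: gring_induct)
    case one
    then show ?case using assms(1) by (metis gring_1 imageI)
  next
    case (incl h)
    then show ?case using gring_incl by blast
  next
    case (uminus h)
    then show ?case by (auto simp flip: assms(2) intro!: imageI gring_uminus)
  next
    case (add h h')
    then show ?case by (auto simp flip: assms(3) intro!: imageI gring_add)
  next
    case (mult h h')
    then obtain x y where "x \<in> gring H" "h = \<phi> x" "y \<in> gring H" "h' = \<phi> y" by blast
    then have "x * y \<in> gring H" "h * h' = \<phi> (x * y)" by (simp_all add: assms(4) gring_mult)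
    then show ?case by blast
  qed
qed

lemma vlin_indicator: "vlin (\<lambda>x. if x = y then 1 else 0) u = lookup u y"
  unfolding vlin_def by (auto simp: in_keys_iff if_distrib[of "(*) _"] cong: if_cong)

lemma lookup_frag_extend_vlin: "lookup (frag_extend f u) y = vlin (\<lambda>x. lookup (f x) y) u"
  unfolding lookup_frag_extend vlin_def by simp

lemma vlin_fun_add: "vlin (\<lambda>x. \<phi> x + \<psi> x) u = vlin \<phi> u + vlin \<psi> u"
  unfolding vlin_def by (simp add: distrib_left sum.distrib)

context langlands_lacing
begin

section \<open>The specialization maps\<close>

definition CCE :: "'a expo set" where
  "CCE = {e. keys e \<subseteq> UNIV \<times> CC}"

definition LZ :: "'a laurent set" where
  "LZ = {g. keys g \<subseteq> CCE}"

definition LX :: "'a laurent set" where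
  "LX = {g. keys g \<subseteq> X_to_z ` CCE}"

definition th_t :: "'a expo \<Rightarrow> 'a expo" where
  "th_t = frag_extend (\<lambda>(i, a). z_ex i (Z_param i a))"

definition th_q :: "'a expo \<Rightarrow> 'a expo" where
  "th_q = frag_extend (\<lambda>(i, a). z_ex i (spec_q a))"

definition ev_t :: "'a laurent \<Rightarrow> 'a laurent" where
  "ev_t = frag_extend (\<lambda>u. frag_of (th_t u))"

definition ev_q :: "'a laurent \<Rightarrow> 'a laurent" where
  "ev_q = frag_extend (\<lambda>u. frag_of (th_q (z_to_X u)))"

lemma Pi_t_ev: "Pi_t p = ev_t (poly p 1)"
  by (simp add: Pi_t_def ev_t_def th_t_def)

lemma Pi_q_ev: "Pi_q p = ev_q (poly p 0)"
  by (simp add: Pi_q_def ev_q_def th_q_def)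

lemma CCE_zero: "0 \<in> CCE"
  and CCE_add: "u \<in> CCE \<Longrightarrow> v \<in> CCE \<Longrightarrow> u + v \<in> CCE"
  and CCE_diff: "u \<in> CCE \<Longrightarrow> v \<in> CCE \<Longrightarrow> u - v \<in> CCE"
  and CCE_minus: "u \<in> CCE \<Longrightarrow> - u \<in> CCE"
  unfolding CCE_def using keys_add[of u v] keys_diff[of u v] by auto

lemma CCE_sum: "(\<And>k. k \<in> I \<Longrightarrow> g k \<in> CCE) \<Longrightarrow> sum g I \<in> CCE"
  by (induction I rule: infinite_finite_induct) (auto intro: CCE_zero CCE_add)

lemma CCE_frag_of: "a \<in> CC \<Longrightarrow> frag_of (i, a) \<in> CCE"
  by (auto simp: CCE_def)

lemma th_t_add: "th_t (u + v) = th_t u + th_t v"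
  and th_t_diff: "th_t (u - v) = th_t u - th_t v"
  and th_t_minus: "th_t (- u) = - th_t u"
  and th_t_frag_of: "th_t (frag_of (i, a)) = frag_of (i, Z_param i a)"
  by (simp_all add: th_t_def frag_extend_add frag_extend_diff frag_extend_minus z_ex_def)

lemma th_q_add: "th_q (u + v) = th_q u + th_q v"
  and th_q_diff: "th_q (u - v) = th_q u - th_q v"
  and th_q_minus: "th_q (- u) = - th_q u"
  and th_q_zero: "th_q 0 = 0"
  and th_q_frag_of: "th_q (frag_of (i, a)) = frag_of (i, spec_q a)"
  by (simp_all add: th_q_def frag_extend_add frag_extend_diff frag_extend_minus z_ex_def)

lemma th_q_sum: "th_q (\<Sum>k\<in>I. g k) = (\<Sum>k\<in>I. th_q (g k))"
  by (induction I rule: infinite_finite_induct) (simp_all add: th_q_add th_q_zero)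

lemma th_t_zero: "th_t 0 = 0"
  by (simp add: th_t_def)

lemma th_t_sum: "th_t (\<Sum>k\<in>I. g k) = (\<Sum>k\<in>I. th_t (g k))"
  by (induction I rule: infinite_finite_induct) (simp_all add: th_t_add th_t_zero)

lemma X_to_z_add: "X_to_z (u + v) = X_to_z u + X_to_z v"
  and X_to_z_diff: "X_to_z (u - v) = X_to_z u - X_to_z v"
  and X_to_z_minus: "X_to_z (- u) = - X_to_z u"
  and X_to_z_zero: "X_to_z 0 = 0"
  and X_to_z_frag_of: "X_to_z (frag_of (i, a)) = X_ex i a"
  by (simp_all add: X_to_z_def frag_extend_add frag_extend_diff frag_extend_minus)

lemma X_to_z_sum: "X_to_z (\<Sum>k\<in>I. g k) = (\<Sum>k\<in>I. X_to_z (g k))"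
  by (induction I rule: infinite_finite_induct) (simp_all add: X_to_z_add X_to_z_zero)

lemma d_values: "d i = 1 \<or> d i = 2 \<or> d i = 3"
  using d_cases[of i] lacing by auto

lemma X_ex_sum:
  "X_ex i a = (\<Sum>k<d i. z_ex i (a * q powi (2 * int k + 1 - int (d i))))"
proof -
  have m1: "q powi (-1) = inverse q" "q powi (-2) = inverse (q^2)" "q powi 2 = q^2"
    by (simp_all add: power_int_minus)
  show ?thesis
    using d_values[of i] by (elim disjE) (simp_all add: X_ex_def numeral_eq_Suc lessThan_Suc divide_inverse m1[unfolded numeral_eq_Suc])
qed

text \<open>Independence of the \<open>X_ex i a\<close>: look at the largest exponent of \<open>q\<close>.\<close>

lemma X_to_z_inj:
  assumes "X_to_z e = 0" "e \<in> CCE"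
  shows "e = 0"
proof (rule ccontr)
  assume "e \<noteq> 0"
  then obtain i a where ia: "(i, a) \<in> keys e" by (metis all_not_in_conv keys_eq_empty surj_pair)
  then have a: "a \<noteq> 0" using assms(2) CC_nz by (auto simp: CCE_def)
  define N where "N = {n. (i, a * q ^ (2 * n)) \<in> keys e}"
  have "inj_on (\<lambda>n. (i, a * q ^ (2 * n))) N"
    using a q_nz by (auto simp: inj_on_def q_power_inj)
  moreover have "(\<lambda>n. (i, a * q ^ (2 * n))) ` N \<subseteq> keys e" by (auto simp: N_def)
  ultimately have N: "finite N" using finite_keys by (metis inj_on_finite)
  have "0 \<in> N" using ia by (simp add: N_def)
  then have "Max N \<in> N" using N by (intro Max_in) auto
  define b where "b = a * q ^ (2 * Max N)"
  have b: "lookup e (i, b) \<noteq> 0" using \<open>Max N \<in> N\<close> by (simp add: N_def b_def in_keys_iff)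
  have above: "lookup e (i, b * q ^ (2 * k)) = 0" if "k > 0" for k
  proof (rule ccontr)
    assume "lookup e (i, b * q ^ (2 * k)) \<noteq> 0"
    then have "Max N + k \<in> N" by (simp add: N_def b_def in_keys_iff distrib_left power_add mult.assoc)
    then show False using Max_ge[OF N] that by fastforce
  qed
  have lookup_X: "lookup (X_to_z e) (i, c) = vlin (\<lambda>x. lookup (case x of (i, a) \<Rightarrow> X_ex i a) (i, c)) e" for c
    unfolding X_to_z_def by (rule lookup_frag_extend_vlin)
  have other: "lookup (X_ex j a') (i, c) = 0" if "j \<noteq> i" for j a' c
    using that by (simp add: X_ex_def z_ex_def lookup_add)
  consider "d i = 1" | "d i = 2" | "d i = 3" using d_values by blast
  \<comment> \<open>The witness is \<open>b * q ^ (d i - 1)\<close>, the last variable of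
    \<open>X_ex i b\<close>. Any other \<open>X_ex\<close> that contains it has parameter
    \<open>b * q ^ (2 * k)\<close> with \<open>k > 0\<close> and does not occur by
    \<open>above\<close>.\<close>
  then have "\<exists>c. lookup (X_to_z e) (i, c) = lookup e (i, b)"
  proof cases
    case 1
    have "(\<lambda>x. lookup (case x of (i, a) \<Rightarrow> X_ex i a) (i, b)) = (\<lambda>x. if x = (i, b) then 1 else 0)"
    proof
      fix x :: "'a \<times> complex"
      obtain j a' where x: "x = (j, a')" by (cases x)
      show "lookup (case x of (i, a) \<Rightarrow> X_ex i a) (i, b) = (if x = (i, b) then 1 else 0)"
        using other[of j a' b] 1 by (cases "j = i") (auto simp: x X_ex_def z_ex_def)
    qed
    then show ?thesis by (intro exI[of _ b]) (simp add: lookup_X vlin_indicator)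
  next
    case 2
    have "(\<lambda>x. lookup (case x of (i, a) \<Rightarrow> X_ex i a) (i, b * q))
        = (\<lambda>x. (if x = (i, b * q ^ (2 * 1)) then 1 else 0) + (if x = (i, b) then 1 else 0))"
    proof
      fix x :: "'a \<times> complex"
      obtain j a' where x: "x = (j, a')" by (cases x)
      have "b * q = a' / q \<longleftrightarrow> a' = b * q^2" "b * q = a' * q \<longleftrightarrow> a' = b"
        using q_nz by (auto simp: field_simps power2_eq_square)
      then show "lookup (case x of (i, a) \<Rightarrow> X_ex i a) (i, b * q)
          = (if x = (i, b * q ^ (2 * 1)) then 1 else 0) + (if x = (i, b) then 1 else 0)"
        using other[of j a' "b * q"] 2 by (cases "j = i") (auto simp: x X_ex_def z_ex_def lookup_add)
    qed
    then show ?thesis using above[of 1]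
      by (intro exI[of _ "b * q"]) (simp add: lookup_X vlin_fun_add vlin_indicator)
  next
    case 3
    have "(\<lambda>x. lookup (case x of (i, a) \<Rightarrow> X_ex i a) (i, b * q^2))
        = (\<lambda>x. ((if x = (i, b * q ^ (2 * 2)) then 1 else 0) + (if x = (i, b * q ^ (2 * 1)) then 1 else 0))
          + (if x = (i, b) then 1 else 0))"
    proof
      fix x :: "'a \<times> complex"
      obtain j a' where x: "x = (j, a')" by (cases x)
      have "b * q^2 = a' / q^2 \<longleftrightarrow> a' = b * q^4" "b * q^2 = a' * q^2 \<longleftrightarrow> a' = b"
        using q_nz by (auto simp: field_simps simp flip: power_add)
      then show "lookup (case x of (i, a) \<Rightarrow> X_ex i a) (i, b * q^2)
          = ((if x = (i, b * q ^ (2 * 2)) then 1 else 0) + (if x = (i, b * q ^ (2 * 1)) then 1 else 0))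
            + (if x = (i, b) then 1 else 0)"
        using other[of j a' "b * q^2"] 3 by (cases "j = i") (auto simp: x X_ex_def z_ex_def lookup_add)
    qed
    then show ?thesis using above[of 1] above[of 2]
      by (intro exI[of _ "b * q^2"]) (simp add: lookup_X vlin_fun_add vlin_indicator)
  qed
  then show False using assms(1) b by auto
qed

lemma z_to_X: "e \<in> CCE \<Longrightarrow> z_to_X (X_to_z e) = e"
  unfolding z_to_X_def CCE_def[symmetric]
proof (rule inv_into_f_f)
  show "inj_on X_to_z CCE"
  proof (rule inj_onI)
    fix u v assume uv: "u \<in> CCE" "v \<in> CCE" "X_to_z u = X_to_z v"
    have "u - v = 0" by (rule X_to_z_inj[OF _ CCE_diff[OF uv(1,2)]]) (simp add: X_to_z_diff uv(3))
    then show "u = v" by simp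
  qed
qed

lemma ev_t_frag_of: "ev_t (frag_of u) = frag_of (th_t u)"
  by (simp add: ev_t_def)

lemma ev_q_frag_of: "e \<in> CCE \<Longrightarrow> ev_q (frag_of (X_to_z e)) = frag_of (th_q e)"
  by (simp add: ev_q_def z_to_X)

lemma ev_t_1: "ev_t 1 = 1"
  using ev_t_frag_of[of 0] th_t_zero by simp

lemma ev_q_1: "ev_q 1 = 1"
  using ev_q_frag_of[OF CCE_zero] th_q_zero X_to_z_zero by simp

lemma ev_t_add: "ev_t (f + g) = ev_t f + ev_t g"
  and ev_t_diff: "ev_t (f - g) = ev_t f - ev_t g"
  and ev_t_minus: "ev_t (- f) = - ev_t f"
  and ev_q_add: "ev_q (f + g) = ev_q f + ev_q g"
  and ev_q_diff: "ev_q (f - g) = ev_q f - ev_q g"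
  and ev_q_minus: "ev_q (- f) = - ev_q f"
  by (simp_all add: ev_t_def ev_q_def frag_extend_add frag_extend_diff frag_extend_minus)

lemma ev_t_mult: "ev_t (f * g) = ev_t f * ev_t g"
  unfolding ev_t_def by (rule frag_extend_mult) (simp add: th_t_add frag_of_add)

lemma ev_q_mult:
  assumes "f \<in> LX" "g \<in> LX"
  shows "ev_q (f * g) = ev_q f * ev_q g"
  unfolding ev_q_def
proof (rule frag_extend_mult)
  fix u v assume "u \<in> keys f" "v \<in> keys g"
  then have "u \<in> X_to_z ` CCE" "v \<in> X_to_z ` CCE" using assms unfolding LX_def by auto
  then obtain e e' where e: "e \<in> CCE" "u = X_to_z e" "e' \<in> CCE" "v = X_to_z e'" by auto
  then show "frag_of (th_q (z_to_X (u + v))) = frag_of (th_q (z_to_X u)) * frag_of (th_q (z_to_X v))"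
    by (simp add: X_to_z_add[symmetric] z_to_X CCE_add th_q_add frag_of_add)
qed

lemma LX_zero: "0 \<in> X_to_z ` CCE"
  using imageI[OF CCE_zero, of X_to_z] X_to_z_zero by simp

lemma LX_exponents_add: "u \<in> X_to_z ` CCE \<Longrightarrow> v \<in> X_to_z ` CCE \<Longrightarrow> u + v \<in> X_to_z ` CCE"
  by (auto simp flip: X_to_z_add intro: CCE_add)

lemma gring_LX: "H \<subseteq> LX \<Longrightarrow> gring H \<subseteq> LX"
  unfolding LX_def using gring_keys[of _ H "X_to_z ` CCE"] LX_zero LX_exponents_add by blast

lemma gring_LZ: "H \<subseteq> LZ \<Longrightarrow> gring H \<subseteq> LZ"
  unfolding LZ_def using gring_keys[of _ H CCE] CCE_zero CCE_add by blast

end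

lemma frag_of_sum: "frag_of (\<Sum>k\<in>I. g k) = (\<Prod>k\<in>I. frag_of (g k :: 'v \<Rightarrow>\<^sub>0 int))"
  by (induction I rule: infinite_finite_induct) (simp_all add: frag_of_add)

context langlands_lacing
begin

section \<open>The exponents of the \<open>B\<close> in terms of the variables \<open>A\<close> of
  the two sides\<close>

definition nbr :: "'a \<Rightarrow> 'a \<Rightarrow> complex \<Rightarrow> 'a expo" where
  "nbr i j c = (if C i j = -1 then z_ex j c else 0)
     + (if C i j = -2 then z_ex j (c / q) + z_ex j (c * q) else 0)
     + (if C i j = -3 then z_ex j (c / q^2) + z_ex j c + z_ex j (c * q^2) else 0)"

lemma B_ex_nbr:
  "B_ex i c = z_ex i (c / (q ^ d i * t)) + z_ex i (c * q ^ d i * t) - (\<Sum>j\<in>UNIV. nbr i j c)"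
proof -
  have filter: "(\<Sum>j\<in>UNIV. if P j then f j else 0) = (\<Sum>j | P j. f j)" for P and f :: "'a \<Rightarrow> 'a expo"
    using sum.inter_filter[of UNIV f P] by simp
  have "(\<Sum>j\<in>UNIV. nbr i j c) = (\<Sum>j | C i j = -1. z_ex j c)
      + (\<Sum>j | C i j = -2. z_ex j (c / q) + z_ex j (c * q))
      + (\<Sum>j | C i j = -3. z_ex j (c / q^2) + z_ex j c + z_ex j (c * q^2))"
    by (simp only: nbr_def sum.distrib[of _ _ UNIV] filter)
  then show ?thesis unfolding B_ex_def by simp
qed

lemma nbr_none: "i = j \<or> C i j = 0 \<Longrightarrow> nbr i j c = 0"
  using C_diag by (auto simp: nbr_def)

lemma nbr_long: "i \<noteq> j \<Longrightarrow> C i j \<noteq> 0 \<Longrightarrow> d j \<le> d i \<Longrightarrow> nbr i j c = z_ex j c"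
  using d_ratio(1)[of i j] by (simp add: nbr_def)

lemma nbr_short: "i \<noteq> j \<Longrightarrow> C i j \<noteq> 0 \<Longrightarrow> \<not> d j \<le> d i \<Longrightarrow> nbr i j c = X_ex j c"
  using d_ratio_neg[of i j] lacing by (auto simp: nbr_def X_ex_def)

lemma CC_powi: "a \<in> CC \<Longrightarrow> a * q powi k \<in> CC"
  using CC_mult(1)[of a k 0] by simp

lemma CC_q: "a \<in> CC \<Longrightarrow> a * q ^ k \<in> CC" "a \<in> CC \<Longrightarrow> a * q ^ k * t \<in> CC"
  using CC_shift[of a k 0] CC_shift[of a k 1] by simp_all

lemma CC_div: "a \<in> CC \<Longrightarrow> a / q ^ k \<in> CC" "a \<in> CC \<Longrightarrow> a / (q ^ k * t) \<in> CC"
  using CC_mult(1)[of a "- int k" 0] CC_mult(1)[of a "- int k" "-1"]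
  by (simp_all add: power_int_minus field_simps)

lemma CCE_z_ex: "a \<in> CC \<Longrightarrow> z_ex i a \<in> CCE"
  unfolding z_ex_def by (rule CCE_frag_of)

lemma CCE_X_ex: "a \<in> CC \<Longrightarrow> X_ex i a \<in> CCE"
  unfolding X_ex_sum by (intro CCE_sum CCE_z_ex CC_powi)

lemma CCE_nbr: "c \<in> CC \<Longrightarrow> nbr i j c \<in> CCE"
  by (cases "i = j \<or> C i j = 0"; cases "d j \<le> d i")
    (auto simp: nbr_none nbr_long nbr_short CCE_zero CCE_z_ex CCE_X_ex)

lemma CCE_B_ex: "c \<in> CC \<Longrightarrow> B_ex i c \<in> CCE"
  unfolding B_ex_nbr by (intro CCE_diff CCE_add CCE_sum CCE_z_ex CCE_nbr CC_div CC_q)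

lemma th_t_z_ex: "th_t (z_ex i a) = frag_of (i, Z_param i a)"
  by (simp add: z_ex_def th_t_frag_of)

lemma Z_param_shift:
  assumes "a \<in> CC"
  shows "Z_param i (a * q ^ (2 * d i) * t ^ 2) = Z_param i a * Pt i"
proof -
  have "2 * d i * dual_d i = r * 2" using d_dual_d[of i] by simp
  then have "(eps ^ (2 * d i)) ^ dual_d i = (eps ^ r) ^ 2" by (simp only: power_mult[symmetric])
  then have "(eps ^ (2 * d i)) ^ dual_d i = 1" by (simp add: eps_r)
  then show ?thesis
    unfolding Z_param_eq spec_t_shift[OF assms] Pt_def
    by (simp add: power_mult_distrib power_mult[of t 2])
qed

text \<open>In the direction from short to long, \<open>X_ex j\<close> specializes to
  \<open>r\<close> variables. That they are distinct follows from the number of neighbours, already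
  known from the Cartan matrix.\<close>

lemma th_t_nbr:
  assumes a: "a \<in> CC"
  shows "th_t (nbr i j (a * q ^ d i * t)) = (\<Sum>b\<in>Nt i j (Z_param i a). frag_of (j, b))"
proof (cases "i = j \<or> C i j = 0")
  case True
  then show ?thesis by (auto simp: nbr_none Nt_def th_t_zero)
next
  case False
  then have ij: "i \<noteq> j" "C i j \<noteq> 0" by auto
  show ?thesis
  proof (cases "d j \<le> d i")
    case True
    then show ?thesis using nbr_long[OF ij] Nt_long[OF a ij] by (simp add: th_t_z_ex)
  next
    case nd: False
    note neg = d_ratio_neg[OF ij nd]
    let ?g = "\<lambda>k. Z_param j (a * q powi (2 + 2 * int k - int r) * t)"
    have N: "Nt i j (Z_param i a) = ?g ` {..<r}" using Nt_short_alt[OF a ij] nd by simp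
    have "card (Nt i j (Z_param i a)) = r"
      using ts.N_card[of "Z_param i a" i j] ij neg a by (auto simp: Vt_def)
    then have inj: "inj_on ?g {..<r}" unfolding N by (intro eq_card_imp_inj_on) auto
    have arg: "a * q ^ d i * t * q powi (2 * int k + 1 - int (d j)) = a * q powi (2 + 2 * int k - int r) * t" for k
    proof -
      have "q powi (2 + 2 * int k - int r) = q powi (1 + (2 * int k + 1 - int r))" by (rule arg_cong) simp
      also have "\<dots> = q * q powi (2 * int k + 1 - int r)" using q_nz by (subst power_int_add) auto
      finally show ?thesis using neg by simp
    qed
    have "th_t (nbr i j (a * q ^ d i * t)) = (\<Sum>k<d j. frag_of (j, ?g k))"
      by (simp only: nbr_short[OF ij nd] X_ex_sum th_t_sum th_t_z_ex arg)
    then have "th_t (nbr i j (a * q ^ d i * t)) = (\<Sum>k<r. frag_of (j, ?g k))"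
      by (simp only: neg(2))
    then show ?thesis unfolding N using sum.reindex[OF inj, of "\<lambda>b. frag_of (j, b)"] by simp
  qed
qed

lemma th_t_B_ex:
  assumes a: "a \<in> CC"
  shows "th_t (B_ex i (a * q ^ d i * t)) = ts.A (i, Z_param i a)"
proof -
  have e1: "a * q ^ d i * t / (q ^ d i * t) = a" using q_nz t_nz by simp
  have e2: "a * q ^ d i * t * q ^ d i * t = a * q ^ (2 * d i) * t ^ 2"
    by (simp add: mult_2 mult_2_right power_add power2_eq_square ac_simps)
  show ?thesis
    unfolding B_ex_nbr e1 e2 ts.A_def th_t_diff th_t_add th_t_sum th_t_nbr[OF a] th_t_z_ex
      Z_param_shift[OF a] by simp
qed

definition qm :: "'a \<Rightarrow> 'a \<Rightarrow> nat" where
  "qm i j = (if j = i \<or> C i j = 0 then 0 else if d j \<le> d i then d i div d j else 1)"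

definition qf :: "'a \<Rightarrow> 'a \<Rightarrow> nat \<Rightarrow> nat" where
  "qf i j k = (if d j \<le> d i then d j + 2 * d j * k else d i)"

lemma Nq_qm: "Nq i j a = (\<lambda>k. a * q ^ qf i j k) ` {..<qm i j}"
  by (auto simp: Nq_def qm_def qf_def power_add mult.assoc)

lemma Nq_inj: "a \<noteq> 0 \<Longrightarrow> inj_on (\<lambda>k. a * q ^ qf i j k) {..<qm i j}"
  using d_pos[of j] by (auto simp: inj_on_def q_power_inj qm_def qf_def split: if_splits)

definition B_sum :: "'a \<Rightarrow> complex \<Rightarrow> 'a expo" where
  "B_sum i a = (\<Sum>k<d i. B_ex i (a * q ^ (2 * k + 1) * t))"

text \<open>\<open>B_sum i a\<close> is the exponent of the variable \<open>A\<close> at node \<open>i\<close>; the following is its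
  expression in the \<open>X_ex\<close>.\<close>

definition BX :: "'a \<Rightarrow> complex \<Rightarrow> 'a expo" where
  "BX i a = frag_of (i, a) + frag_of (i, a * q ^ (2 * d i) * t ^ 2)
     - (\<Sum>j\<in>UNIV. \<Sum>k<qm i j. frag_of (j, a * q ^ qf i j k * t))"

lemma CCE_BX: "a \<in> CC \<Longrightarrow> BX i a \<in> CCE"
  unfolding BX_def by (intro CCE_diff CCE_add CCE_sum CCE_frag_of CC_shift CC_q)

lemma spec_q_Vq: "a \<in> CC \<Longrightarrow> spec_q a \<in> Vq i"
  unfolding Vq_def spec_q_def by auto

lemma th_q_BX:
  assumes a: "a \<in> CC"
  shows "th_q (BX i a) = qs.A (i, spec_q a)"
proof -
  have "spec_q (a * q ^ k * t) = spec_q a * q ^ k" for k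
    using spec_q_shift[OF a, of k 1] by simp
  then have "(\<Sum>k<qm i j. th_q (frag_of (j, a * q ^ qf i j k * t)))
      = (\<Sum>b\<in>Nq i j (spec_q a). frag_of (j, b))" for j
    unfolding Nq_qm sum.reindex[OF Nq_inj[OF Vq_nz[OF spec_q_Vq[OF a]]]] by (simp add: th_q_frag_of)
  then show ?thesis
    unfolding BX_def qs.A_def
    by (simp add: th_q_diff th_q_add th_q_sum th_q_frag_of spec_q_shift[OF a] Pq_def)
qed

text \<open>Three different reasons, according to the lengths: if \<open>d j = 1\<close> and
  \<open>i\<close> is not shorter, every neighbour already is an \<open>X_ex\<close>; for equal
  lengths the \<open>d i\<close> neighbours merge into one \<open>X_ex j\<close>; for short
  \<open>i\<close> there is one summand, and its neighbour is a full \<open>X_ex j\<close>.\<close>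

lemma nbr_sum:
  "(\<Sum>k<d i. nbr i j (a * q ^ (2 * k + 1) * t)) = (\<Sum>k<qm i j. X_ex j (a * q ^ qf i j k * t))"
proof (cases "i = j \<or> C i j = 0")
  case True
  then show ?thesis by (auto simp: nbr_none qm_def)
next
  case False
  then have ij: "i \<noteq> j" "C i j \<noteq> 0" by auto
  show ?thesis
  proof (cases "d j \<le> d i")
    case True
    show ?thesis
    proof (cases "d j = 1")
      case d1: True
      then show ?thesis
        using True ij d_pos[of i] nbr_long[OF ij True] by (simp add: qm_def qf_def X_ex_def)
    next
      case False
      then have dij: "d i = d j" using True C_short(1)[of j i] by linarith
      have qm: "qm i j = 1" "qf i j 0 = d i" using ij dij d_pos[of j] by (auto simp: qm_def qf_def)
      have arg: "a * q ^ d i * t * q powi (2 * int k + 1 - int (d j)) = a * q ^ (2 * k + 1) * t" for k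
      proof -
        have "q ^ d i * q powi (2 * int k + 1 - int (d j)) = q powi (int (d i) + (2 * int k + 1 - int (d j)))"
          using q_nz by (simp add: power_int_add)
        also have "\<dots> = q powi int (2 * k + 1)" unfolding dij by (rule arg_cong) simp
        finally show ?thesis by (simp only: power_int_of_nat ac_simps)
      qed
      have "(\<Sum>k<qm i j. X_ex j (a * q ^ qf i j k * t)) = X_ex j (a * q ^ d i * t)"
        by (simp add: qm)
      also have "\<dots> = (\<Sum>k<d j. z_ex j (a * q ^ (2 * k + 1) * t))"
        by (simp only: X_ex_sum arg)
      finally show ?thesis by (simp only: nbr_long[OF ij True] dij)
    qed
  next
    case nd: False
    then show ?thesis
      using d_ratio_neg(1)[OF ij nd] ij nbr_short[OF ij nd] by (simp add: qm_def qf_def)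
  qed
qed

lemma X_to_z_BX: "X_to_z (BX i a) = B_sum i a"
proof -
  have shift: "a * q ^ (2 * k + 1) * t / (q ^ d i * t) = a * q powi (2 * int k + 1 - int (d i))"
    "a * q ^ (2 * k + 1) * t * q ^ d i * t = a * q ^ (2 * d i) * t ^ 2 * q powi (2 * int k + 1 - int (d i))" for k
  proof -
    have p: "q powi (2 * int k + 1 - int (d i)) = q ^ (2 * k + 1) / q ^ d i"
    proof -
      have "2 * int k + 1 = int (2 * k + 1)" by simp
      then have "2 * int k + 1 - int (d i) = int (2 * k + 1) - int (d i)" by (simp only:)
      then show ?thesis
        by (simp only:, subst power_int_diff) (use q_nz in \<open>simp_all only: power_int_of_nat simp_thms\<close>)
    qed
    show "a * q ^ (2 * k + 1) * t / (q ^ d i * t) = a * q powi (2 * int k + 1 - int (d i))"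
      unfolding p using t_nz by simp
    show "a * q ^ (2 * k + 1) * t * q ^ d i * t = a * q ^ (2 * d i) * t ^ 2 * q powi (2 * int k + 1 - int (d i))"
    proof -
      have "q ^ (2 * d i) = q ^ d i * q ^ d i" by (simp add: mult_2 power_add)
      then show ?thesis unfolding p using q_nz by (simp add: power2_eq_square)
    qed
  qed
  have "B_sum i a = (\<Sum>k<d i. z_ex i (a * q powi (2 * int k + 1 - int (d i))))
      + (\<Sum>k<d i. z_ex i (a * q ^ (2 * d i) * t ^ 2 * q powi (2 * int k + 1 - int (d i))))
      - (\<Sum>k<d i. \<Sum>j\<in>UNIV. nbr i j (a * q ^ (2 * k + 1) * t))"
    unfolding B_sum_def B_ex_nbr shift sum_subtractf sum.distrib ..
  also have "\<dots> = X_ex i a + X_ex i (a * q ^ (2 * d i) * t ^ 2)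
      - (\<Sum>j\<in>UNIV. \<Sum>k<d i. nbr i j (a * q ^ (2 * k + 1) * t))"
    unfolding X_ex_sum[symmetric] by (subst sum.swap) (rule refl)
  finally show ?thesis
    unfolding nbr_sum BX_def by (simp add: X_to_z_add X_to_z_diff X_to_z_sum X_to_z_frag_of)
qed

section \<open>The subrings \<open>K_i\<close>\<close>

definition zg :: "'a \<Rightarrow> complex \<Rightarrow> 'a laurent" where
  "zg i a = frag_of (z_ex i a) + frag_of (z_ex i a - B_ex i (a * q ^ d i * t))"

definition xg :: "'a \<Rightarrow> complex \<Rightarrow> 'a laurent" where
  "xg i a = frag_of (X_ex i a) + frag_of (X_ex i a - B_sum i a)"

definition Zgens :: "'a \<Rightarrow> 'a laurent set" where
  "Zgens i = zg i ` CC \<union> (\<lambda>(j, a). frag_of (z_ex j a)) ` ((- {i}) \<times> CC)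
     \<union> (\<lambda>(j, a). frag_of (- z_ex j a)) ` ((- {i}) \<times> CC)"

definition Xgens :: "'a \<Rightarrow> 'a laurent set" where
  "Xgens i = xg i ` CC \<union> (\<lambda>(j, a). frag_of (X_ex j a)) ` ((- {i}) \<times> CC)
     \<union> (\<lambda>(j, a). frag_of (- X_ex j a)) ` ((- {i}) \<times> CC)"

definition Kgen :: "'a \<Rightarrow> 'a laurent poly set" where
  "Kgen i = (if d i = 1 then
        (\<Union>a\<in>CC. {z i a * (1 + B_inv i (a * q * t))})
      else if d i = 2 then
        (\<Union>a\<in>CC.
          {X i a * (1 + gam * B_inv i (a * q^3 * t) + gam * B_inv i (a * q * t)
                      + B_inv i (a * q^3 * t) * B_inv i (a * q * t)),
           gam * z i a * (1 + B_inv i (a * q^2 * t))})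
      else
        (\<Union>a\<in>CC.
          {X i a * (1 + gam * B_inv i (a * q^5 * t)) * (1 + gam * B_inv i (a * q^3 * t))
                 * (1 + gam * B_inv i (a * q * t))
             + (1 - gam) * X i a * B_inv i (a * q^5 * t) * B_inv i (a * q^3 * t)
                 * B_inv i (a * q * t),
           gam * z i a * (1 + B_inv i (a * q^3 * t))}))
     \<union> (\<Union>j\<in>-{i}. \<Union>a\<in>CC. {X j a, X_inv j a, gam * z j a, gam * z_inv j a})
     \<union> {gam}"

lemma K_i_gring: "K_i i = gring (Kgen i)"
  unfolding K_i_def Kgen_def by (rule refl)

lemma poly_mono [simp]: "poly (mono u) c = frag_of u"
  by (simp add: mono_def)

lemma poly_gam [simp]: "poly gam c = c"
  by (simp add: gam_def)

lemma frag_of_diff_mult: "frag_of (u - v :: 'a expo) = frag_of u * frag_of (- v)"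
  by (simp flip: frag_of_add)

lemma Zgens_z: "j \<noteq> i \<Longrightarrow> a \<in> CC \<Longrightarrow> frag_of (z_ex j a) \<in> gring (Zgens i)"
    "j \<noteq> i \<Longrightarrow> a \<in> CC \<Longrightarrow> frag_of (- z_ex j a) \<in> gring (Zgens i)"
    "a \<in> CC \<Longrightarrow> zg i a \<in> gring (Zgens i)"
  by (auto simp: Zgens_def intro!: gring_incl)

lemma Xgens_x: "j \<noteq> i \<Longrightarrow> a \<in> CC \<Longrightarrow> frag_of (X_ex j a) \<in> gring (Xgens i)"
    "j \<noteq> i \<Longrightarrow> a \<in> CC \<Longrightarrow> frag_of (- X_ex j a) \<in> gring (Xgens i)"
    "a \<in> CC \<Longrightarrow> xg i a \<in> gring (Xgens i)"
  by (auto simp: Xgens_def intro!: gring_incl)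

lemma Zgens_X:
  assumes "j \<noteq> i" "a \<in> CC"
  shows "frag_of (X_ex j a) \<in> gring (Zgens i)" "frag_of (- X_ex j a) \<in> gring (Zgens i)"
  unfolding X_ex_sum sum_negf[symmetric] frag_of_sum
  using assms by (auto intro!: gring_prod Zgens_z CC_powi)

lemma zg_eq: "a * q ^ d i * t = c \<Longrightarrow> zg i a = frag_of (z_ex i a) * (1 + frag_of (- B_ex i c))"
  unfolding zg_def frag_of_diff_mult by (simp add: distrib_left)

lemma Kgen_cases [consumes 1]:
  assumes "h \<in> Kgen i"
  obtains (other) "\<exists>j\<in>- {i}. \<exists>a\<in>CC. h \<in> {X j a, X_inv j a, gam * z j a, gam * z_inv j a}"
  | (gam) "h = gam"
  | (one) a where "d i = 1" "a \<in> CC" "h = z i a * (1 + B_inv i (a * q * t))"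
  | (two) a where "d i = 2" "a \<in> CC" "h = X i a * (1 + gam * B_inv i (a * q^3 * t) + gam * B_inv i (a * q * t)
                      + B_inv i (a * q^3 * t) * B_inv i (a * q * t))"
  | (two') a where "d i = 2" "a \<in> CC" "h = gam * z i a * (1 + B_inv i (a * q^2 * t))"
  | (three) a where "d i = 3" "a \<in> CC" "h = X i a * (1 + gam * B_inv i (a * q^5 * t)) * (1 + gam * B_inv i (a * q^3 * t))
                 * (1 + gam * B_inv i (a * q * t))
             + (1 - gam) * X i a * B_inv i (a * q^5 * t) * B_inv i (a * q^3 * t)
                 * B_inv i (a * q * t)"
  | (three') a where "d i = 3" "a \<in> CC" "h = gam * z i a * (1 + B_inv i (a * q^3 * t))"
  using assms d_values[of i] unfolding Kgen_def by (elim disjE) auto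

text \<open>At \<open>\<gamma> = 1\<close> the generators built from \<open>X i a\<close> are products of those built from the \<open>z i a\<close>.\<close>

lemma Kgen_at_1:
  assumes h: "h \<in> Kgen i"
  shows "poly h 1 \<in> gring (Zgens i)"
  using h
proof (cases rule: Kgen_cases)
  case other
  then show ?thesis by (auto intro: Zgens_X Zgens_z)
next
  case (one a)
  then have "poly h 1 = zg i a" by (simp add: zg_def frag_of_diff_mult algebra_simps)
  then show ?thesis using one Zgens_z by simp
next
  case (two a)
  have "poly h 1 = zg i (a / q ^ 1) * zg i (a * q ^ 1)"
  proof -
    have "a / q ^ 1 * q ^ d i * t = a * q * t" "a * q ^ 1 * q ^ d i * t = a * q^3 * t"
      using two q_nz by (simp_all add: power2_eq_square power3_eq_cube)
    note zg = this[THEN zg_eq]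
    have "frag_of (X_ex i a) = frag_of (z_ex i (a / q ^ 1)) * frag_of (z_ex i (a * q ^ 1))"
      using two by (simp add: X_ex_def frag_of_add)
    then show ?thesis unfolding zg two(3) by (simp add: algebra_simps)
  qed
  then show ?thesis using two CC_q(1)[of a 1] CC_div(1)[of a 1] Zgens_z(3) by (simp add: gring_mult)
next
  case (two' a)
  then have "poly h 1 = zg i a" by (simp add: zg_def frag_of_diff_mult algebra_simps)
  then show ?thesis using two' Zgens_z by simp
next
  case (three a)
  have "poly h 1 = zg i (a / q ^ 2) * zg i a * zg i (a * q ^ 2)"
  proof -
    have "a / q ^ 2 * q ^ d i * t = a * q * t" "a * q ^ d i * t = a * q^3 * t"
      "a * q ^ 2 * q ^ d i * t = a * q^5 * t"
      using three q_nz by (simp_all add: numeral_eq_Suc)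
    note zg = this[THEN zg_eq]
    have "frag_of (X_ex i a) = frag_of (z_ex i (a / q ^ 2)) * frag_of (z_ex i a) * frag_of (z_ex i (a * q ^ 2))"
      using three by (simp add: X_ex_def frag_of_add)
    then show ?thesis unfolding zg three(3) by (simp add: algebra_simps)
  qed
  then show ?thesis using three CC_q(1)[of a 2] CC_div(1)[of a 2] Zgens_z(3) by (simp add: gring_mult)
next
  case (three' a)
  then have "poly h 1 = zg i a" by (simp add: zg_def frag_of_diff_mult algebra_simps)
  then show ?thesis using three' Zgens_z by simp
qed simp

lemma B_sum_values:
  "d i = 1 \<Longrightarrow> B_sum i a = B_ex i (a * q * t)"
  "d i = 2 \<Longrightarrow> B_sum i a = B_ex i (a * q * t) + B_ex i (a * q ^ 3 * t)"
  "d i = 3 \<Longrightarrow> B_sum i a = B_ex i (a * q * t) + B_ex i (a * q ^ 3 * t) + B_ex i (a * q ^ 5 * t)"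
  by (simp_all add: B_sum_def numeral_eq_Suc lessThan_Suc ac_simps)

end

context langlands_lacing
begin

lemma frag_of_minus_add: "frag_of (- (u + v) :: 'a expo) = frag_of (- u) * frag_of (- v)"
  by (simp flip: frag_of_add)

lemma gring_poly: "h \<in> H \<Longrightarrow> poly h c \<in> gring ((\<lambda>p. poly p c) ` H)"
  by (rule gring_incl) auto

lemma gring_poly_image:
  assumes "\<And>h. h \<in> H \<Longrightarrow> poly h c \<in> gring H'" "H' \<subseteq> gring ((\<lambda>p. poly p c) ` H)"
  shows "(\<lambda>p. poly p c) ` gring H = gring H'"
proof -
  have "(\<lambda>p. poly p c) ` gring H = gring ((\<lambda>p. poly p c) ` H)" by (rule gring_image) auto
  moreover have "(\<lambda>p. poly p c) ` H \<subseteq> gring H'" using assms(1) by auto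
  ultimately show ?thesis using gring_subset assms(2) by blast
qed

lemma xg_eq: "xg i a = frag_of (X_ex i a) * (1 + frag_of (- B_sum i a))"
  unfolding xg_def frag_of_diff_mult by (simp add: distrib_left)

lemma xg_values:
  "d i = 1 \<Longrightarrow> xg i a = frag_of (z_ex i a) * (1 + frag_of (- B_ex i (a * q * t)))"
  "d i = 2 \<Longrightarrow> xg i a = frag_of (X_ex i a)
    * (1 + frag_of (- B_ex i (a * q * t)) * frag_of (- B_ex i (a * q ^ 3 * t)))"
  "d i = 3 \<Longrightarrow> xg i a = frag_of (X_ex i a) * (1 + frag_of (- B_ex i (a * q * t))
    * frag_of (- B_ex i (a * q ^ 3 * t)) * frag_of (- B_ex i (a * q ^ 5 * t)))"
  by (simp_all only: xg_eq B_sum_values frag_of_minus_add) (simp add: X_ex_def)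

text \<open>At \<open>\<gamma> = 0\<close> the mixed terms disappear. The generator built from
  \<open>X i a\<close> keeps its leading term and the term with all the \<open>B\<close> inverted,
  whose exponents add up to \<open>B_sum i a\<close>.\<close>

lemma Kgen_at_0:
  assumes h: "h \<in> Kgen i"
  shows "poly h 0 \<in> gring (Xgens i)"
  using h
proof (cases rule: Kgen_cases)
  case other
  then show ?thesis by (auto intro: Xgens_x)
next
  case (one a)
  then have "poly h 0 = xg i a" by (simp add: xg_values)
  then show ?thesis using one Xgens_x by simp
next
  case (two a)
  then have "poly h 0 = xg i a" by (simp add: xg_values ac_simps)
  then show ?thesis using two Xgens_x by simp
next
  case (three a)
  then have "poly h 0 = xg i a" by (simp add: xg_values distrib_left ac_simps)
  then show ?thesis using three Xgens_x by simp
qed simp_all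

lemma K_i_at_1: "(\<lambda>p. poly p 1) ` K_i i = gring (Zgens i)"
  unfolding K_i_gring
proof (rule gring_poly_image)
  let ?G = "gring ((\<lambda>p. poly p 1) ` Kgen i)"
  have 1: "zg i a \<in> ?G" if a: "a \<in> CC" for a
  proof -
    have "\<exists>h\<in>Kgen i. poly h 1 = zg i a"
    proof -
      consider "d i = 1" | "d i = 2" | "d i = 3" using d_values by blast
      then show ?thesis
      proof cases
        case d: 1
        show ?thesis
          by (rule bexI[of _ "z i a * (1 + B_inv i (a * q * t))"])
            (use d a in \<open>auto simp: zg_eq Kgen_def\<close>)
      next
        case d: 2
        show ?thesis
          by (rule bexI[of _ "gam * z i a * (1 + B_inv i (a * q ^ 2 * t))"])
            (use d a in \<open>auto simp: zg_eq Kgen_def\<close>)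
      next
        case d: 3
        show ?thesis
          by (rule bexI[of _ "gam * z i a * (1 + B_inv i (a * q ^ 3 * t))"])
            (use d a in \<open>auto simp: zg_eq Kgen_def\<close>)
      qed
    qed
    then show ?thesis by (metis gring_incl imageI)
  qed
  have 2: "frag_of (z_ex j a) \<in> ?G"
    "frag_of (- z_ex j a) \<in> ?G" if "j \<noteq> i" "a \<in> CC" for j a
  proof -
    have *: "gam * z j a \<in> Kgen i" "gam * z_inv j a \<in> Kgen i" using that by (auto simp: Kgen_def)
    show "frag_of (z_ex j a) \<in> ?G"
      "frag_of (- z_ex j a) \<in> ?G"
      using *[THEN gring_poly, of 1] by simp_all
  qed
  show "Zgens i \<subseteq> ?G"
    unfolding Zgens_def by (auto intro: 1 2)
qed (rule Kgen_at_1)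

lemma K_i_at_0: "(\<lambda>p. poly p 0) ` K_i i = gring (Xgens i)"
  unfolding K_i_gring
proof (rule gring_poly_image)
  let ?G = "gring ((\<lambda>p. poly p 0) ` Kgen i)"
  have 1: "xg i a \<in> ?G" if a: "a \<in> CC" for a
  proof -
    have "\<exists>h\<in>Kgen i. poly h 0 = xg i a"
    proof -
      consider "d i = 1" | "d i = 2" | "d i = 3" using d_values by blast
      then show ?thesis
      proof cases
        case d: 1
        show ?thesis
          by (rule bexI[of _ "z i a * (1 + B_inv i (a * q * t))"])
            (use d a in \<open>auto simp: xg_values Kgen_def\<close>)
      next
        case d: 2
        show ?thesis
          by (rule bexI[of _ "X i a * (1 + gam * B_inv i (a * q^3 * t) + gam * B_inv i (a * q * t)
                    + B_inv i (a * q^3 * t) * B_inv i (a * q * t))"])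
            (use d a in \<open>auto simp: xg_values Kgen_def ac_simps\<close>)
      next
        case d: 3
        let ?h = "X i a * (1 + gam * B_inv i (a * q^5 * t)) * (1 + gam * B_inv i (a * q^3 * t))
               * (1 + gam * B_inv i (a * q * t))
           + (1 - gam) * X i a * B_inv i (a * q^5 * t) * B_inv i (a * q^3 * t)
               * B_inv i (a * q * t)"
        have "?h \<in> Kgen i" using d a unfolding Kgen_def by auto
        moreover have "poly ?h 0 = xg i a"
          using d by (simp add: xg_values distrib_left ac_simps)
        ultimately show ?thesis by blast
      qed
    qed
    then show ?thesis by (metis gring_incl imageI)
  qed
  have 2: "frag_of (X_ex j a) \<in> ?G"
    "frag_of (- X_ex j a) \<in> ?G" if "j \<noteq> i" "a \<in> CC" for j a
  proof -
    have *: "X j a \<in> Kgen i" "X_inv j a \<in> Kgen i" using that by (auto simp: Kgen_def)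
    show "frag_of (X_ex j a) \<in> ?G"
      "frag_of (- X_ex j a) \<in> ?G"
      using *[THEN gring_poly, of 0] by simp_all
  qed
  show "Xgens i \<subseteq> ?G"
    unfolding Xgens_def by (auto intro: 1 2)
qed (rule Kgen_at_0)

lemma gring_Zgens_LZ: "gring (Zgens i) \<subseteq> LZ"
proof (rule gring_LZ, rule subsetI)
  fix g assume "g \<in> Zgens i"
  then show "g \<in> LZ"
    unfolding Zgens_def zg_def LZ_def
    by (auto dest!: keys_addD intro!: CCE_z_ex CCE_minus CCE_diff CCE_B_ex CC_q)
qed

lemma xg_X_to_z: "xg i a = frag_of (X_to_z (frag_of (i, a))) + frag_of (X_to_z (frag_of (i, a) - BX i a))"
  by (simp add: xg_def X_to_z_diff X_to_z_BX X_to_z_frag_of)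

lemma frag_of_LX: "e \<in> CCE \<Longrightarrow> frag_of (X_to_z e) \<in> LX"
  by (simp add: LX_def)

lemma LX_add: "f \<in> LX \<Longrightarrow> g \<in> LX \<Longrightarrow> f + g \<in> LX"
  unfolding LX_def using keys_add[of f g] by blast

lemma X_ex_LX: "a \<in> CC \<Longrightarrow> frag_of (X_ex j a) \<in> LX" "a \<in> CC \<Longrightarrow> frag_of (- X_ex j a) \<in> LX"
  using frag_of_LX[OF CCE_frag_of[of a j]] frag_of_LX[OF CCE_minus[OF CCE_frag_of[of a j]]]
  by (simp_all add: X_to_z_frag_of X_to_z_minus)

lemma gring_Xgens_LX: "gring (Xgens i) \<subseteq> LX"
proof (rule gring_LX, rule subsetI)
  fix g assume "g \<in> Xgens i"
  then show "g \<in> LX"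
    unfolding Xgens_def xg_X_to_z
    by (auto intro!: LX_add frag_of_LX CCE_diff CCE_BX CCE_frag_of X_ex_LX)
qed

lemma ev_t_Zgens: "ev_t ` gring (Zgens i) = ts.K (ts.S i)"
proof -
  have S: "ts.S i = (\<lambda>a. (i, Z_param i a)) ` CC"
    "ts.V - ts.S i = (\<lambda>(j, a). (j, Z_param j a)) ` ((- {i}) \<times> CC)"
    unfolding ts.S_def unfolding ts.V_def Vt_def by (force simp: image_iff)+
  have zg: "ev_t (zg i a) = ts.gen (i, Z_param i a)" if "a \<in> CC" for a
    unfolding zg_def ts.gen_def using th_t_B_ex[OF that]
    by (simp add: ev_t_add ev_t_frag_of th_t_diff th_t_z_ex)
  have "ev_t ` Zgens i = ts.gen ` ts.S i \<union> (\<lambda>y. frag_of (frag_of y)) ` (ts.V - ts.S i)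
      \<union> (\<lambda>y. frag_of (- frag_of y)) ` (ts.V - ts.S i)"
    unfolding S(2) unfolding S(1) Zgens_def image_Un image_image
    by (intro arg_cong2[of _ _ _ _ "(\<union>)"] image_cong refl)
      (auto simp: zg ev_t_frag_of th_t_z_ex th_t_minus)
  then show ?thesis
    unfolding ts.K_def by (subst gring_image) (auto simp: ev_t_1 ev_t_minus ev_t_add ev_t_mult)
qed

lemma spec_q_image: "spec_q ` CC = Vq i"
proof
  show "spec_q ` CC \<subseteq> Vq i" using spec_q_Vq by blast
  show "Vq i \<subseteq> spec_q ` CC"
  proof
    fix b assume "b \<in> Vq i"
    then obtain l :: int where l: "b = q powi l * t powi 0" unfolding Vq_def by auto
    then have "spec_q b = b" unfolding l spec_q_def qt_exponents by simp
    moreover have "b \<in> CC" unfolding l CC_def by blast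
    ultimately show "b \<in> spec_q ` CC" by (metis imageI)
  qed
qed

lemma ev_q_Xgens: "ev_q ` gring (Xgens i) = qs.K (qs.S i)"
proof -
  have S: "qs.S i = (\<lambda>a. (i, spec_q a)) ` CC"
    "qs.V - qs.S i = (\<lambda>(j, a). (j, spec_q a)) ` ((- {i}) \<times> CC)"
    unfolding qs.S_def unfolding qs.V_def spec_q_image[symmetric] by (force simp: image_iff)+
  have X: "ev_q (frag_of (X_ex j a)) = frag_of (frag_of (j, spec_q a))"
    "ev_q (frag_of (- X_ex j a)) = frag_of (- frag_of (j, spec_q a))" if "a \<in> CC" for j a
    using ev_q_frag_of[OF CCE_frag_of[OF that, of j]] ev_q_frag_of[OF CCE_minus[OF CCE_frag_of[OF that, of j]]]
    by (simp_all add: X_to_z_frag_of X_to_z_minus th_q_frag_of th_q_minus)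
  have xg: "ev_q (xg i a) = qs.gen (i, spec_q a)" if a: "a \<in> CC" for a
    unfolding xg_X_to_z qs.gen_def ev_q_add ev_q_frag_of[OF CCE_frag_of[OF a]]
      ev_q_frag_of[OF CCE_diff[OF CCE_frag_of[OF a] CCE_BX[OF a]]] th_q_diff th_q_BX[OF a] th_q_frag_of
    by (rule refl)
  have "ev_q ` Xgens i = qs.gen ` qs.S i \<union> (\<lambda>y. frag_of (frag_of y)) ` (qs.V - qs.S i)
      \<union> (\<lambda>y. frag_of (- frag_of y)) ` (qs.V - qs.S i)"
    unfolding S(2) unfolding S(1) Xgens_def image_Un image_image
    by (intro arg_cong2[of _ _ _ _ "(\<union>)"] image_cong refl) (auto simp: xg X)
  then show ?thesis
    unfolding qs.K_def
    by (subst gring_image) (use gring_Xgens_LX[of i] in \<open>auto simp: ev_q_1 ev_q_minus ev_q_add intro!: ev_q_mult\<close>)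
qed

lemma Pi_t_K_i: "Pi_t ` K_i i = ts.K (ts.S i)"
  unfolding ev_t_Zgens[symmetric] K_i_at_1[symmetric] image_image Pi_t_ev ..

lemma Pi_q_K_i: "Pi_q ` K_i i = qs.K (qs.S i)"
  unfolding ev_q_Xgens[symmetric] K_i_at_0[symmetric] image_image Pi_q_ev ..

section \<open>The quotient ring\<close>

definition Y :: "'a laurent poly set" where
  "Y = gring (\<Union>i. \<Union>a\<in>CC. {X i a, X_inv i a, gam * z i a, gam * z_inv i a, gam})"

lemma gam_Y: "gam \<in> Y"
  unfolding Y_def using CC_1 by (intro gring_incl) auto

lemma Y_at_1: "(\<lambda>p. poly p 1) ` Y = LZ"
proof -
  let ?H = "\<Union>i. \<Union>a\<in>CC. {X i a, X_inv i a, gam * z i a, gam * z_inv i a, gam}"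
  have img: "(\<lambda>p. poly p 1) ` Y = gring ((\<lambda>p. poly p 1) ` ?H)"
    unfolding Y_def by (rule gring_image) auto
  have "(\<lambda>p. poly p 1) ` ?H \<subseteq> LZ"
    by (auto simp: LZ_def CCE_X_ex CCE_z_ex CCE_minus CCE_zero)
  then have "(\<lambda>p. poly p 1) ` Y \<subseteq> LZ" unfolding img by (rule gring_LZ)
  moreover have "g \<in> gring ((\<lambda>p. poly p 1) ` ?H)" if g: "g \<in> LZ" for g
  proof -
    have unit: "frag_of u \<in> gring ((\<lambda>p. poly p 1) ` ?H)" if "keys u \<subseteq> UNIV \<times> CC" for u
    proof (rule gring_frag_of[OF that])
      fix x :: "'a \<times> complex" assume "x \<in> UNIV \<times> CC"
      then obtain i a where x: "x = (i, a)" "a \<in> CC" by auto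
      have *: "gam * z i a \<in> ?H" "gam * z_inv i a \<in> ?H" using x(2) by blast+
      show "frag_of (frag_of x) \<in> gring ((\<lambda>p. poly p 1) ` ?H) \<and> frag_of (- frag_of x) \<in> gring ((\<lambda>p. poly p 1) ` ?H)"
        using *[THEN gring_poly, of 1] by (simp add: x(1) z_ex_def)
    qed simp
    have "frag_extend frag_of g \<in> gring ((\<lambda>p. poly p 1) ` ?H)"
      by (rule gring_frag_extend) (use g unit in \<open>auto simp: LZ_def CCE_def\<close>)
    then show ?thesis using frag_expansion[of g] by simp
  qed
  ultimately show ?thesis using img by blast
qed

lemma Y_at_0: "(\<lambda>p. poly p 0) ` Y = LX"
proof -
  let ?H = "\<Union>i. \<Union>a\<in>CC. {X i a, X_inv i a, gam * z i a, gam * z_inv i a, gam}"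
  have img: "(\<lambda>p. poly p 0) ` Y = gring ((\<lambda>p. poly p 0) ` ?H)"
    unfolding Y_def by (rule gring_image) auto
  have "0 \<in> LX" by (simp add: LX_def)
  then have "(\<lambda>p. poly p 0) ` ?H \<subseteq> LX" by (auto simp: X_ex_LX)
  then have "(\<lambda>p. poly p 0) ` Y \<subseteq> LX" unfolding img by (rule gring_LX)
  moreover have "g \<in> gring ((\<lambda>p. poly p 0) ` ?H)" if g: "g \<in> LX" for g
  proof -
    have unit: "frag_of (X_to_z e) \<in> gring ((\<lambda>p. poly p 0) ` ?H)" if "keys e \<subseteq> UNIV \<times> CC" for e
    proof (rule gring_frag_of[OF that X_to_z_diff])
      fix x :: "'a \<times> complex" assume "x \<in> UNIV \<times> CC"
      then obtain i a where x: "x = (i, a)" "a \<in> CC" by auto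
      have *: "X i a \<in> ?H" "X_inv i a \<in> ?H" using x(2) by blast+
      show "frag_of (X_to_z (frag_of x)) \<in> gring ((\<lambda>p. poly p 0) ` ?H)
          \<and> frag_of (- X_to_z (frag_of x)) \<in> gring ((\<lambda>p. poly p 0) ` ?H)"
        using *[THEN gring_poly, of 0] by (simp add: x(1) X_to_z_frag_of)
    qed
    have "frag_extend frag_of g \<in> gring ((\<lambda>p. poly p 0) ` ?H)"
      by (rule gring_frag_extend) (use g unit in \<open>auto simp: LX_def CCE_def\<close>)
    then show ?thesis using frag_expansion[of g] by simp
  qed
  ultimately show ?thesis using img by blast
qed

lemma Y_lift:
  assumes "g0 \<in> LX" "g1 \<in> LZ"
  shows "\<exists>y\<in>Y. poly y 0 = g0 \<and> poly y 1 = g1"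
proof -
  obtain y0 y1 where y: "y0 \<in> Y" "poly y0 0 = g0" "y1 \<in> Y" "poly y1 1 = g1"
    using assms unfolding Y_at_0[symmetric] Y_at_1[symmetric] by blast
  have "gam * y1 + (1 - gam) * y0 \<in> Y"
    using y(1,3) gam_Y unfolding Y_def by (intro gring_add gring_mult gring_diff gring_1)
  then show ?thesis using y by (intro bexI[of _ "gam * y1 + (1 - gam) * y0"]) simp_all
qed

lemma K_i_lift:
  assumes "ft \<in> ts.K (ts.S i)" "fq \<in> qs.K (qs.S i)"
  shows "\<exists>p\<in>K_i i. Pi_t p = ft \<and> Pi_q p = fq"
proof -
  obtain p1 p0 where p: "p1 \<in> K_i i" "Pi_t p1 = ft" "p0 \<in> K_i i" "Pi_q p0 = fq"
    using assms unfolding Pi_t_K_i[symmetric] Pi_q_K_i[symmetric] by blast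
  have "gam \<in> K_i i" unfolding K_i_gring by (rule gring_incl) (simp add: Kgen_def)
  then have "gam * p1 + (1 - gam) * p0 \<in> K_i i"
    using p(1,3) unfolding K_i_gring by (intro gring_add gring_mult gring_diff gring_1)
  then show ?thesis
    using p by (intro bexI[of _ "gam * p1 + (1 - gam) * p0"]) (simp_all add: Pi_t_ev Pi_q_ev)
qed

text \<open>Elements of \<open>K_i\<close> need not lie in \<open>Y\<close>. Whether
  \<open>p\<close> denotes a coset depends only on its values at \<open>\<gamma> = 0\<close> and
  \<open>\<gamma> = 1\<close>, and \<open>Y_lift\<close> provides an element of \<open>Y\<close>
  with the same values.\<close>

lemma K_i_Y:
  assumes "p \<in> K_i i"
  shows "\<exists>y\<in>Y. poly y 0 = poly p 0 \<and> poly y 1 = poly p 1"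
proof (rule Y_lift)
  show "poly p 0 \<in> LX" using assms K_i_at_0[of i] gring_Xgens_LX[of i] by blast
  show "poly p 1 \<in> LZ" using assms K_i_at_1[of i] gring_Zgens_LZ[of i] by blast
qed

text \<open>The coset modulo \<open>Ker_tq\<close>, as \<open>carrier_Y_tilde\<close> shows, in a
  form that avoids the ring structure of the quotient.\<close>

definition coset :: "'a laurent poly \<Rightarrow> 'a laurent poly set" where
  "coset y = {y' \<in> Y. Pi_t y' = Pi_t y \<and> Pi_q y' = Pi_q y}"

lemma Pi_diff: "Pi_t (p - p') = Pi_t p - Pi_t p'" "Pi_q (p - p') = Pi_q p - Pi_q p'"
  by (simp_all add: Pi_t_ev Pi_q_ev ev_t_diff ev_q_diff)

lemma carrier_Y_tilde: "carrier Y_tilde = coset ` Y"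
proof -
  have Ytq: "carrier Y_tq = Y" "x \<oplus>\<^bsub>Y_tq\<^esub> y = x + y" for x y
    unfolding Y_tq_def Y_def subring_gen_def by (simp_all add: cring_class_ops_def)
  have "\<zero>\<^bsub>Y_t\<^esub> = 0" "\<zero>\<^bsub>Y_q\<^esub> = 0"
    unfolding Y_t_def Y_q_def subring_gen_def by (simp_all add: cring_class_ops_def)
  then have Ker: "Ker_tq = {y \<in> Y. Pi_t y = 0 \<and> Pi_q y = 0}"
    unfolding Ker_tq_def a_kernel_def' Ytq by auto
  have "Ker_tq +>\<^bsub>Y_tq\<^esub> y = coset y" if y: "y \<in> Y" for y
  proof (intro equalityI subsetI)
    fix y' assume "y' \<in> Ker_tq +>\<^bsub>Y_tq\<^esub> y"
    then obtain h where h: "h \<in> Y" "Pi_t h = 0" "Pi_q h = 0" "y' = h + y"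
      unfolding a_r_coset_def' Ytq Ker by auto
    have "h + y \<in> Y" using h(1) y unfolding Y_def by (rule gring_add)
    then show "y' \<in> coset y"
      using Pi_diff[of "h + y" y] h by (simp add: coset_def)
  next
    fix y' assume y': "y' \<in> coset y"
    then have "y' - y \<in> Y" using y unfolding coset_def Y_def by (auto intro: gring_diff)
    then have "y' - y \<in> Ker_tq" using y' by (simp add: Ker Pi_diff coset_def)
    then have "(y' - y) + y \<in> Ker_tq +>\<^bsub>Y_tq\<^esub> y" unfolding a_r_coset_def' Ytq by blast
    then show "y' \<in> Ker_tq +>\<^bsub>Y_tq\<^esub> y" by simp
  qed
  then show ?thesis
    unfolding Y_tilde_def FactRing_def by (auto simp: A_RCOSETS_def' Ytq)
qed

lemma Pi_tilde:
  assumes "x \<in> carrier Y_tilde" "y \<in> x"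
  shows "Pi_t_tilde x = Pi_t y" "Pi_q_tilde x = Pi_q y" "x = coset y" "y \<in> Y"
proof -
  obtain y0 where y0: "y0 \<in> Y" "x = coset y0" using assms(1) carrier_Y_tilde by blast
  then show "x = coset y" "y \<in> Y" using assms(2) by (auto simp: coset_def)
  then have "Pi_t ` x = {Pi_t y}" "Pi_q ` x = {Pi_q y}" using assms(2) by (auto simp: coset_def)
  then show "Pi_t_tilde x = Pi_t y" "Pi_q_tilde x = Pi_q y"
    by (simp_all add: Pi_t_tilde_def Pi_q_tilde_def)
qed

lemma carrier_nonempty:
  assumes "x \<in> carrier Y_tilde"
  obtains y where "y \<in> x"
  using assms unfolding carrier_Y_tilde by (auto simp: coset_def)

text \<open>The roots 0 and 1 of \<open>gam^2 - gam\<close> differ by a unit, so the two linear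
  factors can be split off one after the other over any commutative ring of coefficients.\<close>

lemma dvd_gam_iff:
  fixes p :: "'a laurent poly"
  shows "(gam ^ 2 - gam) dvd p \<longleftrightarrow> poly p 0 = 0 \<and> poly p 1 = 0"
proof
  assume "(gam ^ 2 - gam) dvd p"
  then show "poly p 0 = 0 \<and> poly p 1 = 0" by (auto simp: dvd_def)
next
  assume p: "poly p 0 = 0 \<and> poly p 1 = 0"
  then obtain p' where p': "p = [:- 0, 1:] * p'" unfolding poly_eq_0_iff_dvd by (auto elim: dvdE)
  then have "poly p' 1 = 0" using p by simp
  then obtain p'' where "p' = [:- 1, 1:] * p''" unfolding poly_eq_0_iff_dvd by (auto elim: dvdE)
  then have "p = (gam ^ 2 - gam) * p''" unfolding p' gam_def by (simp add: power2_eq_square)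
  then show "(gam ^ 2 - gam) dvd p" by simp
qed

lemma denotes_iff:
  "denotes p x \<longleftrightarrow> x \<in> carrier Y_tilde \<and> (\<exists>y\<in>x. poly y 0 = poly p 0 \<and> poly y 1 = poly p 1)"
proof -
  have "poly (p - y) c = 0 \<longleftrightarrow> poly y c = poly p c" for y c by auto
  then show ?thesis unfolding denotes_def dvd_gam_iff by (simp only:)
qed

lemma denotes_Pi:
  assumes "denotes p x"
  shows "Pi_t_tilde x = Pi_t p" "Pi_q_tilde x = Pi_q p"
  using assms Pi_tilde[of x] unfolding denotes_iff Pi_t_ev Pi_q_ev by metis+

lemma tilde_eqI:
  assumes "x \<in> carrier Y_tilde" "x' \<in> carrier Y_tilde"
    and "Pi_t_tilde x = Pi_t_tilde x'" "Pi_q_tilde x = Pi_q_tilde x'"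
  shows "x = x'"
proof -
  obtain y y' where y: "y \<in> x" "y' \<in> x'" using assms(1,2) by (meson carrier_nonempty)
  then have "coset y = coset y'"
    using Pi_tilde(1,2)[OF assms(1) y(1)] Pi_tilde(1,2)[OF assms(2) y(2)] assms(3,4) by (simp add: coset_def)
  then show ?thesis using Pi_tilde(3)[OF assms(1) y(1)] Pi_tilde(3)[OF assms(2) y(2)] by simp
qed

lemma K_L_carrier: "x \<in> K_L \<Longrightarrow> x \<in> carrier Y_tilde"
  unfolding K_L_def denotes_def by blast

lemma K_L_Pi:
  assumes "x \<in> K_L"
  shows "Pi_t_tilde x \<in> ts.K (ts.S i)" "Pi_q_tilde x \<in> qs.K (qs.S i)"
proof -
  obtain p where p: "p \<in> K_i i" "denotes p x" using assms unfolding K_L_def by blast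
  then show "Pi_t_tilde x \<in> ts.K (ts.S i)" "Pi_q_tilde x \<in> qs.K (qs.S i)"
    unfolding denotes_Pi[OF p(2)] Pi_t_K_i[symmetric] Pi_q_K_i[symmetric] by auto
qed

text \<open>The representing polynomials of the various \<open>K_i\<close> may be different. They
  denote the same coset because a coset is determined by the pair \<open>ft\<close>,
  \<open>fq\<close>; the one built from the arbitrary node \<open>undefined\<close> can be
  taken.\<close>

lemma K_L_lift:
  assumes "\<And>i. ft \<in> ts.K (ts.S i)" "\<And>i. fq \<in> qs.K (qs.S i)"
  obtains x where "x \<in> K_L" "Pi_t_tilde x = ft" "Pi_q_tilde x = fq"
proof -
  have "\<exists>p y. p \<in> K_i i \<and> y \<in> Y \<and> poly y 0 = poly p 0 \<and> poly y 1 = poly p 1 \<and> Pi_t y = ft \<and> Pi_q y = fq" for i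
    using K_i_lift[OF assms[of i]] K_i_Y[of _ i] unfolding Pi_t_ev Pi_q_ev by metis
  then obtain p y where py: "\<And>i. p i \<in> K_i i" "\<And>i. y i \<in> Y" "\<And>i. poly (y i) 0 = poly (p i) 0"
    "\<And>i. poly (y i) 1 = poly (p i) 1" "\<And>i. Pi_t (y i) = ft" "\<And>i. Pi_q (y i) = fq" by metis
  define x where "x = coset (y undefined)"
  have x: "x \<in> carrier Y_tilde" unfolding x_def carrier_Y_tilde using py(2) by blast
  have yx: "y i \<in> x" for i unfolding x_def coset_def using py by simp
  have "denotes (p i) x" for i unfolding denotes_iff using x yx py(3,4) by blast
  then have "x \<in> K_L" unfolding K_L_def using py(1) by blast
  then show ?thesis using that Pi_tilde[OF x yx[of undefined]] py(5,6) by simp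
qed

lemma Pi_t_on_V:
  assumes "y \<in> Y"
  shows "ts.on_V (Pi_t y)"
  unfolding ts.on_V_def
proof
  fix u assume "u \<in> keys (Pi_t y)"
  then obtain v where v: "v \<in> keys (poly y 1)" "u = th_t v"
    unfolding Pi_t_ev ev_t_def by (auto elim: keys_frag_extendD)
  have "v \<in> CCE" using v(1) assms Y_at_1 unfolding LZ_def by blast
  show "keys u \<subseteq> ts.V"
  proof
    fix w assume "w \<in> keys u"
    then obtain x where x: "x \<in> keys v" "w \<in> keys (case x of (i, a) \<Rightarrow> z_ex i (Z_param i a))"
      unfolding v(2) th_t_def by (rule keys_frag_extendD)
    then show "w \<in> ts.V" using \<open>v \<in> CCE\<close> by (cases x) (auto simp: z_ex_def ts.V_def Vt_def CCE_def)
  qed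
qed

lemma Pi_q_on_V:
  assumes "y \<in> Y"
  shows "qs.on_V (Pi_q y)"
  unfolding qs.on_V_def
proof
  fix u assume "u \<in> keys (Pi_q y)"
  then obtain v where v: "v \<in> keys (poly y 0)" "u = th_q (z_to_X v)"
    unfolding Pi_q_ev ev_q_def by (auto elim: keys_frag_extendD)
  have "v \<in> X_to_z ` CCE" using v(1) assms Y_at_0 unfolding LX_def by blast
  then obtain e where e: "e \<in> CCE" "u = th_q e" using v(2) z_to_X by auto
  show "keys u \<subseteq> qs.V"
  proof
    fix w assume "w \<in> keys u"
    then obtain x where x: "x \<in> keys e" "w \<in> keys (case x of (i, a) \<Rightarrow> z_ex i (spec_q a))"
      unfolding e(2) th_q_def by (rule keys_frag_extendD)
    then show "w \<in> qs.V" using e(1) spec_q_Vq by (cases x) (auto simp: z_ex_def qs.V_def CCE_def)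
  qed
qed

lemma dominant_nonneg: "dominant S u \<Longrightarrow> keys u \<subseteq> S \<Longrightarrow> nonneg_expo u"
  unfolding nonneg_expo_def dominant_def by (metis in_keys_iff order_refl subsetD)

theorem unique_F:
  assumes "is_dominant_monomial m"
  shows "\<exists>!F. F \<in> K_L \<and> is_unique_dominant_monomial_of m F"
proof -
  have m: "m \<in> carrier Y_tilde"
    using assms unfolding is_dominant_monomial_def is_monomial_def denotes_def by blast
  obtain y where y: "y \<in> m" using m by (rule carrier_nonempty)
  obtain ft where ft: "\<And>i. ft \<in> ts.K (ts.S i)" "\<And>u. u \<in> keys (ft - Pi_t y) \<Longrightarrow> \<not> dominant ts.V u"
    using ts.unique_dominant_correction[OF Pi_t_on_V[OF Pi_tilde(4)[OF m y]]] by blast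
  obtain fq where fq: "\<And>i. fq \<in> qs.K (qs.S i)" "\<And>u. u \<in> keys (fq - Pi_q y) \<Longrightarrow> \<not> dominant qs.V u"
    using qs.unique_dominant_correction[OF Pi_q_on_V[OF Pi_tilde(4)[OF m y]]] by blast
  obtain F where F: "F \<in> K_L" "Pi_t_tilde F = ft" "Pi_q_tilde F = fq"
    using ft(1) fq(1) by (rule K_L_lift)
  have nonneg: "nonneg_expo u \<Longrightarrow> dominant S u" for u and S :: "('a \<times> complex) set"
    unfolding nonneg_expo_def dominant_def by blast
  have "is_unique_dominant_monomial_of m F"
    unfolding is_unique_dominant_monomial_of_def F Pi_tilde(1,2)[OF m y] using ft(2) fq(2) nonneg by blast
  moreover have "F1 = F2" if F1: "F1 \<in> K_L" "is_unique_dominant_monomial_of m F1"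
    and F2: "F2 \<in> K_L" "is_unique_dominant_monomial_of m F2" for F1 F2
  proof (rule tilde_eqI[OF K_L_carrier[OF F1(1)] K_L_carrier[OF F2(1)]])
    note dom = F1(2)[unfolded is_unique_dominant_monomial_of_def] F2(2)[unfolded is_unique_dominant_monomial_of_def]
    show "Pi_t_tilde F1 = Pi_t_tilde F2"
      by (rule ts.unique_dominant_unique[of _ _ "Pi_t_tilde m"])
        (use K_L_Pi(1) F1(1) F2(1) dom dominant_nonneg in blast)+
    show "Pi_q_tilde F1 = Pi_q_tilde F2"
      by (rule qs.unique_dominant_unique[of _ _ "Pi_q_tilde m"])
        (use K_L_Pi(2) F1(1) F2(1) dom dominant_nonneg in blast)+
  qed
  ultimately show ?thesis using F(1) by (intro ex1I[of _ F]) auto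
qed

end

theorem theorem6p8:
  fixes C :: "'i::finite \<Rightarrow> 'i \<Rightarrow> int"
    and d :: "'i \<Rightarrow> nat" and r :: nat
    and q t :: complex and phi :: "'i \<Rightarrow> nat"
    and m :: "'i laurent poly set"
  assumes "langlands_setting C d r q t phi"
    and "r \<in> {2, 3}"
    and "langlands_setting.is_dominant_monomial d r q t phi m"
  shows "\<exists>!F. F \<in> langlands_setting.K_L C d r q t phi \<and>
              langlands_setting.is_unique_dominant_monomial_of d r q t phi m F"
proof -
  interpret langlands_lacing C d r q t phi
    using assms(1,2) by (intro langlands_lacing.intro langlands_lacing_axioms.intro)
  show ?thesis using assms(3) by (rule unique_F)
qed

end
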